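(* There exist universal constants $c_{partial}>0$ and $\gamma>0$ such that the following holds. Let $D\subset\mathbb{R}^n$ and let $f:D\to\mathbb{R}$ satisfy the approximate Hessian sparsity assumption (see context) with constants $\kappa'_{ef},\kappa'_{eg},\kappa'_{eh}$. Then there exist constants $\kappa_{ef},\kappa_{eg},\kappa_{eh}>0$, not depending on $x_0$ and $\Delta$, such that for every $x_0\in D$ and $\Delta>0$ with $B_\infty(x_0;\Delta)\subset D$ the following is true. Let $h$ be the sparsity level, corresponding to $x_0$ and $\Delta$, of the fully quadratic model guaranteed by the assumption. Let $Y=\{y^1,\dots,y^p\}$ be a set of $p$ random points drawn independently according to the uniform probability measure on $B_\infty(0;\Delta)$, with $$\frac{p}{\log p}\;\ge\; 9\,c_{partial}\,(h+n+1)\,\bigl(\log(h+n+1)\bigr)^2\,\log q,\qquad q=\frac{(n+1)(n+2)}{2}.$$ Then, with probability larger than $1-n^{-\gamma\log p}$, the quadratic $m^*(x)=\tilde m^*(x-x_0)$, where $\tilde m^*(z)=\sum_{l}\alpha^*_l\psi_l(z)$ and $\alpha^*=(\alpha_Q^*,\alpha_L^* )$ is the solution of $$\min_{\alpha=(\alpha_Q,\alpha_L)\in\mathbb{R}^q}\ \|\alpha_Q\|_1\quad\text{s.t.}\quad \bigl\|M(\psi_Q,Y)\alpha_Q+M(\psi_L,Y)\alpha_L-f(Y+x_0)\bigr\|_2\le\eta,\qquad \eta=\sqrt{p}\,\kappa'_{ef}\Delta^3,$$ is a fully quadratic model of $f$ on $B_\infty(x_0;\Delta)$ with constants $\kappa_{ef},\kappa_{eg},\kappa_{eh}$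 and $\nu_2^{m^*}=0$.
   Context: Notation: $B_\infty(x;\Delta)=\{y\in\mathbb{R}^n:\|y-x\|_\infty\le\Delta\}$. For matrices, $\|\cdot\|_2$ is the spectral norm. A vector is $h$-sparse if it has at most $h$ non-zero entries. Basis $\psi$ (depending on $\Delta$) of the space of polynomials of degree at most $2$ on $\mathbb{R}^n$, with $q=(n+1)(n+2)/2$ elements: $\psi_{2,i}(x)=\frac{3\sqrt5}{2\Delta^2}x_i^2-\frac{\sqrt5}{2}$ ($1\le i\le n$), $\psi_{2,ij}(x)=\frac{3}{\Delta^2}x_ix_j$ ($1\le i<j\le n$), $\psi_{1,i}(x)=\frac{\sqrt3}{\Delta}x_i$ ($1\le i\le n$), $\psi_0(x)=1$. $\psi_Q$ is the subset of elements of degree $2$ (the $\psi_{2,i}$ and $\psi_{2,ij}$), and $\psi_L$ the subset of elements of degree $1$ or $0$. A coefficient vector $\alpha\in\mathbb{R}^q$ is split accordingly as $(\alpha_Q,\alpha_L)$. For $Y=\{y^1,\dots,y^p\}$, $M(\psi_Q,Y)$ and $M(\psi_L,Y)$ are the matrices whose $i$-th row consists of the values at $y^i$ of the elements of $\psi_Q$, respectively $\psi_L$; $f(Y+x_0)\in\mathbb{R}^p$ has entries $f(y^i+x_0)$. Fully quadratic model: a $C^2$ function $m$ is a fully quadratic model of $f$ on $B_\infty(x_0;\Delta)$ with constants $\kappa_{ef},\kappa_{eg},\kappa_{eh}$ and $\nu_2^m$ if $\nabla^2 m$ is Lipschitz continuous with Lipschitz constant at most $\nu_2^m$ and, for all $x\in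 B_\infty(x_0;\Delta)$, $\|\nabla^2f(x)-\nabla^2m(x)\|_2\le\kappa_{eh}\Delta$, $\|\nabla f(x)-\nabla m(x)\|_2\le\kappa_{eg}\Delta^2$, and $|f(x)-m(x)|\le\kappa_{ef}\Delta^3$. Approximate Hessian sparsity assumption on $f:D\to\mathbb{R}$ with constants $\kappa'_{ef},\kappa'_{eg},\kappa'_{eh}>0$: $f$ is twice differentiable with Lipschitz continuous Hessian on an open set containing $D$; and for any $x_0\in D$ and $\Delta>0$ (with $B_\infty(x_0;\Delta)\subset D$) there exists a polynomial of degree at most two $m(x)=\sum_l\alpha_l\psi_l(x)$, with $\alpha_Q$ an $h$-sparse vector, where $h\in\{1,\dots,n(n+1)/2\}$ may depend on $x_0$ and $\Delta$, which is a fully quadratic model of $f$ on $B_\infty(x_0;\Delta)$ with the constants $\kappa'_{ef},\kappa'_{eg},\kappa'_{eh}$, these constants being independent of $x_0$ and $\Delta$. *)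

theory Defs
  imports "HOL-Analysis.Analysis"
begin

text \<open>
  The constants in the theorem are universal over all dimensions, so the dimension \<open>n\<close> has to be
  a bound variable and cannot be a type index. A vector of \<open>\<real>\<^sup>n\<close> is therefore an extensional
  function on \<open>{1..n}\<close>; this is exactly the underlying space of
  \<^term>\<open>PiM {1..n} (\<lambda>_. lborel :: real measure)\<close>. The topology of \<^typ>\<open>nat \<Rightarrow> real\<close> (pointwise
  convergence) restricted to this set is the Euclidean topology.
\<close>

type_synonym rvec = "nat \<Rightarrow> real"

definition Rn :: "nat \<Rightarrow> rvec set" where
  "Rn n = ({1..n} \<rightarrow>\<^sub>E UNIV)"

definition vzero :: "nat \<Rightarrow> rvec" where
  "vzero n = (\<lambda>i\<in>{1..n}. 0)"

definition vadd :: "nat \<Rightarrow> rvec \<Rightarrow> rvec \<Rightarrow> rvec" where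
  "vadd n x y = (\<lambda>i\<in>{1..n}. x i + y i)"

definition vsub :: "nat \<Rightarrow> rvec \<Rightarrow> rvec \<Rightarrow> rvec" where
  "vsub n x y = (\<lambda>i\<in>{1..n}. x i - y i)"

definition norm2 :: "nat \<Rightarrow> rvec \<Rightarrow> real" where
  "norm2 n x = L2_set x {1..n}"

text \<open>Meaningful for \<open>n \<ge> 1\<close> only.\<close>
definition norm_inf :: "nat \<Rightarrow> rvec \<Rightarrow> real" where
  "norm_inf n x = Max ((\<lambda>i. \<bar>x i\<bar>) ` {1..n})"

definition B_inf :: "nat \<Rightarrow> rvec \<Rightarrow> real \<Rightarrow> rvec set" where
  "B_inf n x \<Delta> = {y \<in> Rn n. norm_inf n (vsub n y x) \<le> \<Delta>}"

definition spectral_norm :: "nat \<Rightarrow> (nat \<Rightarrow> nat \<Rightarrow> real) \<Rightarrow> real" where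
  "spectral_norm n A =
    (SUP v \<in> {v \<in> Rn n. norm2 n v \<le> 1}. norm2 n (\<lambda>i. \<Sum>j\<in>{1..n}. A i j * v j))"


subsection \<open>Gradients and Hessians\<close>

text \<open>Frechet differentiability on \<^term>\<open>Rn n\<close>, with the derivative represented by its gradient
  (compare \<^const>\<open>has_derivative\<close> and \<^const>\<open>gderiv\<close>, whose type classes do not cover \<^typ>\<open>rvec\<close>).\<close>
definition has_gradient :: "nat \<Rightarrow> (rvec \<Rightarrow> real) \<Rightarrow> rvec \<Rightarrow> rvec \<Rightarrow> bool" where
  "has_gradient n f g x \<longleftrightarrow> g \<in> Rn n \<and>
    ((\<lambda>y. (f y - f x - (\<Sum>i\<in>{1..n}. g i * (y i - x i))) / norm2 n (vsub n y x)) \<longlongrightarrow> 0)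
      (at x within Rn n)"

definition gradient :: "nat \<Rightarrow> (rvec \<Rightarrow> real) \<Rightarrow> rvec \<Rightarrow> rvec" where
  "gradient n f x = (THE g. has_gradient n f g x)"

definition hessian :: "nat \<Rightarrow> (rvec \<Rightarrow> real) \<Rightarrow> rvec \<Rightarrow> nat \<Rightarrow> nat \<Rightarrow> real" where
  "hessian n f x i = gradient n (\<lambda>y. gradient n f y i) x"

text \<open>Intended for sets \<open>S\<close> that are open in \<^term>\<open>Rn n\<close>.\<close>
definition twice_differentiable_on :: "nat \<Rightarrow> rvec set \<Rightarrow> (rvec \<Rightarrow> real) \<Rightarrow> bool" where
  "twice_differentiable_on n S f \<longleftrightarrow>
    (\<forall>x\<in>S. (\<exists>g. has_gradient n f g x) \<and>
      (\<forall>i\<in>{1..n}. \<exists>g. has_gradient n (\<lambda>y. gradient n f y i) g x))"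

definition C2 :: "nat \<Rightarrow> (rvec \<Rightarrow> real) \<Rightarrow> bool" where
  "C2 n m \<longleftrightarrow> twice_differentiable_on n (Rn n) m \<and>
    (\<forall>i\<in>{1..n}. \<forall>j\<in>{1..n}. continuous_on (Rn n) (\<lambda>x. hessian n m x i j))"

definition hessian_lipschitz_on :: "nat \<Rightarrow> real \<Rightarrow> rvec set \<Rightarrow> (rvec \<Rightarrow> real) \<Rightarrow> bool" where
  "hessian_lipschitz_on n L S f \<longleftrightarrow> 0 \<le> L \<and>
    (\<forall>x\<in>S. \<forall>y\<in>S. spectral_norm n (\<lambda>i j. hessian n f x i j - hessian n f y i j)
                     \<le> L * norm2 n (vsub n x y))"

text \<open>The model \<open>m\<close> is a function on all of \<open>\<real>\<^sup>n\<close>. The function \<open>f\<close> is understood to be twice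
  differentiable at the points of the ball; otherwise its gradient is unspecified.\<close>
definition fully_quadratic_model ::
  "nat \<Rightarrow> (rvec \<Rightarrow> real) \<Rightarrow> (rvec \<Rightarrow> real) \<Rightarrow> rvec \<Rightarrow> real \<Rightarrow> real \<Rightarrow> real \<Rightarrow> real \<Rightarrow> real \<Rightarrow> bool" where
  "fully_quadratic_model n f m x0 \<Delta> \<kappa>ef \<kappa>eg \<kappa>eh \<nu> \<longleftrightarrow>
    C2 n m \<and> hessian_lipschitz_on n \<nu> (Rn n) m \<and>
    (\<forall>x \<in> B_inf n x0 \<Delta>.
      spectral_norm n (\<lambda>i j. hessian n f x i j - hessian n m x i j) \<le> \<kappa>eh * \<Delta> \<and>
      norm2 n (vsub n (gradient n f x) (gradient n m x)) \<le> \<kappa>eg * \<Delta> ^ 2 \<and>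
      \<bar>f x - m x\<bar> \<le> \<kappa>ef * \<Delta> ^ 3)"


subsection \<open>The basis\<close>

text \<open>Names for the basis elements: \<open>Sq i\<close>, \<open>Mixed i j\<close>, \<open>Lin i\<close> and \<open>Const\<close> stand for
  \<open>\<psi>\<^bsub>2,i\<^esub>\<close>, \<open>\<psi>\<^bsub>2,ij\<^esub>\<close>, \<open>\<psi>\<^bsub>1,i\<^esub>\<close> and \<open>\<psi>\<^sub>0\<close>. A coefficient vector is a function on these names of which
  only the values on \<open>Q_idx n \<union> L_idx n\<close> matter; its parts \<open>\<alpha>\<^sub>Q\<close> and \<open>\<alpha>\<^sub>L\<close> are its values on
  \<open>Q_idx n\<close> and on \<open>L_idx n\<close>.\<close>
datatype psi_name = Sq nat | Mixed nat nat | Lin nat | Const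

definition Q_idx :: "nat \<Rightarrow> psi_name set" where
  "Q_idx n = {Sq i |i. 1 \<le> i \<and> i \<le> n} \<union> {Mixed i j |i j. 1 \<le> i \<and> i < j \<and> j \<le> n}"

definition L_idx :: "nat \<Rightarrow> psi_name set" where
  "L_idx n = {Lin i |i. 1 \<le> i \<and> i \<le> n} \<union> {Const}"

fun psi :: "real \<Rightarrow> psi_name \<Rightarrow> rvec \<Rightarrow> real" where
  "psi \<Delta> (Sq i) x = 3 * sqrt 5 / (2 * \<Delta> ^ 2) * (x i) ^ 2 - sqrt 5 / 2"
| "psi \<Delta> (Mixed i j) x = 3 / \<Delta> ^ 2 * x i * x j"
| "psi \<Delta> (Lin i) x = sqrt 3 / \<Delta> * x i"
| "psi \<Delta> Const x = 1"

definition quad_poly :: "nat \<Rightarrow> real \<Rightarrow> (psi_name \<Rightarrow> real) \<Rightarrow> rvec \<Rightarrow> real" where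
  "quad_poly n \<Delta> \<alpha> x = (\<Sum>l \<in> Q_idx n \<union> L_idx n. \<alpha> l * psi \<Delta> l x)"

definition sparse_on :: "'i set \<Rightarrow> nat \<Rightarrow> ('i \<Rightarrow> real) \<Rightarrow> bool" where
  "sparse_on I h \<alpha> \<longleftrightarrow> card {l \<in> I. \<alpha> l \<noteq> 0} \<le> h"


subsection \<open>The approximate Hessian sparsity assumption\<close>

text \<open>The Lipschitz constant of the Hessian of the model is \<open>0\<close> because a polynomial of degree at
  most two has a constant Hessian.\<close>
definition sparsity_level ::
  "nat \<Rightarrow> (rvec \<Rightarrow> real) \<Rightarrow> real \<Rightarrow> real \<Rightarrow> real \<Rightarrow> rvec \<Rightarrow> real \<Rightarrow> nat \<Rightarrow> bool" where
  "sparsity_level n f \<kappa>ef \<kappa>eg \<kappa>eh x0 \<Delta> h \<longleftrightarrow>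
    h \<in> {1..n * (n + 1) div 2} \<and>
    (\<exists>\<alpha>. sparse_on (Q_idx n) h \<alpha> \<and>
         fully_quadratic_model n f (quad_poly n \<Delta> \<alpha>) x0 \<Delta> \<kappa>ef \<kappa>eg \<kappa>eh 0)"

definition approx_hessian_sparsity ::
  "nat \<Rightarrow> rvec set \<Rightarrow> (rvec \<Rightarrow> real) \<Rightarrow> real \<Rightarrow> real \<Rightarrow> real \<Rightarrow> bool" where
  "approx_hessian_sparsity n D f \<kappa>ef \<kappa>eg \<kappa>eh \<longleftrightarrow>
    0 < \<kappa>ef \<and> 0 < \<kappa>eg \<and> 0 < \<kappa>eh \<and>
    (\<exists>\<Omega>. openin (top_of_set (Rn n)) \<Omega> \<and> D \<subseteq> \<Omega> \<and> twice_differentiable_on n \<Omega> f \<and>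
         (\<exists>L. hessian_lipschitz_on n L \<Omega> f)) \<and>
    (\<forall>x0\<in>D. \<forall>\<Delta>>0. B_inf n x0 \<Delta> \<subseteq> D \<longrightarrow> (\<exists>h. sparsity_level n f \<kappa>ef \<kappa>eg \<kappa>eh x0 \<Delta> h))"


subsection \<open>The random sample and the optimization problem\<close>

text \<open>The joint law of \<open>p\<close> independent points, each uniform on the ball \<open>B\<^sub>\<infinity>(0;\<Delta>)\<close>; an outcome \<open>Y\<close>
  is the family \<open>Y 1, \<dots>, Y p\<close>.\<close>
definition sample_measure :: "nat \<Rightarrow> nat \<Rightarrow> real \<Rightarrow> (nat \<Rightarrow> rvec) measure" where
  "sample_measure n p \<Delta> =
    PiM {1..p} (\<lambda>_. uniform_measure (PiM {1..n} (\<lambda>_. lborel)) (B_inf n (vzero n) \<Delta>))"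

definition interp_matrix :: "real \<Rightarrow> (nat \<Rightarrow> rvec) \<Rightarrow> nat \<Rightarrow> psi_name \<Rightarrow> real" where
  "interp_matrix \<Delta> Y i l = psi \<Delta> l (Y i)"

definition feasible ::
  "nat \<Rightarrow> nat \<Rightarrow> real \<Rightarrow> (rvec \<Rightarrow> real) \<Rightarrow> rvec \<Rightarrow> (nat \<Rightarrow> rvec) \<Rightarrow> real \<Rightarrow> (psi_name \<Rightarrow> real) \<Rightarrow> bool" where
  "feasible n p \<Delta> f x0 Y \<eta> \<alpha> \<longleftrightarrow>
    norm2 p (\<lambda>i. (\<Sum>l\<in>Q_idx n. interp_matrix \<Delta> Y i l * \<alpha> l)
               + (\<Sum>l\<in>L_idx n. interp_matrix \<Delta> Y i l * \<alpha> l)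
               - f (vadd n (Y i) x0)) \<le> \<eta>"

definition is_solution ::
  "nat \<Rightarrow> nat \<Rightarrow> real \<Rightarrow> (rvec \<Rightarrow> real) \<Rightarrow> rvec \<Rightarrow> (nat \<Rightarrow> rvec) \<Rightarrow> real \<Rightarrow> (psi_name \<Rightarrow> real) \<Rightarrow> bool" where
  "is_solution n p \<Delta> f x0 Y \<eta> \<alpha> \<longleftrightarrow>
    is_arg_min (\<lambda>\<beta>. \<Sum>l\<in>Q_idx n. \<bar>\<beta> l\<bar>) (feasible n p \<Delta> f x0 Y \<eta>) \<alpha>"

end

theory Submission
  imports Defs "HOL-Probability.Probability"
begin

text \<open>
  Let \<open>v\<close> be the difference between a minimizer and the coefficient vector of the sparse model given by
  the assumption (re-expanded around \<open>x0\<close>, which does not change its quadratic part). Minimality puts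
  \<open>v\<close> in the cone \<open>\<parallel>v\<parallel>\<^sub>1 \<le> 2 \<surd>s \<parallel>v\<parallel>\<^sub>2\<close> with \<open>s = h + n + 1\<close>, and feasibility of both vectors bounds
  the empirical norm of the polynomial of \<open>v\<close> by \<open>2 \<kappa>ef' \<Delta>\<^sup>3\<close>. So only a lower bound of the empirical
  norm on the cone is needed, not a full restricted isometry property.

  By Maurey's argument every vector of the cone is close, in the Euclidean and the empirical norm
  simultaneously, to a multiple of a sum of \<open>1000 s\<close> signed unit vectors, of which there are at most
  \<open>(2 q)\<close> to the power \<open>1000 s\<close>. For each fixed vector, a hypercontractive inequality
  \<open>E g\<^sup>4 \<le> C (E g\<^sup>2)\<^sup>2\<close> for quadratic polynomials \<open>g\<close> makes the lower tail of the empirical second moment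
  exponentially small in \<open>p\<close>, and the union bound over this finite set gives the claim.
\<close>

subsection \<open>Gradients on \<open>Rn n\<close>\<close>

text \<open>The difficulty is to pass from finitely many vectors to the whole cone. The error
  vectors of an approximation need not lie in the cone, so nothing is known about their sampled
  values; these values are therefore carried along as additional coordinates of the approximation.
  Bounds on the basis elements are enough for this step, but not for the tails: a polynomial with
  unit coefficient vector can be as large as \<open>sqrt q\<close> on the cube. The tail estimate
  rests on moments instead, because a sum of nonnegative terms is rarely small as soon as its fourth
  moments are controlled, at a rate free of the dimension. The constants form a chain: 72 * 120 =
  8640 is the fourth moment constant, 8 * 8640 = 69120 gives the rate p / 69120, and 250 * (2 sqrt
  s)^2 = 1000 s is the number of signed unit vectors. The logarithm of the number of test vectors is
  of order s ln q, so the hypothesis on p leaves a factor ln p to spare, and this factor pays for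
  the failure probability with exponent - ln p. The constants of the final model are chosen after n,
  so crude powers of n are acceptable in them.\<close>

lemma norm2_vsub: "norm2 n (vsub n y x) = L2_set (\<lambda>i. y i - x i) {1..n}"
  by (simp add: norm2_def vsub_def L2_set_def)

lemma abs_le_norm2: "i \<in> {1..n} \<Longrightarrow> \<bar>x i\<bar> \<le> norm2 n x"
  unfolding norm2_def using member_le_L2_set[of "{1..n}" i "\<lambda>i. \<bar>x i\<bar>"] by (simp add: L2_set_def)

lemma tendsto_norm2_vsub: "((\<lambda>y. norm2 n (vsub n y x)) \<longlongrightarrow> 0) (at x within S)"
proof -
  have "((\<lambda>y::rvec. y i) \<longlongrightarrow> x i) (at x within S)" for i
    by (rule tendsto_within_subset[OF _ subset_UNIV])
      (rule continuous_on_product_coordinates[unfolded continuous_on_def, rule_format, OF UNIV_I])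
  then have "((\<lambda>y. sqrt (\<Sum>i\<in>{1..n}. (y i - x i)\<^sup>2)) \<longlongrightarrow> sqrt (\<Sum>i\<in>{1..n}. (x i - x i)\<^sup>2)) (at x within S)"
    by (intro tendsto_real_sqrt tendsto_sum tendsto_power tendsto_diff tendsto_const)
  then show ?thesis
    by (simp add: norm2_vsub L2_set_def)
qed

text \<open>\<open>Rn n\<close> is a thin subset of its type, so two gradients are compared along
  coordinate rays that stay inside it. The difference of the two defining quotients tends to 0 and
  is constant along such a ray. Indices outside \<open>{1..n}\<close> are settled by
  extensionality.\<close>

lemma has_gradient_unique:
  assumes g: "has_gradient n f g x" "has_gradient n f g' x" and x: "x \<in> Rn n"
  shows "g = g'"
proof
  fix j
  show "g j = g' j"
  proof (cases "j \<in> {1..n}")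
    case False
    with g show ?thesis
      by (auto simp: has_gradient_def Rn_def PiE_def extensional_def)
  next
    case j: True
    \<comment> \<open>Only \<open>t > 0\<close> is used: the distance to \<open>x\<close> is then
      \<open>t\<close> itself, and the quotient is exactly \<open>g j - g' j\<close>.\<close>
    define c where "c t = x(j := x j + t)" for t :: real
    define r where "r y = (\<Sum>i\<in>{1..n}. (g i - g' i) * (y i - x i)) / norm2 n (vsub n y x)" for y
    have "(r \<longlongrightarrow> 0) (at x within Rn n)"
    proof -
      from g have "((\<lambda>y. (f y - f x - (\<Sum>i\<in>{1..n}. g' i * (y i - x i))) / norm2 n (vsub n y x)
          - (f y - f x - (\<Sum>i\<in>{1..n}. g i * (y i - x i))) / norm2 n (vsub n y x)) \<longlongrightarrow> 0 - 0)
          (at x within Rn n)"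
        unfolding has_gradient_def by (intro tendsto_diff) auto
      then show ?thesis
        unfolding r_def by (simp add: diff_divide_distrib[symmetric] left_diff_distrib sum_subtractf)
    qed
    moreover have "filterlim c (at x within Rn n) (at_right 0)"
    proof -
      have "continuous_on UNIV c"
        unfolding c_def
      proof (rule continuous_on_coordinatewise_then_product)
        show "continuous_on UNIV (\<lambda>t. (x(j := x j + t)) i)" for i
          by (cases "i = j") (auto intro!: continuous_intros)
      qed
      then have "(c \<longlongrightarrow> c 0) (at_right 0)"
        unfolding continuous_on_def by (blast intro: tendsto_within_subset[OF _ subset_UNIV])
      moreover have "c 0 = x" "c t \<in> Rn n" "t > 0 \<Longrightarrow> c t \<noteq> x" for t
        using x j by (auto simp: c_def Rn_def PiE_def extensional_def fun_eq_iff)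
      ultimately show ?thesis
        unfolding filterlim_at by (auto simp: eventually_at_filter)
    qed
    ultimately have "((\<lambda>t. r (c t)) \<longlongrightarrow> 0) (at_right 0)"
      by (rule filterlim_compose)
    moreover have "r (c t) = g j - g' j" if "t > 0" for t
    proof -
      have "(\<Sum>i\<in>{1..n}. (g i - g' i) * (c t i - x i)) = (\<Sum>i\<in>{1..n}. if i = j then (g j - g' j) * t else 0)"
        by (intro sum.cong) (auto simp: c_def)
      moreover have "(\<Sum>i\<in>{1..n}. (c t i - x i)\<^sup>2) = (\<Sum>i\<in>{1..n}. if i = j then t\<^sup>2 else 0)"
        by (intro sum.cong) (auto simp: c_def)
      ultimately show ?thesis
        using that j by (simp add: r_def norm2_vsub L2_set_def)
    qed
    then have "eventually (\<lambda>t. r (c t) = g j - g' j) (at_right 0)"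
      by (simp add: eventually_at_filter)
    ultimately have "((\<lambda>t::real. g j - g' j) \<longlongrightarrow> 0) (at_right 0)"
      by (rule Lim_transform_eventually)
    then show ?thesis
      by (simp add: tendsto_const_iff)
  qed
qed

lemma gradient_eqI: "has_gradient n f g x \<Longrightarrow> x \<in> Rn n \<Longrightarrow> gradient n f x = g"
  unfolding gradient_def using has_gradient_unique by blast

text \<open>Gradients of models are computed at points of \<open>Rn n\<close> only, so the functions
  differentiated for the Hessian are known only there. The limit is taken within
  \<open>Rn n\<close>, which makes this sufficient.\<close>

lemma has_gradient_cong:
  assumes "\<And>y. y \<in> Rn n \<Longrightarrow> f y = f' y" "x \<in> Rn n" "has_gradient n f g x"
  shows "has_gradient n f' g x"
proof -
  have "eventually (\<lambda>y. (f y - f x - (\<Sum>i\<in>{1..n}. g i * (y i - x i))) / norm2 n (vsub n y x)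
      = (f' y - f' x - (\<Sum>i\<in>{1..n}. g i * (y i - x i))) / norm2 n (vsub n y x)) (at x within Rn n)"
    unfolding eventually_at_filter using assms(1)[OF assms(2)] by (intro always_eventually) (simp add: assms(1))
  from tendsto_cong[OF this] assms(3) show ?thesis
    unfolding has_gradient_def by simp
qed

lemma sum_sum_mult_bound:
  fixes A :: "'a \<Rightarrow> 'b \<Rightarrow> real"
  assumes "\<And>i. i \<in> I \<Longrightarrow> \<bar>d i\<bar> \<le> r" "\<And>j. j \<in> J \<Longrightarrow> \<bar>e j\<bar> \<le> s" "0 \<le> r"
  shows "\<bar>\<Sum>i\<in>I. \<Sum>j\<in>J. A i j * d i * e j\<bar> \<le> (\<Sum>i\<in>I. \<Sum>j\<in>J. \<bar>A i j\<bar>) * (r * s)"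
proof -
  have "\<bar>\<Sum>i\<in>I. \<Sum>j\<in>J. A i j * d i * e j\<bar> \<le> (\<Sum>i\<in>I. \<Sum>j\<in>J. \<bar>A i j * d i * e j\<bar>)"
    by (rule order_trans[OF sum_abs sum_mono]) (rule sum_abs)
  also have "\<dots> \<le> (\<Sum>i\<in>I. \<Sum>j\<in>J. \<bar>A i j\<bar> * (r * s))"
    using assms by (intro sum_mono) (auto simp: abs_mult mult.assoc intro!: mult_left_mono mult_mono)
  finally show ?thesis
    by (simp add: sum_distrib_right)
qed

text \<open>Taylor form at \<open>z\<close>: for symmetric \<open>A\<close> the data are the value,
  gradient and Hessian at \<open>z\<close>. Changing the centre affects \<open>c\<close> and
  \<open>b\<close> but not \<open>A\<close>.\<close>

definition quad_fun ::
  "nat \<Rightarrow> real \<Rightarrow> (nat \<Rightarrow> real) \<Rightarrow> (nat \<Rightarrow> nat \<Rightarrow> real) \<Rightarrow> rvec \<Rightarrow> rvec \<Rightarrow> real" where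
  "quad_fun n c b A z y = c + (\<Sum>i\<in>{1..n}. b i * (y i - z i))
     + (\<Sum>i\<in>{1..n}. \<Sum>j\<in>{1..n}. A i j * (y i - z i) * (y j - z j)) / 2"

text \<open>The exact Taylor expansion at \<open>x\<close>. Symmetry of \<open>A\<close> merges the
  two cross terms into one, which cancels the factor 1/2. It provides both the gradient and the
  change of centre.\<close>

lemma quad_fun_expand:
  assumes A: "\<And>i j. A i j = A j i"
  shows "quad_fun n c b A z y = quad_fun n c b A z x
    + (\<Sum>i\<in>{1..n}. (b i + (\<Sum>j\<in>{1..n}. A i j * (x j - z j))) * (y i - x i))
    + (\<Sum>i\<in>{1..n}. \<Sum>j\<in>{1..n}. A i j * (y i - x i) * (y j - x j)) / 2"
proof -
  define u d where "u i = x i - z i" and "d i = y i - x i" for i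
  have yz: "y i - z i = u i + d i" for i
    by (simp add: u_def d_def)
  have "(\<Sum>i\<in>{1..n}. \<Sum>j\<in>{1..n}. A i j * (u i + d i) * (u j + d j)) =
      (\<Sum>i\<in>{1..n}. \<Sum>j\<in>{1..n}. A i j * u i * u j) + (\<Sum>i\<in>{1..n}. \<Sum>j\<in>{1..n}. A i j * d i * d j)
      + (\<Sum>i\<in>{1..n}. \<Sum>j\<in>{1..n}. A i j * u i * d j) + (\<Sum>i\<in>{1..n}. \<Sum>j\<in>{1..n}. A i j * u j * d i)"
    by (simp add: sum.distrib[symmetric] algebra_simps)
  also have "(\<Sum>i\<in>{1..n}. \<Sum>j\<in>{1..n}. A i j * u i * d j) = (\<Sum>i\<in>{1..n}. \<Sum>j\<in>{1..n}. A i j * u j * d i)"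
    by (subst sum.swap) (simp add: A)
  finally have "(\<Sum>i\<in>{1..n}. \<Sum>j\<in>{1..n}. A i j * (u i + d i) * (u j + d j)) =
      (\<Sum>i\<in>{1..n}. \<Sum>j\<in>{1..n}. A i j * u i * u j) + (\<Sum>i\<in>{1..n}. \<Sum>j\<in>{1..n}. A i j * d i * d j)
      + 2 * (\<Sum>i\<in>{1..n}. \<Sum>j\<in>{1..n}. A i j * u j * d i)"
    by simp
  moreover have "(\<Sum>i\<in>{1..n}. (b i + (\<Sum>j\<in>{1..n}. A i j * u j)) * d i) =
      (\<Sum>i\<in>{1..n}. b i * d i) + (\<Sum>i\<in>{1..n}. \<Sum>j\<in>{1..n}. A i j * u j * d i)"
    by (simp add: distrib_right sum.distrib sum_distrib_right)
  moreover have "(\<Sum>i\<in>{1..n}. b i * (u i + d i)) = (\<Sum>i\<in>{1..n}. b i * u i) + (\<Sum>i\<in>{1..n}. b i * d i)"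
    by (simp add: distrib_left sum.distrib)
  ultimately show ?thesis
    unfolding quad_fun_def yz u_def[symmetric] d_def[symmetric] by linarith
qed

lemma has_gradient_quad_fun:
  assumes A: "\<And>i j. A i j = A j i"
  shows "has_gradient n (quad_fun n c b A z) (\<lambda>i\<in>{1..n}. b i + (\<Sum>j\<in>{1..n}. A i j * (x j - z j))) x"
proof -
  define K where "K = (\<Sum>i\<in>{1..n}. \<Sum>j\<in>{1..n}. \<bar>A i j\<bar>)"
  define g where "g = (\<lambda>i\<in>{1..n}. b i + (\<Sum>j\<in>{1..n}. A i j * (x j - z j)))"
  define q where "q = quad_fun n c b A z"
  have *: "\<bar>(q y - q x - (\<Sum>i\<in>{1..n}. g i * (y i - x i))) / norm2 n (vsub n y x)\<bar>
      \<le> K * norm2 n (vsub n y x)" for y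
  proof -
    define N where "N = norm2 n (vsub n y x)"
    have N: "N \<ge> 0" "i \<in> {1..n} \<Longrightarrow> \<bar>y i - x i\<bar> \<le> N" for i
      using abs_le_norm2[of i n "vsub n y x"] by (auto simp: N_def norm2_def vsub_def)
    have "q y - q x - (\<Sum>i\<in>{1..n}. g i * (y i - x i)) =
        (\<Sum>i\<in>{1..n}. \<Sum>j\<in>{1..n}. A i j * (y i - x i) * (y j - x j)) / 2"
      unfolding q_def g_def by (subst quad_fun_expand[OF A, where x=x and y=y]) simp
    moreover have "\<bar>\<Sum>i\<in>{1..n}. \<Sum>j\<in>{1..n}. A i j * (y i - x i) * (y j - x j)\<bar> \<le> K * (N * N)"
      unfolding K_def using N by (intro sum_sum_mult_bound) auto
    moreover have "0 \<le> K * (N * N)"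
      by (auto simp: K_def intro!: mult_nonneg_nonneg sum_nonneg N)
    ultimately have "\<bar>q y - q x - (\<Sum>i\<in>{1..n}. g i * (y i - x i))\<bar> \<le> K * (N * N)"
      by linarith
    then have "\<bar>q y - q x - (\<Sum>i\<in>{1..n}. g i * (y i - x i))\<bar> / N \<le> K * N"
      using N(1) by (cases "N = 0") (auto simp: field_simps)
    with N(1) show ?thesis
      unfolding N_def[symmetric] by (simp add: abs_divide)
  qed
  have K0: "((\<lambda>y. K * norm2 n (vsub n y x)) \<longlongrightarrow> K * 0) (at x within Rn n)"
    by (rule tendsto_mult[OF tendsto_const tendsto_norm2_vsub])
  have "((\<lambda>y. (q y - q x - (\<Sum>i\<in>{1..n}. g i * (y i - x i))) / norm2 n (vsub n y x)) \<longlongrightarrow> 0) (at x within Rn n)"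
    by (rule_tac Lim_null_comparison[OF _ K0[unfolded mult_zero_right]]) (use * in \<open>auto intro!: always_eventually simp del: abs_divide One_nat_def\<close>)
  then show ?thesis
    unfolding has_gradient_def q_def g_def by (auto simp: Rn_def)
qed

lemma quad_fun_gradient_hessian:
  assumes A: "\<And>i j. A i j = A j i" and m: "\<And>y. y \<in> Rn n \<Longrightarrow> m y = quad_fun n c b A z y"
    and x: "x \<in> Rn n"
  shows "has_gradient n m (\<lambda>i\<in>{1..n}. b i + (\<Sum>j\<in>{1..n}. A i j * (x j - z j))) x"
    and "gradient n m x = (\<lambda>i\<in>{1..n}. b i + (\<Sum>j\<in>{1..n}. A i j * (x j - z j)))"
    and "i \<in> {1..n} \<Longrightarrow> has_gradient n (\<lambda>y. gradient n m y i) (\<lambda>j\<in>{1..n}. A i j) x"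
    and "i \<in> {1..n} \<Longrightarrow> hessian n m x i = (\<lambda>j\<in>{1..n}. A i j)"
proof -
  have 1: "has_gradient n m (\<lambda>i\<in>{1..n}. b i + (\<Sum>j\<in>{1..n}. A i j * (x j - z j))) x" if "x \<in> Rn n" for x
    using has_gradient_quad_fun[of A, OF A] m that by (rule_tac has_gradient_cong[where f="quad_fun n c b A z"]) auto
  then show "has_gradient n m (\<lambda>i\<in>{1..n}. b i + (\<Sum>j\<in>{1..n}. A i j * (x j - z j))) x"
    using x by blast
  have 2: "gradient n m x = (\<lambda>i\<in>{1..n}. b i + (\<Sum>j\<in>{1..n}. A i j * (x j - z j)))" if "x \<in> Rn n" for x
    using 1 that by (auto intro: gradient_eqI)
  then show "gradient n m x = (\<lambda>i\<in>{1..n}. b i + (\<Sum>j\<in>{1..n}. A i j * (x j - z j)))"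
    using x by blast
  assume i: "i \<in> {1..n}"
  \<comment> \<open>Each component of the gradient is affine, hence again of this form with zero
    quadratic part, so the Hessian needs no separate limit argument.\<close>
  have "has_gradient n (quad_fun n (b i) (A i) (\<lambda>_ _. 0) z) (\<lambda>j\<in>{1..n}. A i j) x"
    using has_gradient_quad_fun[of "\<lambda>_ _. 0" n "b i" "A i" z x] by simp
  then show 3: "has_gradient n (\<lambda>y. gradient n m y i) (\<lambda>j\<in>{1..n}. A i j) x"
    using i x by (rule_tac has_gradient_cong[where f="quad_fun n (b i) (A i) (\<lambda>_ _. 0) z"]) (auto simp: 2 quad_fun_def)
  then show "hessian n m x i = (\<lambda>j\<in>{1..n}. A i j)"
    unfolding hessian_def using x by (rule gradient_eqI)
qed

section \<open>Euclidean and spectral norm estimates\<close>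

lemma norm2_le_sum_abs: "norm2 n x \<le> (\<Sum>i\<in>{1..n}. \<bar>x i\<bar>)"
  unfolding norm2_def by (rule L2_set_le_sum_abs)

lemma norm2_vsub_triangle: "norm2 n (vsub n x z) \<le> norm2 n (vsub n x y) + norm2 n (vsub n y z)"
  unfolding norm2_vsub using L2_set_triangle_ineq[of "\<lambda>i. x i - y i" "\<lambda>i. y i - z i"] by simp

lemma norm2_matrix_le:
  assumes "norm2 n v \<le> 1"
  shows "norm2 n (\<lambda>i. \<Sum>j\<in>{1..n}. A i j * v j) \<le> (\<Sum>i\<in>{1..n}. \<Sum>j\<in>{1..n}. \<bar>A i j\<bar>)"
proof -
  have "\<bar>v j\<bar> \<le> 1" if "j \<in> {1..n}" for j
    using abs_le_norm2[OF that, of v] assms by linarith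
  then have "\<bar>\<Sum>j\<in>{1..n}. A i j * v j\<bar> \<le> (\<Sum>j\<in>{1..n}. \<bar>A i j\<bar>)" for i
    by (intro order_trans[OF sum_abs] sum_mono) (auto simp: abs_mult intro!: mult_left_le)
  then show ?thesis
    by (intro order_trans[OF norm2_le_sum_abs] sum_mono)
qed

lemma unit_ball_nonempty: "{v \<in> Rn n. norm2 n v \<le> 1} \<noteq> {}"
  by (auto simp: Rn_def norm2_def L2_set_def intro!: exI[of _ "\<lambda>i\<in>{1..n}. 0"])

text \<open>A real supremum dominates its members only if it is bounded above; the sum of the
  absolute entries supplies the bound.\<close>

lemma norm2_le_spectral_norm:
  assumes "v \<in> Rn n" "norm2 n v \<le> 1"
  shows "norm2 n (\<lambda>i. \<Sum>j\<in>{1..n}. A i j * v j) \<le> spectral_norm n A"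
  unfolding spectral_norm_def using assms
  by (intro cSUP_upper bdd_aboveI2[where M="\<Sum>i\<in>{1..n}. \<Sum>j\<in>{1..n}. \<bar>A i j\<bar>"]) (auto simp del: One_nat_def intro!: norm2_matrix_le)

lemma spectral_norm_le_sum: "spectral_norm n A \<le> (\<Sum>i\<in>{1..n}. \<Sum>j\<in>{1..n}. \<bar>A i j\<bar>)"
  unfolding spectral_norm_def
  by (intro cSUP_least unit_ball_nonempty) (auto simp del: One_nat_def intro!: norm2_matrix_le)

lemma spectral_norm_add_le:
  assumes "\<And>i j. i \<in> {1..n} \<Longrightarrow> j \<in> {1..n} \<Longrightarrow> C i j = A i j + B i j"
  shows "spectral_norm n C \<le> spectral_norm n A + spectral_norm n B"
proof -
  have "norm2 n (\<lambda>i. \<Sum>j\<in>{1..n}. C i j * v j) \<le> spectral_norm n A + spectral_norm n B"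
    if v: "v \<in> Rn n" "norm2 n v \<le> 1" for v
  proof -
    have "norm2 n (\<lambda>i. \<Sum>j\<in>{1..n}. C i j * v j) =
        norm2 n (\<lambda>i. (\<Sum>j\<in>{1..n}. A i j * v j) + (\<Sum>j\<in>{1..n}. B i j * v j))"
      unfolding norm2_def L2_set_def using assms
      by (intro arg_cong[where f=sqrt] sum.cong refl arg_cong[where f="\<lambda>x. x\<^sup>2"])
         (simp add: sum.distrib[symmetric] algebra_simps)
    also have "\<dots> \<le> norm2 n (\<lambda>i. \<Sum>j\<in>{1..n}. A i j * v j) + norm2 n (\<lambda>i. \<Sum>j\<in>{1..n}. B i j * v j)"
      unfolding norm2_def by (rule L2_set_triangle_ineq)
    finally show ?thesis
      using norm2_le_spectral_norm[OF v, of A] norm2_le_spectral_norm[OF v, of B] by linarith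
  qed
  then show ?thesis
    unfolding spectral_norm_def[of n C] by (intro cSUP_least unit_ball_nonempty) auto
qed

subsection \<open>The polynomials spanned by the basis\<close>

lemma finite_idx [simp]: "finite (Q_idx n)" "finite (L_idx n)"
proof -
  have "Q_idx n \<subseteq> Sq ` {1..n} \<union> (\<lambda>(i, j). Mixed i j) ` ({1..n} \<times> {1..n})"
    by (auto simp: Q_idx_def)
  then show "finite (Q_idx n)"
    by (rule finite_subset) auto
  have "L_idx n \<subseteq> Lin ` {1..n} \<union> {Const}"
    by (auto simp: L_idx_def)
  then show "finite (L_idx n)"
    by (rule finite_subset) auto
qed

lemma Q_L_disjoint [simp]: "Q_idx n \<inter> L_idx n = {}"
  by (auto simp: Q_idx_def L_idx_def)

lemma sum_idx_split: "(\<Sum>l\<in>Q_idx n \<union> L_idx n. F l) = (\<Sum>l\<in>Q_idx n. F l) + (\<Sum>l\<in>L_idx n. F l)"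
  by (rule sum.union_disjoint) auto

lemma idx_0: "Q_idx 0 \<union> L_idx 0 = {Const}"
  by (auto simp: Q_idx_def L_idx_def)

text \<open>A new variable brings one square, one linear element and \<open>n\<close> mixed ones.
  The inductions on the number of variables (cardinality, Taylor form, moments) all rest on this
  decomposition.\<close>

lemma sum_idx_Suc:
  fixes F :: "psi_name \<Rightarrow> 'a :: comm_monoid_add"
  shows "(\<Sum>l\<in>Q_idx (Suc n) \<union> L_idx (Suc n). F l) =
    (\<Sum>l\<in>Q_idx n \<union> L_idx n. F l) + (F (Sq (Suc n)) + F (Lin (Suc n)) + (\<Sum>i\<in>{1..n}. F (Mixed i (Suc n))))"
proof -
  have eq: "Q_idx (Suc n) \<union> L_idx (Suc n) =
      (Q_idx n \<union> L_idx n) \<union> ({Sq (Suc n)} \<union> {Lin (Suc n)} \<union> (\<lambda>i. Mixed i (Suc n)) ` {1..n})"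
    unfolding Q_idx_def L_idx_def by (auto simp: le_Suc_eq less_Suc_eq_le)
  have new: "Sq (Suc n) \<notin> Q_idx n \<union> L_idx n" "Lin (Suc n) \<notin> Q_idx n \<union> L_idx n"
    "(\<lambda>i. Mixed i (Suc n)) ` {1..n} \<inter> (Q_idx n \<union> L_idx n) = {}"
    by (auto simp: Q_idx_def L_idx_def)
  have "(\<Sum>l\<in>Q_idx (Suc n) \<union> L_idx (Suc n). F l) = (\<Sum>l\<in>Q_idx n \<union> L_idx n. F l) +
      (\<Sum>l\<in>{Sq (Suc n)} \<union> {Lin (Suc n)} \<union> (\<lambda>i. Mixed i (Suc n)) ` {1..n}. F l)"
    unfolding eq using new by (intro sum.union_disjoint) auto
  also have "(\<Sum>l\<in>{Sq (Suc n)} \<union> {Lin (Suc n)} \<union> (\<lambda>i. Mixed i (Suc n)) ` {1..n}. F l) =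
      (\<Sum>l\<in>{Sq (Suc n)} \<union> {Lin (Suc n)}. F l) + (\<Sum>l\<in>(\<lambda>i. Mixed i (Suc n)) ` {1..n}. F l)"
    by (intro sum.union_disjoint) auto
  also have "(\<Sum>l\<in>(\<lambda>i. Mixed i (Suc n)) ` {1..n}. F l) = (\<Sum>i\<in>{1..n}. F (Mixed i (Suc n)))"
    by (simp add: sum.reindex inj_on_def)
  finally show ?thesis
    by (simp add: ac_simps)
qed

lemma card_idx: "real (card (Q_idx n \<union> L_idx n)) = real (n + 1) * real (n + 2) / 2"
proof (induction n)
  case 0
  then show ?case by (simp add: idx_0)
next
  case (Suc n)
  have "card (Q_idx (Suc n) \<union> L_idx (Suc n)) = card (Q_idx n \<union> L_idx n) + (n + 2)"
    using sum_idx_Suc[of "\<lambda>_. 1::nat" n] by simp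
  with Suc show ?case
    by (simp add: field_simps)
qed

lemma card_L_idx: "card (L_idx n) = n + 1"
proof -
  have "L_idx n = insert Const (Lin ` {1..n})"
    by (auto simp: L_idx_def)
  then show ?thesis
    by (simp add: card_image inj_on_def card_insert_if image_iff)
qed

text \<open>The entries of the constant Hessian of \<open>quad_poly\<close>: the diagonal doubles
  the factor of \<open>Sq i\<close>, and \<open>min\<close> and \<open>max\<close> are there because
  mixed names occur only with increasing indices.\<close>

definition hess_coeff :: "real \<Rightarrow> (psi_name \<Rightarrow> real) \<Rightarrow> nat \<Rightarrow> nat \<Rightarrow> real" where
  "hess_coeff \<Delta> \<alpha> i j = (if i = j then 3 * sqrt 5 / \<Delta>\<^sup>2 * \<alpha> (Sq i)
     else 3 / \<Delta>\<^sup>2 * \<alpha> (Mixed (min i j) (max i j)))"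

lemma hess_coeff_sym: "hess_coeff \<Delta> \<alpha> i j = hess_coeff \<Delta> \<alpha> j i"
  by (simp add: hess_coeff_def min.commute max.commute)

text \<open>The correction \<open>sqrt 5 / 2\<close> in the constant collects the constant parts of
  the degree two Legendre elements \<open>Sq i\<close>.\<close>

lemma quad_poly_eq_quad_fun:
  "quad_poly n \<Delta> \<alpha> x = quad_fun n (\<alpha> Const - sqrt 5 / 2 * (\<Sum>i\<in>{1..n}. \<alpha> (Sq i)))
     (\<lambda>i. sqrt 3 / \<Delta> * \<alpha> (Lin i)) (hess_coeff \<Delta> \<alpha>) (\<lambda>_. 0) x"
proof (induction n)
  case 0
  then show ?case by (simp add: quad_poly_def quad_fun_def idx_0)
next
  case (Suc n)
  let ?H = "hess_coeff \<Delta> \<alpha>" and ?N = "Suc n"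
  have "(\<Sum>i\<in>{1..?N}. \<Sum>j\<in>{1..?N}. ?H i j * x i * x j) =
      (\<Sum>i\<in>{1..n}. (\<Sum>j\<in>{1..n}. ?H i j * x i * x j) + ?H i ?N * x i * x ?N)
       + ((\<Sum>j\<in>{1..n}. ?H ?N j * x ?N * x j) + ?H ?N ?N * x ?N * x ?N)"
    by simp
  \<comment> \<open>The new row equals the new column by symmetry; together they cancel the 1/2 in
    front of the quadratic form.\<close>
  also have "(\<Sum>j\<in>{1..n}. ?H ?N j * x ?N * x j) = (\<Sum>i\<in>{1..n}. ?H i ?N * x i * x ?N)"
    by (simp add: hess_coeff_sym[of _ _ ?N] mult.assoc mult.commute[of "x ?N"])
  finally have "(\<Sum>i\<in>{1..?N}. \<Sum>j\<in>{1..?N}. ?H i j * x i * x j) =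
      (\<Sum>i\<in>{1..n}. \<Sum>j\<in>{1..n}. ?H i j * x i * x j)
       + 2 * (\<Sum>i\<in>{1..n}. ?H i ?N * x i * x ?N) + ?H ?N ?N * x ?N * x ?N"
    by (simp only: sum.distrib)
  moreover have "(\<Sum>i\<in>{1..n}. ?H i ?N * x i * x ?N) =
      (\<Sum>i\<in>{1..n}. \<alpha> (Mixed i ?N) * psi \<Delta> (Mixed i ?N) x)"
    by (intro sum.cong) (auto simp: hess_coeff_def min_def max_def)
  moreover have "?H ?N ?N * x ?N * x ?N / 2 - sqrt 5 / 2 * \<alpha> (Sq ?N) =
      \<alpha> (Sq ?N) * psi \<Delta> (Sq ?N) x"
    by (simp add: hess_coeff_def power2_eq_square algebra_simps)
  moreover have "(\<Sum>i\<in>{1..?N}. sqrt 3 / \<Delta> * \<alpha> (Lin i) * (x i - 0)) =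
      (\<Sum>i\<in>{1..n}. sqrt 3 / \<Delta> * \<alpha> (Lin i) * (x i - 0)) + \<alpha> (Lin ?N) * psi \<Delta> (Lin ?N) x"
    by simp
  moreover have "sqrt 5 / 2 * (\<Sum>i\<in>{1..?N}. \<alpha> (Sq i)) =
      sqrt 5 / 2 * (\<Sum>i\<in>{1..n}. \<alpha> (Sq i)) + sqrt 5 / 2 * \<alpha> (Sq ?N)"
    by (simp add: distrib_left)
  moreover have "quad_poly ?N \<Delta> \<alpha> x = quad_poly n \<Delta> \<alpha> x + (\<alpha> (Sq ?N) * psi \<Delta> (Sq ?N) x
      + \<alpha> (Lin ?N) * psi \<Delta> (Lin ?N) x + (\<Sum>i\<in>{1..n}. \<alpha> (Mixed i ?N) * psi \<Delta> (Mixed i ?N) x))"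
    unfolding quad_poly_def by (rule sum_idx_Suc)
  ultimately show ?case
    using Suc unfolding quad_fun_def diff_zero by linarith
qed

lemma quad_fun_shift: "quad_fun n c b A (\<lambda>_. 0) (vsub n x z) = quad_fun n c b A z x"
  unfolding quad_fun_def by (auto simp: vsub_def intro!: arg_cong2[where f="(+)"] sum.cong)

lemma quad_poly_shift_eq_quad_fun:
  "quad_poly n \<Delta> \<alpha> (vsub n x z) = quad_fun n (\<alpha> Const - sqrt 5 / 2 * (\<Sum>i\<in>{1..n}. \<alpha> (Sq i)))
     (\<lambda>i. sqrt 3 / \<Delta> * \<alpha> (Lin i)) (hess_coeff \<Delta> \<alpha>) z x"
  by (simp add: quad_poly_eq_quad_fun quad_fun_shift)

text \<open>The assumption gives a model expanded around the origin, while the program fits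
  coefficients around \<open>x0\<close>. Recentring touches only the linear and constant
  coefficients, so the sparsity of the quadratic part survives.\<close>

lemma quad_poly_translate:
  assumes "\<Delta> > 0"
  obtains \<beta> where "\<And>l. l \<in> Q_idx n \<Longrightarrow> \<beta> l = \<alpha> l"
    and "\<And>x. quad_poly n \<Delta> \<alpha> x = quad_poly n \<Delta> \<beta> (vsub n x z)"
proof
  define c b where "c = \<alpha> Const - sqrt 5 / 2 * (\<Sum>i\<in>{1..n}. \<alpha> (Sq i))"
    and "b i = sqrt 3 / \<Delta> * \<alpha> (Lin i)" for i
  define b' where "b' i = b i + (\<Sum>j\<in>{1..n}. hess_coeff \<Delta> \<alpha> i j * (z j - 0))" for i
  \<comment> \<open>The linear entries undo the normalization \<open>sqrt 3 / \<Delta>\<close>. The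
    constant entry restores the value at \<open>z\<close> and compensates the constants hidden in
    the squares.\<close>
  define \<beta> where "\<beta> l = (case l of Lin i \<Rightarrow> \<Delta> / sqrt 3 * b' i
      | Const \<Rightarrow> quad_poly n \<Delta> \<alpha> z + sqrt 5 / 2 * (\<Sum>i\<in>{1..n}. \<alpha> (Sq i)) | _ \<Rightarrow> \<alpha> l)" for l
  show "\<beta> l = \<alpha> l" if "l \<in> Q_idx n" for l
    using that by (auto simp: Q_idx_def \<beta>_def)
  have H: "hess_coeff \<Delta> \<beta> = hess_coeff \<Delta> \<alpha>"
    by (auto simp: hess_coeff_def \<beta>_def fun_eq_iff)
  fix x
  have "quad_poly n \<Delta> \<alpha> x = quad_fun n c b (hess_coeff \<Delta> \<alpha>) (\<lambda>_. 0) x"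
    by (simp add: quad_poly_eq_quad_fun c_def b_def[abs_def])
  also have "\<dots> = quad_fun n (quad_poly n \<Delta> \<alpha> z) b' (hess_coeff \<Delta> \<alpha>) z x"
    by (subst quad_fun_expand[OF hess_coeff_sym, where x=z])
       (simp add: quad_poly_eq_quad_fun c_def b_def[abs_def] b'_def[abs_def] quad_fun_def[of n _ _ _ z])
  also have "\<dots> = quad_poly n \<Delta> \<beta> (vsub n x z)"
    using assms by (simp add: quad_poly_shift_eq_quad_fun H) (simp add: \<beta>_def)
  finally show "quad_poly n \<Delta> \<alpha> x = quad_poly n \<Delta> \<beta> (vsub n x z)" .
qed

declare One_nat_def [simp del]

subsection \<open>Essentially bounded functions\<close>

text \<open>The uniform measures have the whole space as carrier, where polynomials are unbounded,
  though they are bounded almost everywhere. The class is closed under products, so integrability of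
  every moment comes for free.\<close>

definition ess_bounded :: "'a measure \<Rightarrow> ('a \<Rightarrow> real) \<Rightarrow> bool" where
  "ess_bounded M f \<longleftrightarrow> f \<in> borel_measurable M \<and> (\<exists>B. AE x in M. \<bar>f x\<bar> \<le> B)"

lemma ess_boundedI: "f \<in> borel_measurable M \<Longrightarrow> (AE x in M. \<bar>f x\<bar> \<le> B) \<Longrightarrow> ess_bounded M f"
  by (auto simp: ess_bounded_def)

lemma ess_bounded_measurable: "ess_bounded M f \<Longrightarrow> f \<in> borel_measurable M"
  by (simp add: ess_bounded_def)

lemma ess_bounded_const [intro, simp]: "ess_bounded M (\<lambda>_. c)"
  by (auto simp: ess_bounded_def intro!: exI[of _ "\<bar>c\<bar>"])

lemma ess_bounded_add [intro]:
  assumes "ess_bounded M f" "ess_bounded M g"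
  shows "ess_bounded M (\<lambda>x. f x + g x)"
proof -
  from assms obtain B C where *: "AE x in M. \<bar>f x\<bar> \<le> B" "AE x in M. \<bar>g x\<bar> \<le> C"
    and [measurable]: "f \<in> borel_measurable M" "g \<in> borel_measurable M"
    by (auto simp: ess_bounded_def)
  from * have "AE x in M. \<bar>f x + g x\<bar> \<le> B + C"
    by eventually_elim linarith
  then show ?thesis
    by (intro ess_boundedI) auto
qed

lemma ess_bounded_mult [intro]:
  assumes "ess_bounded M f" "ess_bounded M g"
  shows "ess_bounded M (\<lambda>x. f x * g x)"
proof -
  from assms obtain B C where *: "AE x in M. \<bar>f x\<bar> \<le> B" "AE x in M. \<bar>g x\<bar> \<le> C"
    and [measurable]: "f \<in> borel_measurable M" "g \<in> borel_measurable M"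
    by (auto simp: ess_bounded_def)
  from * have "AE x in M. \<bar>f x * g x\<bar> \<le> B * C"
  proof eventually_elim
    case (elim x)
    then have "\<bar>f x\<bar> * \<bar>g x\<bar> \<le> B * C"
      by (intro mult_mono) auto
    then show ?case
      by (simp add: abs_mult)
  qed
  then show ?thesis
    by (intro ess_boundedI) auto
qed

lemma ess_bounded_power [intro]: "ess_bounded M f \<Longrightarrow> ess_bounded M (\<lambda>x. f x ^ k)"
  by (induction k) auto

lemma ess_bounded_diff [intro]:
  "ess_bounded M f \<Longrightarrow> ess_bounded M g \<Longrightarrow> ess_bounded M (\<lambda>x. f x - g x)"
  using ess_bounded_add[of M f "\<lambda>x. - 1 * g x"] ess_bounded_mult[of M "\<lambda>_. - 1" g] by simp

lemma ess_bounded_sum [intro]: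
  "(\<And>i. i \<in> I \<Longrightarrow> ess_bounded M (f i)) \<Longrightarrow> ess_bounded M (\<lambda>x. \<Sum>i\<in>I. f i x)"
  by (induction I rule: infinite_finite_induct) auto

lemma (in finite_measure) ess_bounded_integrable [intro]: "ess_bounded M f \<Longrightarrow> integrable M f"
  by (auto simp: ess_bounded_def intro!: integrable_const_bound)

lemmas ess_bounded_intros = ess_bounded_const ess_bounded_add ess_bounded_diff ess_bounded_mult
  ess_bounded_power ess_bounded_sum

lemma (in finite_measure) ess_bounded_integral_add:
  "ess_bounded M f \<Longrightarrow> ess_bounded M g \<Longrightarrow> (\<integral>x. f x + g x \<partial>M) = (\<integral>x. f x \<partial>M) + (\<integral>x. g x \<partial>M)"
  by (intro Bochner_Integration.integral_add ess_bounded_integrable)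

lemma (in finite_measure) ess_bounded_integral_diff:
  "ess_bounded M f \<Longrightarrow> ess_bounded M g \<Longrightarrow> (\<integral>x. f x - g x \<partial>M) = (\<integral>x. f x \<partial>M) - (\<integral>x. g x \<partial>M)"
  by (intro Bochner_Integration.integral_diff ess_bounded_integrable)

lemma ess_bounded_component:
  assumes "\<And>i. i \<in> I \<Longrightarrow> prob_space (M i)" "i \<in> I" "ess_bounded (M i) f"
  shows "ess_bounded (PiM I M) (\<lambda>x. f (x i))"
proof -
  from assms(3) obtain B where *: "AE x in M i. \<bar>f x\<bar> \<le> B" and [measurable]: "f \<in> borel_measurable (M i)"
    by (auto simp: ess_bounded_def)
  have [measurable]: "(\<lambda>x. x i) \<in> measurable (PiM I M) (M i)"
    using assms(2) by (rule measurable_component_singleton)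
  show ?thesis
    using AE_PiM_component[OF assms(1,2), where P="\<lambda>x. \<bar>f x\<bar> \<le> B"] *
    by (intro ess_boundedI[where B=B]) auto
qed

text \<open>Expanding the nonnegative integral of \<open>(s f - t g)^2\<close> gives a quadratic
  form in \<open>s\<close> and \<open>t\<close>; its values at suitable points yield the
  discriminant inequality.\<close>

lemma (in prob_space) integral_Cauchy_Schwarz:
  assumes f: "ess_bounded M f" and g: "ess_bounded M g"
  shows "(\<integral>x. f x * g x \<partial>M)\<^sup>2 \<le> (\<integral>x. (f x)\<^sup>2 \<partial>M) * (\<integral>x. (g x)\<^sup>2 \<partial>M)"
proof -
  define F G H where "F = (\<integral>x. (f x)\<^sup>2 \<partial>M)" and "G = (\<integral>x. (g x)\<^sup>2 \<partial>M)" and "H = (\<integral>x. f x * g x \<partial>M)"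
  have nonneg: "0 \<le> s\<^sup>2 * F - 2 * s * t * H + t\<^sup>2 * G" for s t
  proof -
    have "0 \<le> (\<integral>x. (s * f x - t * g x)\<^sup>2 \<partial>M)"
      by simp
    also have "\<dots> = (\<integral>x. s\<^sup>2 * (f x)\<^sup>2 - 2 * s * t * (f x * g x) + t\<^sup>2 * (g x)\<^sup>2 \<partial>M)"
      by (intro Bochner_Integration.integral_cong) (auto simp: power2_eq_square algebra_simps)
    also have "\<dots> = s\<^sup>2 * F - 2 * s * t * H + t\<^sup>2 * G"
      unfolding F_def G_def H_def
      by (simp add: ess_bounded_integral_add ess_bounded_integral_diff ess_bounded_intros f g)
    finally show ?thesis .
  qed
  have FG: "F \<ge> 0" "G \<ge> 0"
    by (auto simp: F_def G_def)
  have "H\<^sup>2 \<le> F * G"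
  proof (cases "G = 0")
    case True
    have "H = 0"
    proof (rule ccontr)
      assume "H \<noteq> 0"
      \<comment> \<open>With \<open>G = 0\<close> the form at this point equals F - (F + 1), which
        is negative.\<close>
      with nonneg[of 1 "(F + 1) / (2 * H)"] True show False
        by (simp add: field_simps)
    qed
    with True show ?thesis by simp
  next
    case False
    have "G\<^sup>2 * F - 2 * G * H * H + H\<^sup>2 * G = G * (F * G - H\<^sup>2)"
      by (simp add: power2_eq_square algebra_simps)
    with nonneg[of G H] have "0 \<le> G * (F * G - H\<^sup>2)"
      by simp
    with False FG show ?thesis
      by (simp add: zero_le_mult_iff)
  qed
  then show ?thesis
    by (simp add: F_def G_def H_def)
qed

subsection \<open>A hypercontractive inequality for polynomials of degree two\<close>

text \<open>The odd term 4 a w^3 is absorbed by its even neighbours. The term linear in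
  \<open>w\<close> is kept exactly, because it will have mean zero.\<close>

lemma fourth_power_le:
  fixes a w :: real
  shows "(a + w) ^ 4 \<le> a ^ 4 + 4 * a ^ 3 * w + 8 * a\<^sup>2 * w\<^sup>2 + 3 * w ^ 4"
proof -
  have "a ^ 4 + 4 * a ^ 3 * w + 8 * a\<^sup>2 * w\<^sup>2 + 3 * w ^ 4 - (a + w) ^ 4 = 2 * (w * (a - w))\<^sup>2"
    by (simp add: power4_eq_xxxx power3_eq_cube power2_eq_square algebra_simps)
  then show ?thesis
    using zero_le_power2[of "w * (a - w)"] by linarith
qed

lemma fourth_power_sum_le:
  fixes u v :: real
  shows "(u + v) ^ 4 \<le> 8 * (u ^ 4 + v ^ 4)"
proof -
  have "(u + v)\<^sup>2 \<le> 2 * (u\<^sup>2 + v\<^sup>2)" for u v :: real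
    using zero_le_power2[of "u - v"] by (simp add: power2_eq_square algebra_simps)
  note sq = this
  have "((u + v)\<^sup>2)\<^sup>2 \<le> (2 * (u\<^sup>2 + v\<^sup>2))\<^sup>2"
    by (intro power_mono sq) auto
  also have "\<dots> = 4 * (u\<^sup>2 + v\<^sup>2)\<^sup>2"
    by (simp only: power_mult_distrib) simp
  also have "\<dots> \<le> 4 * (2 * ((u\<^sup>2)\<^sup>2 + (v\<^sup>2)\<^sup>2))"
    by (intro mult_left_mono sq) auto
  finally show ?thesis
    by (simp add: power4_eq_xxxx power2_eq_square mult.assoc)
qed

text \<open>An abstraction of the normalized Legendre polynomials of degrees one and two under the
  uniform law. The bounds 3 and 5 are their maximal squares on the interval.\<close>

locale orthonormal_pair = prob_space M for M :: "'a measure" +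
  fixes T L :: "'a \<Rightarrow> real"
  assumes T_meas [measurable]: "T \<in> borel_measurable M" and L_meas [measurable]: "L \<in> borel_measurable M"
    and T_bound: "AE y in M. (T y)\<^sup>2 \<le> 3" and L_bound: "AE y in M. (L y)\<^sup>2 \<le> 5"
    and T_mean: "(\<integral>y. T y \<partial>M) = 0" and L_mean: "(\<integral>y. L y \<partial>M) = 0"
    and T_square: "(\<integral>y. (T y)\<^sup>2 \<partial>M) = 1" and L_square: "(\<integral>y. (L y)\<^sup>2 \<partial>M) = 1"
    and TL_mean: "(\<integral>y. T y * L y \<partial>M) = 0"
begin

abbreviation Pr :: "nat \<Rightarrow> (nat \<Rightarrow> 'a) measure" where
  "Pr n \<equiv> PiM {1..n} (\<lambda>_. M)"

lemma Pr_prob_space: "prob_space (Pr n)"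
  by (intro prob_space_PiM prob_space_axioms)

lemma ess_bounded_TL [intro]: "ess_bounded M T" "ess_bounded M L"
proof -
  have "AE y in M. \<bar>T y\<bar> \<le> sqrt 3"
    using T_bound by eventually_elim (simp add: real_le_rsqrt)
  then show "ess_bounded M T"
    by (rule ess_boundedI[rotated]) measurable
  have "AE y in M. \<bar>L y\<bar> \<le> sqrt 5"
    using L_bound by eventually_elim (simp add: real_le_rsqrt)
  then show "ess_bounded M L"
    by (rule ess_boundedI[rotated]) measurable
qed

lemma ess_bounded_TL_component [intro]:
  assumes "i \<in> {1..n}"
  shows "ess_bounded (Pr n) (\<lambda>x. T (x i))" "ess_bounded (Pr n) (\<lambda>x. L (x i))"
  using assms prob_space_axioms by (auto intro!: ess_bounded_component[where M="\<lambda>_. M"])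

lemma integral_combination:
  "(\<integral>y. k + a * T y + b * (T y)\<^sup>2 + c * L y + d * (L y)\<^sup>2 + e * (T y * L y) \<partial>M) = k + b + d"
proof -
  have "(\<integral>y. k + a * T y + b * (T y)\<^sup>2 + c * L y + d * (L y)\<^sup>2 + e * (T y * L y) \<partial>M) =
     (\<integral>y. k + a * T y + b * (T y)\<^sup>2 + c * L y + d * (L y)\<^sup>2 \<partial>M) + (\<integral>y. e * (T y * L y) \<partial>M)"
    by (intro ess_bounded_integral_add ess_bounded_intros ess_bounded_TL)
  also have "(\<integral>y. k + a * T y + b * (T y)\<^sup>2 + c * L y + d * (L y)\<^sup>2 \<partial>M) =
     (\<integral>y. k + a * T y + b * (T y)\<^sup>2 + c * L y \<partial>M) + (\<integral>y. d * (L y)\<^sup>2 \<partial>M)"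
    by (intro ess_bounded_integral_add ess_bounded_intros ess_bounded_TL)
  also have "(\<integral>y. k + a * T y + b * (T y)\<^sup>2 + c * L y \<partial>M) =
     (\<integral>y. k + a * T y + b * (T y)\<^sup>2 \<partial>M) + (\<integral>y. c * L y \<partial>M)"
    by (intro ess_bounded_integral_add ess_bounded_intros ess_bounded_TL)
  also have "(\<integral>y. k + a * T y + b * (T y)\<^sup>2 \<partial>M) =
     (\<integral>y. k + a * T y \<partial>M) + (\<integral>y. b * (T y)\<^sup>2 \<partial>M)"
    by (intro ess_bounded_integral_add ess_bounded_intros ess_bounded_TL)
  also have "(\<integral>y. k + a * T y \<partial>M) = (\<integral>y. k \<partial>M) + (\<integral>y. a * T y \<partial>M)"
    by (intro ess_bounded_integral_add ess_bounded_intros ess_bounded_TL)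
  finally show ?thesis
    by (simp add: T_mean L_mean T_square L_square TL_mean prob_space)
qed

lemma second_moment: "(\<integral>y. (a + b * T y + c * L y)\<^sup>2 \<partial>M) = a\<^sup>2 + b\<^sup>2 + c\<^sup>2"
proof -
  have "(\<integral>y. (a + b * T y + c * L y)\<^sup>2 \<partial>M) =
     (\<integral>y. a\<^sup>2 + (2*a*b) * T y + b\<^sup>2 * (T y)\<^sup>2 + (2*a*c) * L y + c\<^sup>2 * (L y)\<^sup>2 + (2*b*c) * (T y * L y) \<partial>M)"
    by (intro Bochner_Integration.integral_cong) (auto simp: power2_eq_square algebra_simps)
  then show ?thesis
    by (simp only: integral_combination)
qed

text \<open>Apply the fourth power inequality with w = b T + c L; the part linear in
  \<open>w\<close> integrates to zero. The constants are 72 = 3 * 8 * 3 and 120 = 3 * 8 * 5, from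
  splitting w^4 and then using the bounds on T^2 and L^2.\<close>

lemma fourth_moment:
  "(\<integral>y. (a + b * T y + c * L y) ^ 4 \<partial>M) \<le> a ^ 4 + 8 * a\<^sup>2 * (b\<^sup>2 + c\<^sup>2) + 72 * b ^ 4 + 120 * c ^ 4"
proof -
  define R where "R y = a ^ 4 + (4 * a^3 * b) * T y + (8 * a\<^sup>2 * b\<^sup>2 + 72 * b ^ 4) * (T y)\<^sup>2 + (4 * a^3 * c) * L y
     + (8 * a\<^sup>2 * c\<^sup>2 + 120 * c ^ 4) * (L y)\<^sup>2 + (16 * a\<^sup>2 * b * c) * (T y * L y)" for y
  have le: "(a + b * t + c * l) ^ 4 \<le> a ^ 4 + (4 * a^3 * b) * t + (8 * a\<^sup>2 * b\<^sup>2 + 72 * b ^ 4) * t\<^sup>2 + (4 * a^3 * c) * l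
     + (8 * a\<^sup>2 * c\<^sup>2 + 120 * c ^ 4) * l\<^sup>2 + (16 * a\<^sup>2 * b * c) * (t * l)"
    if "t\<^sup>2 \<le> 3" "l\<^sup>2 \<le> 5" for t l
  proof -
    \<comment> \<open>Trading fourth powers for squares keeps the majorant a combination of 1, T,
      T^2, L, L^2 and T L, whose integrals are known.\<close>
    have "t ^ 4 = t\<^sup>2 * t\<^sup>2" "l ^ 4 = l\<^sup>2 * l\<^sup>2"
      by (simp_all add: power4_eq_xxxx power2_eq_square)
    then have "t ^ 4 \<le> 3 * t\<^sup>2" "l ^ 4 \<le> 5 * l\<^sup>2"
      using mult_right_mono[OF that(1), of "t\<^sup>2"] mult_right_mono[OF that(2), of "l\<^sup>2"] by simp_all
    then have "b ^ 4 * t ^ 4 \<le> b ^ 4 * (3 * t\<^sup>2)" "c ^ 4 * l ^ 4 \<le> c ^ 4 * (5 * l\<^sup>2)"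
      by (simp_all add: mult_left_mono)
    moreover have "(b * t + c * l) ^ 4 \<le> 8 * (b ^ 4 * t ^ 4 + c ^ 4 * l ^ 4)"
      using fourth_power_sum_le[of "b * t" "c * l"] by (simp add: power_mult_distrib)
    moreover have "(a + (b * t + c * l)) ^ 4 \<le> a ^ 4 + 4 * a ^ 3 * (b * t + c * l)
        + 8 * a\<^sup>2 * (b * t + c * l)\<^sup>2 + 3 * (b * t + c * l) ^ 4"
      by (rule fourth_power_le)
    moreover have "X \<le> P + Q + 24 * (U' + V')"
      if "U \<le> U'" "V \<le> V'" "W \<le> 8 * (U + V)" "X \<le> P + Q + 3 * W" for X P Q U V U' V' W :: real
      using that by argo
    ultimately have "(a + (b * t + c * l)) ^ 4 \<le> a ^ 4 + 4 * a ^ 3 * (b * t + c * l)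
        + 8 * a\<^sup>2 * (b * t + c * l)\<^sup>2 + 24 * (b ^ 4 * (3 * t\<^sup>2) + c ^ 4 * (5 * l\<^sup>2))"
      by blast
    also have "\<dots> = a ^ 4 + (4 * a^3 * b) * t + (8 * a\<^sup>2 * b\<^sup>2 + 72 * b ^ 4) * t\<^sup>2 + (4 * a^3 * c) * l
     + (8 * a\<^sup>2 * c\<^sup>2 + 120 * c ^ 4) * l\<^sup>2 + (16 * a\<^sup>2 * b * c) * (t * l)"
      by (simp add: power2_eq_square algebra_simps)
    finally show ?thesis
      by (simp add: add.assoc)
  qed
  have "(\<integral>y. (a + b * T y + c * L y) ^ 4 \<partial>M) \<le> (\<integral>y. R y \<partial>M)"
  proof (rule integral_mono_AE)
    show "integrable M (\<lambda>y. (a + b * T y + c * L y) ^ 4)" "integrable M R"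
      unfolding R_def by (intro ess_bounded_integrable ess_bounded_intros ess_bounded_TL)+
    show "AE y in M. (a + b * T y + c * L y) ^ 4 \<le> R y"
      using T_bound L_bound unfolding R_def by eventually_elim (rule le)
  qed
  also have "(\<integral>y. R y \<partial>M) = a ^ 4 + 8 * a\<^sup>2 * (b\<^sup>2 + c\<^sup>2) + 72 * b ^ 4 + 120 * c ^ 4"
    unfolding R_def by (subst integral_combination) (simp add: algebra_simps)
  finally show ?thesis .
qed

lemma integral_Suc:
  fixes f :: "(nat \<Rightarrow> 'a) \<Rightarrow> real"
  assumes "integrable (Pr (Suc n)) f"
  shows "(\<integral>x. f x \<partial>Pr (Suc n)) = (\<integral>x. (\<integral>y. f (x(Suc n := y)) \<partial>M) \<partial>Pr n)"
proof -
  interpret product_sigma_finite "\<lambda>_. M"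
    by standard
  have "{1..Suc n} = insert (Suc n) {1..n}"
    by auto
  with assms product_integral_insert[of "{1..n}" "Suc n" f] show ?thesis
    by simp
qed

text \<open>Used with \<open>a\<close> of degree two and \<open>b\<close> of degree one in the old variables, so that \<open>f\<close> runs through the
  polynomials of degree two in one more variable.\<close>
lemma moment_step:
  fixes a b :: "(nat \<Rightarrow> 'a) \<Rightarrow> real" and c :: real
  assumes a: "\<And>m. n \<le> m \<Longrightarrow> ess_bounded (Pr m) a" "\<And>x y. a (x(Suc n := y)) = a x"
    and b: "\<And>m. n \<le> m \<Longrightarrow> ess_bounded (Pr m) b" "\<And>x y. b (x(Suc n := y)) = b x"
    and a2: "(\<integral>x. (a x)\<^sup>2 \<partial>Pr n) = A" and b2: "(\<integral>x. (b x)\<^sup>2 \<partial>Pr n) = B"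
    and a4: "(\<integral>x. a x ^ 4 \<partial>Pr n) \<le> C * A\<^sup>2" and b4: "(\<integral>x. b x ^ 4 \<partial>Pr n) \<le> D * B\<^sup>2"
    and CD: "120 \<le> C" "72 * D \<le> C"
  defines "f \<equiv> \<lambda>x. a x + b x * T (x (Suc n)) + c * L (x (Suc n))"
  shows "(\<integral>x. (f x)\<^sup>2 \<partial>Pr (Suc n)) = A + B + c\<^sup>2"
    and "(\<integral>x. f x ^ 4 \<partial>Pr (Suc n)) \<le> C * (A + B + c\<^sup>2)\<^sup>2"
proof -
  interpret N: prob_space "Pr n" by (rule Pr_prob_space)
  interpret S: prob_space "Pr (Suc n)" by (rule Pr_prob_space)
  have an: "ess_bounded (Pr n) a" "ess_bounded (Pr (Suc n)) a" using a by auto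
  have bn: "ess_bounded (Pr n) b" "ess_bounded (Pr (Suc n)) b" using b by auto
  have f: "ess_bounded (Pr (Suc n)) f"
    unfolding f_def by (intro ess_bounded_add ess_bounded_mult an bn ess_bounded_TL_component) auto
  have fxy: "f (x(Suc n := y)) = a x + b x * T y + c * L y" for x y
    by (simp add: f_def a b)
  have AB: "A \<ge> 0" "B \<ge> 0"
    unfolding a2[symmetric] b2[symmetric] by auto
  have "(\<integral>x. (f x)\<^sup>2 \<partial>Pr (Suc n)) = (\<integral>x. (a x)\<^sup>2 + (b x)\<^sup>2 + c\<^sup>2 \<partial>Pr n)"
    by (subst integral_Suc) (simp_all add: S.ess_bounded_integrable ess_bounded_intros f fxy second_moment)
  also have "\<dots> = (\<integral>x. (a x)\<^sup>2 + (b x)\<^sup>2 \<partial>Pr n) + (\<integral>x. c\<^sup>2 \<partial>Pr n)"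
    by (intro N.ess_bounded_integral_add ess_bounded_intros an bn)
  also have "(\<integral>x. (a x)\<^sup>2 + (b x)\<^sup>2 \<partial>Pr n) = A + B"
    unfolding a2[symmetric] b2[symmetric] by (intro N.ess_bounded_integral_add ess_bounded_intros an bn)
  finally show "(\<integral>x. (f x)\<^sup>2 \<partial>Pr (Suc n)) = A + B + c\<^sup>2"
    by (simp add: N.prob_space)
  \<comment> \<open>Cauchy-Schwarz with \<open>D \<le> C / 72\<close> bounds the mixed moment by C A
    B / sqrt 72, and 72 exceeds 64. The resulting 1/8 cancels the coefficient 8 of the mixed
    term.\<close>
  have "(\<integral>x. (a x)\<^sup>2 * (b x)\<^sup>2 \<partial>Pr n)\<^sup>2 \<le> (\<integral>x. ((a x)\<^sup>2)\<^sup>2 \<partial>Pr n) * (\<integral>x. ((b x)\<^sup>2)\<^sup>2 \<partial>Pr n)"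
    using an bn by (intro N.integral_Cauchy_Schwarz) auto
  also have "\<dots> = (\<integral>x. a x ^ 4 \<partial>Pr n) * (\<integral>x. b x ^ 4 \<partial>Pr n)"
    by (simp flip: power_mult)
  also have "\<dots> \<le> (C * A\<^sup>2) * (C / 72 * B\<^sup>2)"
  proof (intro mult_mono a4 order_trans[OF b4] mult_right_mono)
    show "0 \<le> (\<integral>x. b x ^ 4 \<partial>Pr n)" by simp
  qed (use CD in auto)
  also have "\<dots> \<le> (C * A * B / 8)\<^sup>2"
    using AB by (simp add: power2_eq_square field_simps)
  finally have ab: "(\<integral>x. (a x)\<^sup>2 * (b x)\<^sup>2 \<partial>Pr n) \<le> C * A * B / 8"
    by (rule power2_le_imp_le) (simp add: AB order_trans[OF _ CD(1)])
  define R where "R x = a x ^ 4 + 8 * (a x)\<^sup>2 * ((b x)\<^sup>2 + c\<^sup>2) + 72 * b x ^ 4 + 120 * c ^ 4" for x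
  have R: "R = (\<lambda>x. a x ^ 4 + (8 * ((a x)\<^sup>2 * (b x)\<^sup>2) + (8 * c\<^sup>2 * (a x)\<^sup>2 + (72 * b x ^ 4 + 120 * c ^ 4))))"
    by (auto simp: R_def algebra_simps)
  have "(\<integral>x. R x \<partial>Pr n) = (\<integral>x. a x ^ 4 \<partial>Pr n) + (8 * (\<integral>x. (a x)\<^sup>2 * (b x)\<^sup>2 \<partial>Pr n)
      + (8 * c\<^sup>2 * A + (72 * (\<integral>x. b x ^ 4 \<partial>Pr n) + 120 * c ^ 4)))"
    unfolding R a2[symmetric]
    by (simp add: N.ess_bounded_integral_add ess_bounded_intros an bn N.prob_space)
  have "(\<integral>x. f x ^ 4 \<partial>Pr (Suc n)) = (\<integral>x. (\<integral>y. (a x + b x * T y + c * L y) ^ 4 \<partial>M) \<partial>Pr n)"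
    by (subst integral_Suc) (simp_all add: S.ess_bounded_integrable ess_bounded_intros f fxy)
  also have "\<dots> \<le> (\<integral>x. R x \<partial>Pr n)"
  proof (rule integral_mono')
    show "integrable (Pr n) R"
      unfolding R by (intro N.ess_bounded_integrable ess_bounded_intros an bn)
    fix x
    show "(\<integral>y. (a x + b x * T y + c * L y) ^ 4 \<partial>M) \<le> R x"
      unfolding R_def by (rule fourth_moment)
    show "0 \<le> R x"
      by (simp add: R_def)
  qed
  also have "\<dots> = (\<integral>x. a x ^ 4 \<partial>Pr n) + (8 * (\<integral>x. (a x)\<^sup>2 * (b x)\<^sup>2 \<partial>Pr n)
      + (8 * c\<^sup>2 * A + (72 * (\<integral>x. b x ^ 4 \<partial>Pr n) + 120 * c ^ 4)))"
    by fact
  also have "\<dots> \<le> C * A\<^sup>2 + C * A * B + C * c\<^sup>2 * A + C * B\<^sup>2 + C * c ^ 4"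
  proof -
    have "72 * (\<integral>x. b x ^ 4 \<partial>Pr n) \<le> 72 * (D * B\<^sup>2)"
      using b4 by simp
    also have "\<dots> \<le> C * B\<^sup>2"
      using CD mult_right_mono[of "72 * D" C "B\<^sup>2"] by simp
    finally have "72 * (\<integral>x. b x ^ 4 \<partial>Pr n) \<le> C * B\<^sup>2" .
    moreover have "8 * (c\<^sup>2 * A) \<le> C * (c\<^sup>2 * A)" "120 * c ^ 4 \<le> C * c ^ 4"
      using AB CD by (intro mult_right_mono; simp)+
    ultimately show ?thesis
      using ab a4 by (simp add: mult.assoc)
  qed
  \<comment> \<open>The cross terms of the square leave enough room, so the same \<open>C\<close>
    comes out as went in: the constant does not grow with the number of variables.\<close>
  also have "\<dots> \<le> C * (A + B + c\<^sup>2)\<^sup>2"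
  proof -
    have "C * (A + B + c\<^sup>2)\<^sup>2 - (C * A\<^sup>2 + C * A * B + C * c\<^sup>2 * A + C * B\<^sup>2 + C * c ^ 4) =
        C * (A * B + A * c\<^sup>2 + 2 * B * c\<^sup>2)"
      by (simp add: power2_eq_square power4_eq_xxxx algebra_simps)
    moreover have "0 \<le> C * (A * B + A * c\<^sup>2 + 2 * B * c\<^sup>2)"
      using AB CD by (intro mult_nonneg_nonneg add_nonneg_nonneg) auto
    ultimately show ?thesis by linarith
  qed
  finally show "(\<integral>x. f x ^ 4 \<partial>Pr (Suc n)) \<le> C * (A + B + c\<^sup>2)\<^sup>2" .
qed

text \<open>The basis elements as products of one-variable orthonormal functions; with the Legendre
  polynomials for \<open>T\<close> and \<open>L\<close> this is \<open>psi\<close>.\<close>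

fun chaos :: "psi_name \<Rightarrow> (nat \<Rightarrow> 'a) \<Rightarrow> real" where
  "chaos (Sq i) x = L (x i)"
| "chaos (Mixed i j) x = T (x i) * T (x j)"
| "chaos (Lin i) x = T (x i)"
| "chaos Const x = 1"

text \<open>Affine polynomials come before quadratic ones because they are the coefficients of
  \<open>T\<close> in a new variable. Here that coefficient is itself a constant, so the induction
  step runs with \<open>D = 1\<close> and the constant 120 persists.\<close>

lemma linear_moments:
  fixes k :: real and b :: "nat \<Rightarrow> real"
  defines "f \<equiv> \<lambda>n x. k + (\<Sum>i\<in>{1..n}. b i * T (x i))"
  shows "(\<integral>x. (f n x)\<^sup>2 \<partial>Pr n) = k\<^sup>2 + (\<Sum>i\<in>{1..n}. (b i)\<^sup>2)"
    and "(\<integral>x. f n x ^ 4 \<partial>Pr n) \<le> 120 * (k\<^sup>2 + (\<Sum>i\<in>{1..n}. (b i)\<^sup>2))\<^sup>2"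
    and "n \<le> m \<Longrightarrow> ess_bounded (Pr m) (f n)"
proof -
  have eb: "ess_bounded (Pr m) (f n)" if "n \<le> m" for n m
    unfolding f_def using that
    by (intro ess_bounded_add ess_bounded_sum ess_bounded_mult ess_bounded_TL_component) auto
  then show "n \<le> m \<Longrightarrow> ess_bounded (Pr m) (f n)" .
  have "(\<integral>x. (f n x)\<^sup>2 \<partial>Pr n) = k\<^sup>2 + (\<Sum>i\<in>{1..n}. (b i)\<^sup>2) \<and>
    (\<integral>x. f n x ^ 4 \<partial>Pr n) \<le> 120 * (k\<^sup>2 + (\<Sum>i\<in>{1..n}. (b i)\<^sup>2))\<^sup>2"
  proof (induction n)
    case 0
    interpret P0: prob_space "Pr 0" by (rule Pr_prob_space)
    have "k ^ 4 \<le> 120 * (k\<^sup>2)\<^sup>2"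
      by (simp flip: power_mult)
    then show ?case
      using P0.prob_space by (simp add: f_def)
  next
    case (Suc n)
    interpret Pn: prob_space "Pr n" by (rule Pr_prob_space)
    have *: "f n (x(Suc n := y)) = f n x" for x y
      unfolding f_def by (auto intro!: sum.cong)
    have eq: "f (Suc n) = (\<lambda>x. f n x + b (Suc n) * T (x (Suc n)) + 0 * L (x (Suc n)))"
      by (auto simp: f_def)
    have const: "(\<integral>x. (b (Suc n))\<^sup>2 \<partial>Pr n) = (b (Suc n))\<^sup>2"
      "(\<integral>x. b (Suc n) ^ 4 \<partial>Pr n) \<le> 1 * ((b (Suc n))\<^sup>2)\<^sup>2"
      by (simp_all add: Pn.prob_space flip: power_mult)
    show ?case
      unfolding eq
      using moment_step[of n "f n" "\<lambda>_. b (Suc n)", OF eb * _ refl conjunct1[OF Suc] const(1) conjunct2[OF Suc] const(2), of 0]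
      by (simp add: add.assoc)
  qed
  then show "(\<integral>x. (f n x)\<^sup>2 \<partial>Pr n) = k\<^sup>2 + (\<Sum>i\<in>{1..n}. (b i)\<^sup>2)"
    and "(\<integral>x. f n x ^ 4 \<partial>Pr n) \<le> 120 * (k\<^sup>2 + (\<Sum>i\<in>{1..n}. (b i)\<^sup>2))\<^sup>2"
    by blast+
qed

text \<open>The same induction one degree higher: the factor of the new \<open>T\<close> is affine
  and has constant 120, so C = 72 * 120 = 8640 is reproduced at every step.\<close>

lemma quadratic_moments:
  fixes \<alpha> :: "psi_name \<Rightarrow> real"
  defines "f \<equiv> \<lambda>n x. \<Sum>l\<in>Q_idx n \<union> L_idx n. \<alpha> l * chaos l x"
  shows "(\<integral>x. (f n x)\<^sup>2 \<partial>Pr n) = (\<Sum>l\<in>Q_idx n \<union> L_idx n. (\<alpha> l)\<^sup>2)"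
    and "(\<integral>x. f n x ^ 4 \<partial>Pr n) \<le> 8640 * (\<Sum>l\<in>Q_idx n \<union> L_idx n. (\<alpha> l)\<^sup>2)\<^sup>2"
    and "n \<le> m \<Longrightarrow> ess_bounded (Pr m) (f n)"
proof -
  have eb: "ess_bounded (Pr m) (f n)" if "n \<le> m" for n m
    unfolding f_def
  proof (intro ess_bounded_sum ess_bounded_mult)
    fix l assume "l \<in> Q_idx n \<union> L_idx n"
    moreover have "chaos (Sq i) = (\<lambda>x. L (x i))" "chaos (Mixed i j) = (\<lambda>x. T (x i) * T (x j))"
      "chaos (Lin i) = (\<lambda>x. T (x i))" "chaos Const = (\<lambda>x. 1)" for i j
      by (simp_all add: fun_eq_iff)
    ultimately show "ess_bounded (Pr m) (chaos l)"
      using that unfolding Q_idx_def L_idx_def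
      by (cases l) (auto intro!: ess_bounded_mult ess_bounded_TL_component)
  qed auto
  then show "n \<le> m \<Longrightarrow> ess_bounded (Pr m) (f n)" .
  have "(\<integral>x. (f n x)\<^sup>2 \<partial>Pr n) = (\<Sum>l\<in>Q_idx n \<union> L_idx n. (\<alpha> l)\<^sup>2) \<and>
    (\<integral>x. f n x ^ 4 \<partial>Pr n) \<le> 8640 * (\<Sum>l\<in>Q_idx n \<union> L_idx n. (\<alpha> l)\<^sup>2)\<^sup>2"
  proof (induction n)
    case 0
    interpret P0: prob_space "Pr 0" by (rule Pr_prob_space)
    have "k ^ 4 \<le> 8640 * (k\<^sup>2)\<^sup>2" for k :: real
      by (simp flip: power_mult)
    then show ?case
      using P0.prob_space by (simp add: f_def idx_0)
  next
    case (Suc n)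
    \<comment> \<open>Everything that multiplies \<open>T\<close> of the new variable: its linear
      coefficient and the mixed terms with the old variables.\<close>
    define b where "b x = \<alpha> (Lin (Suc n)) + (\<Sum>i\<in>{1..n}. \<alpha> (Mixed i (Suc n)) * T (x i))" for x :: "nat \<Rightarrow> 'a"
    have b_eq: "b = (\<lambda>x. \<alpha> (Lin (Suc n)) + (\<Sum>i\<in>{1..n}. \<alpha> (Mixed i (Suc n)) * T (x i)))"
      by (simp add: b_def fun_eq_iff)
    have a: "f n (x(Suc n := y)) = f n x" for x y
    proof -
      have "chaos l (x(Suc n := y)) = chaos l x" if "l \<in> Q_idx n \<union> L_idx n" for l
        using that by (cases l) (auto simp: Q_idx_def L_idx_def)
      then show ?thesis
        unfolding f_def by simp
    qed
    have b: "b (x(Suc n := y)) = b x" for x y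
      unfolding b_def by (auto intro!: sum.cong)
    have eq: "f (Suc n) = (\<lambda>x. f n x + b x * T (x (Suc n)) + \<alpha> (Sq (Suc n)) * L (x (Suc n)))"
      by (auto simp: f_def sum_idx_Suc b_def fun_eq_iff algebra_simps sum_distrib_left sum_distrib_right)
    have sq: "(\<Sum>l\<in>Q_idx (Suc n) \<union> L_idx (Suc n). (\<alpha> l)\<^sup>2) = (\<Sum>l\<in>Q_idx n \<union> L_idx n. (\<alpha> l)\<^sup>2)
        + ((\<alpha> (Lin (Suc n)))\<^sup>2 + (\<Sum>i\<in>{1..n}. (\<alpha> (Mixed i (Suc n)))\<^sup>2)) + (\<alpha> (Sq (Suc n)))\<^sup>2"
      by (simp add: sum_idx_Suc)
    have b0: "n \<le> m \<Longrightarrow> ess_bounded (Pr m) b" for m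
      unfolding b_eq by (rule linear_moments)
    have b2: "(\<integral>x. (b x)\<^sup>2 \<partial>Pr n) = (\<alpha> (Lin (Suc n)))\<^sup>2 + (\<Sum>i\<in>{1..n}. (\<alpha> (Mixed i (Suc n)))\<^sup>2)"
      unfolding b_def by (rule linear_moments)
    have b4: "(\<integral>x. b x ^ 4 \<partial>Pr n) \<le> 120 * ((\<alpha> (Lin (Suc n)))\<^sup>2 + (\<Sum>i\<in>{1..n}. (\<alpha> (Mixed i (Suc n)))\<^sup>2))\<^sup>2"
      unfolding b_def by (rule linear_moments)
    show ?case
      unfolding eq sq
      using moment_step[of n "f n" b, OF eb a b0 b conjunct1[OF Suc] b2 conjunct2[OF Suc] b4] by simp
  qed
  then show "(\<integral>x. (f n x)\<^sup>2 \<partial>Pr n) = (\<Sum>l\<in>Q_idx n \<union> L_idx n. (\<alpha> l)\<^sup>2)"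
    and "(\<integral>x. f n x ^ 4 \<partial>Pr n) \<le> 8640 * (\<Sum>l\<in>Q_idx n \<union> L_idx n. (\<alpha> l)\<^sup>2)\<^sup>2"
    by blast+
qed

end

subsection \<open>The uniform distribution on the cube\<close>

lemma B_inf_vzero:
  assumes "n \<ge> 1"
  shows "B_inf n (vzero n) \<Delta> = ({1..n} \<rightarrow>\<^sub>E {-\<Delta>..\<Delta>})"
proof -
  have "norm_inf n (vsub n y (vzero n)) \<le> \<Delta> \<longleftrightarrow> (\<forall>i\<in>{1..n}. y i \<in> {-\<Delta>..\<Delta>})" for y
    using assms unfolding norm_inf_def vsub_def vzero_def
    by (subst Max_le_iff) (auto simp: abs_le_iff)
  then show ?thesis
    unfolding B_inf_def Rn_def by (auto simp: PiE_iff extensional_def simp del: atLeastAtMost_iff)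
qed

lemma prod_divide_ennreal:
  fixes c :: ennreal
  shows "(\<Prod>i\<in>I. f i / c) = (\<Prod>i\<in>I. f i) / c ^ card I"
  by (simp add: divide_ennreal_def prod.distrib ennreal_inverse_power)

abbreviation unif :: "real \<Rightarrow> real measure" where
  "unif \<Delta> \<equiv> uniform_measure lborel {-\<Delta>..\<Delta>}"

lemma prob_space_unif: "\<Delta> > 0 \<Longrightarrow> prob_space (unif \<Delta>)"
  by (rule prob_space_uniform_measure) auto

text \<open>Uniformity on a cube means independent uniform coordinates; this is what turns the
  moments into iterated one-variable integrals.\<close>

lemma uniform_measure_cube:
  assumes n: "n \<ge> 1" and \<Delta>: "\<Delta> > 0"
  shows "uniform_measure (PiM {1..n} (\<lambda>_. lborel)) (B_inf n (vzero n) \<Delta>) = PiM {1..n} (\<lambda>_. unif \<Delta>)"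
proof -
  interpret unif: prob_space "unif \<Delta>"
    using \<Delta> by (rule prob_space_unif)
  interpret U: product_sigma_finite "\<lambda>_::nat. unif \<Delta>"
    by standard
  interpret B: product_sigma_finite "\<lambda>_::nat. lborel :: real measure"
    by standard
  let ?B = "{1..n} \<rightarrow>\<^sub>E {-\<Delta>..\<Delta>}"
  show ?thesis
    unfolding B_inf_vzero[OF n]
  proof (rule U.PiM_eqI)
    show "sets (uniform_measure (PiM {1..n} (\<lambda>_. lborel)) ?B) = sets (PiM {1..n} (\<lambda>_. unif \<Delta>))"
      unfolding sets_uniform_measure by (rule sets_PiM_cong) simp_all
    fix A :: "nat \<Rightarrow> real set"
    assume "\<And>i. i \<in> {1..n} \<Longrightarrow> A i \<in> sets (unif \<Delta>)"
    then have A: "\<And>i. i \<in> {1..n} \<Longrightarrow> A i \<in> sets lborel"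
      by simp
    have AB: "?B \<inter> Pi\<^sub>E {1..n} A = (\<Pi>\<^sub>E i\<in>{1..n}. {-\<Delta>..\<Delta>} \<inter> A i)"
      by (auto simp: PiE_iff)
    have meas: "?B \<in> sets (PiM {1..n} (\<lambda>_. lborel))" "Pi\<^sub>E {1..n} A \<in> sets (PiM {1..n} (\<lambda>_. lborel))"
      using A by (auto intro!: sets_PiM_I_finite)
    have "emeasure (uniform_measure (PiM {1..n} (\<lambda>_. lborel)) ?B) (Pi\<^sub>E {1..n} A) =
        (\<Prod>i\<in>{1..n}. emeasure lborel ({-\<Delta>..\<Delta>} \<inter> A i)) / (\<Prod>i\<in>{1..n}. emeasure lborel {-\<Delta>..\<Delta>})"
    proof -
      have "emeasure (PiM {1..n} (\<lambda>_. lborel)) (\<Pi>\<^sub>E i\<in>{1..n}. {-\<Delta>..\<Delta>} \<inter> A i) =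
          (\<Prod>i\<in>{1..n}. emeasure lborel ({-\<Delta>..\<Delta>} \<inter> A i))"
        using A by (intro B.emeasure_PiM) auto
      then show ?thesis
        using meas by (simp add: AB B.emeasure_PiM)
    qed
    also have "\<dots> = (\<Prod>i\<in>{1..n}. emeasure lborel ({-\<Delta>..\<Delta>} \<inter> A i) / emeasure lborel {-\<Delta>..\<Delta>})"
      by (simp only: prod_divide_ennreal prod_constant)
    also have "\<dots> = (\<Prod>i\<in>{1..n}. emeasure (unif \<Delta>) (A i))"
      using A by (intro prod.cong) auto
    finally show "emeasure (uniform_measure (PiM {1..n} (\<lambda>_. lborel)) ?B) (Pi\<^sub>E {1..n} A) =
        (\<Prod>i\<in>{1..n}. emeasure (unif \<Delta>) (A i))" .
  qed simp
qed

lemma AE_unif: "\<Delta> > 0 \<Longrightarrow> AE y in unif \<Delta>. y \<in> {-\<Delta>..\<Delta>}"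
  by (rule AE_uniform_measureI) auto

lemma ess_bounded_unif:
  assumes "\<Delta> > 0"
  shows "ess_bounded (unif \<Delta>) (\<lambda>y. y)"
  using AE_unif[OF assms] by (intro ess_boundedI[where B=\<Delta>]) (auto elim!: AE_mp simp: abs_le_iff)

lemma unif_moment:
  assumes "\<Delta> > 0"
  shows "(\<integral>y. y ^ k \<partial>unif \<Delta>) = (\<Delta> ^ Suc k - (- \<Delta>) ^ Suc k) / (real (Suc k) * (2 * \<Delta>))"
proof -
  have "unif \<Delta> = density lborel (\<lambda>y. ennreal (indicator {-\<Delta>..\<Delta>} y / (2 * \<Delta>)))"
    unfolding uniform_measure_def using assms divide_ennreal[of 1 "2 * \<Delta>"]
    by (intro density_cong) (auto simp: indicator_def)
  then have "(\<integral>y. y ^ k \<partial>unif \<Delta>) = (\<integral>y. (indicator {-\<Delta>..\<Delta>} y / (2 * \<Delta>)) *\<^sub>R y ^ k \<partial>lborel)"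
    using assms by (simp add: integral_density)
  also have "\<dots> = (\<integral>y. (y ^ k * indicator {-\<Delta>..\<Delta>} y) / (2 * \<Delta>) \<partial>lborel)"
    by (intro Bochner_Integration.integral_cong) auto
  also have "\<dots> = (\<Delta> ^ Suc k - (- \<Delta>) ^ Suc k) / real (Suc k) / (2 * \<Delta>)"
    using assms by (subst integral_divide_zero) (simp add: integral_power del: power_Suc)
  finally show ?thesis
    by simp
qed

text \<open>\<open>leg1\<close> and \<open>leg2\<close> are the Legendre polynomials of degrees one
  and two, rescaled to the interval from \<open>- \<Delta>\<close> to \<open>\<Delta>\<close> and
  normalized for its uniform law.\<close>

definition leg1 :: "real \<Rightarrow> real \<Rightarrow> real" where
  "leg1 \<Delta> y = sqrt 3 / \<Delta> * y"

definition leg2 :: "real \<Rightarrow> real \<Rightarrow> real" where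
  "leg2 \<Delta> y = 3 * sqrt 5 / (2 * \<Delta>\<^sup>2) * y\<^sup>2 - sqrt 5 / 2"

lemma leg_bounds:
  assumes "\<Delta> > 0" "y \<in> {-\<Delta>..\<Delta>}"
  shows "(leg1 \<Delta> y)\<^sup>2 \<le> 3" "(leg2 \<Delta> y)\<^sup>2 \<le> 5"
proof -
  define t where "t = (y / \<Delta>)\<^sup>2"
  have t: "0 \<le> t" "t \<le> 1"
    using assms by (auto simp: t_def power_divide divide_le_eq intro!: abs_le_square_iff[THEN iffD1, of y \<Delta>, simplified])
  have "(leg1 \<Delta> y)\<^sup>2 = 3 * t"
    by (simp add: leg1_def t_def power_mult_distrib power_divide)
  with t show "(leg1 \<Delta> y)\<^sup>2 \<le> 3" by simp
  have "leg2 \<Delta> y = sqrt 5 / 2 * (3 * t - 1)"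
    by (simp add: leg2_def t_def power_divide algebra_simps)
  then have "(leg2 \<Delta> y)\<^sup>2 = 5 / 4 * (3 * t - 1)\<^sup>2"
    by (simp only: power_mult_distrib power_divide) simp
  also have "(3 * t - 1)\<^sup>2 \<le> 2\<^sup>2"
    using t by (intro abs_le_square_iff[THEN iffD1]) auto
  finally show "(leg2 \<Delta> y)\<^sup>2 \<le> 5" by simp
qed

lemma orthonormal_pair_leg:
  assumes \<Delta>: "\<Delta> > 0"
  shows "orthonormal_pair (unif \<Delta>) (leg1 \<Delta>) (leg2 \<Delta>)"
proof -
  interpret prob_space "unif \<Delta>"
    using \<Delta> by (rule prob_space_unif)
  note eb = ess_bounded_intros ess_bounded_unif[OF \<Delta>]
  have prob_UNIV: "prob UNIV = 1"
    using prob_space by simp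
  have pow: "\<Delta> ^ 3 = \<Delta>\<^sup>2 * \<Delta>" "\<Delta> ^ 5 = \<Delta> ^ 4 * \<Delta>"
    using power_Suc2[of \<Delta> 2] power_Suc2[of \<Delta> 4] by (simp_all del: power_Suc)
  have m: "expectation (\<lambda>y. y) = 0" "expectation (\<lambda>y. y\<^sup>2) = \<Delta>\<^sup>2 / 3" "expectation (\<lambda>y. y ^ 3) = 0"
      "expectation (\<lambda>y. y ^ 4) = \<Delta> ^ 4 / 5"
    using unif_moment[OF \<Delta>, of 1] unif_moment[OF \<Delta>, of 2] unif_moment[OF \<Delta>, of 3] unif_moment[OF \<Delta>, of 4] \<Delta>
    by (simp_all add: pow)
  define c d where "c = sqrt 3 / \<Delta>" and "d = 3 * sqrt 5 / (2 * \<Delta>\<^sup>2)"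
  have c2: "c\<^sup>2 = 3 / \<Delta>\<^sup>2" and d2: "d\<^sup>2 = 45 / (4 * \<Delta> ^ 4)"
    by (simp_all add: c_def d_def power_divide power_mult_distrib)
  have leg: "leg1 \<Delta> = (\<lambda>y. c * y)" "leg2 \<Delta> = (\<lambda>y. d * y\<^sup>2 - sqrt 5 / 2)"
    by (auto simp: leg1_def leg2_def c_def d_def)
  show ?thesis
  proof
    show "leg1 \<Delta> \<in> borel_measurable (unif \<Delta>)" "leg2 \<Delta> \<in> borel_measurable (unif \<Delta>)"
      unfolding leg by measurable
    show "AE y in unif \<Delta>. (leg1 \<Delta> y)\<^sup>2 \<le> 3" "AE y in unif \<Delta>. (leg2 \<Delta> y)\<^sup>2 \<le> 5"
      using AE_unif[OF \<Delta>] by (eventually_elim, use leg_bounds \<Delta> in blast)+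
    show "expectation (leg1 \<Delta>) = 0"
      by (simp add: leg m)
    have "expectation (leg2 \<Delta>) = d * (\<Delta>\<^sup>2 / 3) - sqrt 5 / 2"
      unfolding leg by (simp add: ess_bounded_integral_diff eb m prob_UNIV)
    then show "expectation (leg2 \<Delta>) = 0"
      using \<Delta> by (simp add: d_def)
    have "(\<lambda>y. (leg1 \<Delta> y)\<^sup>2) = (\<lambda>y. c\<^sup>2 * y\<^sup>2)"
      by (simp add: leg power_mult_distrib)
    then show "expectation (\<lambda>y. (leg1 \<Delta> y)\<^sup>2) = 1"
      using \<Delta> by (simp add: m c2)
    have "(\<lambda>y. (leg2 \<Delta> y)\<^sup>2) = (\<lambda>y. d\<^sup>2 * y ^ 4 - d * sqrt 5 * y\<^sup>2 + 5 / 4)"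
      by (simp add: leg power2_diff power_mult_distrib power_divide fun_eq_iff flip: power_mult)
    then have "expectation (\<lambda>y. (leg2 \<Delta> y)\<^sup>2) = d\<^sup>2 * (\<Delta> ^ 4 / 5) - d * sqrt 5 * (\<Delta>\<^sup>2 / 3) + 5 / 4"
      by (simp add: ess_bounded_integral_diff ess_bounded_integral_add eb m prob_UNIV)
    then show "expectation (\<lambda>y. (leg2 \<Delta> y)\<^sup>2) = 1"
      using \<Delta> by (simp add: d2) (simp add: d_def)
    have "(\<lambda>y. leg1 \<Delta> y * leg2 \<Delta> y) = (\<lambda>y. c * d * y ^ 3 - c * sqrt 5 / 2 * y)"
      by (simp add: leg power3_eq_cube power2_eq_square algebra_simps)
    then show "expectation (\<lambda>y. leg1 \<Delta> y * leg2 \<Delta> y) = 0"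
      by (simp add: ess_bounded_integral_diff eb m del: times_divide_eq_left)
  qed
qed

text \<open>The mixed elements are the extreme ones, being products of two factors of size at most
  \<open>sqrt 3\<close>; squares stay below \<open>sqrt 5\<close>.\<close>

lemma abs_psi_le:
  assumes "\<Delta> > 0" "x \<in> {1..n} \<rightarrow>\<^sub>E {-\<Delta>..\<Delta>}" "l \<in> Q_idx n \<union> L_idx n"
  shows "\<bar>psi \<Delta> l x\<bar> \<le> 3"
proof (rule power2_le_imp_le)
  have b: "(leg1 \<Delta> (x i))\<^sup>2 \<le> 3" "(leg2 \<Delta> (x i))\<^sup>2 \<le> 5" if "i \<in> {1..n}" for i
    using assms(1,2) that by (auto intro!: leg_bounds simp: PiE_iff)
  have "(psi \<Delta> l x)\<^sup>2 \<le> 9"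
    using assms(3) unfolding Q_idx_def L_idx_def
  proof (elim UnE CollectE exE conjE insertE emptyE)
    fix i assume "l = Sq i" "1 \<le> i" "i \<le> n"
    then show ?thesis
      using b(2)[of i] by (simp add: leg2_def)
  next
    fix i assume "l = Lin i" "1 \<le> i" "i \<le> n"
    then show ?thesis
      using b(1)[of i] by (simp add: leg1_def)
  next
    fix i j assume l: "l = Mixed i j" "1 \<le> i" "i < j" "j \<le> n"
    then have "(psi \<Delta> l x)\<^sup>2 = (leg1 \<Delta> (x i))\<^sup>2 * (leg1 \<Delta> (x j))\<^sup>2"
      by (simp add: leg1_def power_mult_distrib power_divide field_simps)
    also have "\<dots> \<le> 3 * 3"
      using b(1)[of i] b(1)[of j] l by (intro mult_mono) auto
    finally show ?thesis by simp
  qed simp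
  then show "\<bar>psi \<Delta> l x\<bar>\<^sup>2 \<le> 3\<^sup>2"
    by simp
qed simp

text \<open>Orthonormality identifies the second moment with the squared Euclidean norm of the
  coefficients, so sampled values can be compared with coefficients directly.\<close>

lemma quad_poly_moments:
  assumes n: "n \<ge> 1" and \<Delta>: "\<Delta> > 0"
  defines "U \<equiv> uniform_measure (PiM {1..n} (\<lambda>_. lborel)) (B_inf n (vzero n) \<Delta>)"
  shows "prob_space U" "ess_bounded U (quad_poly n \<Delta> \<alpha>)"
    "(\<integral>x. (quad_poly n \<Delta> \<alpha> x)\<^sup>2 \<partial>U) = (\<Sum>l\<in>Q_idx n \<union> L_idx n. (\<alpha> l)\<^sup>2)"
    "(\<integral>x. quad_poly n \<Delta> \<alpha> x ^ 4 \<partial>U) \<le> 8640 * (\<Sum>l\<in>Q_idx n \<union> L_idx n. (\<alpha> l)\<^sup>2)\<^sup>2"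
proof -
  interpret orthonormal_pair "unif \<Delta>" "leg1 \<Delta>" "leg2 \<Delta>"
    using \<Delta> by (rule orthonormal_pair_leg)
  have psi: "psi \<Delta> l x = chaos l x" for l x
    by (cases l) (simp_all add: leg1_def leg2_def power2_eq_square)
  have q: "quad_poly n \<Delta> \<alpha> = (\<lambda>x. \<Sum>l\<in>Q_idx n \<union> L_idx n. \<alpha> l * chaos l x)"
    by (auto simp: quad_poly_def psi)
  show "prob_space U" "ess_bounded U (quad_poly n \<Delta> \<alpha>)"
    "(\<integral>x. (quad_poly n \<Delta> \<alpha> x)\<^sup>2 \<partial>U) = (\<Sum>l\<in>Q_idx n \<union> L_idx n. (\<alpha> l)\<^sup>2)"
    "(\<integral>x. quad_poly n \<Delta> \<alpha> x ^ 4 \<partial>U) \<le> 8640 * (\<Sum>l\<in>Q_idx n \<union> L_idx n. (\<alpha> l)\<^sup>2)\<^sup>2"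
    unfolding U_def uniform_measure_cube[OF n \<Delta>] q
    using Pr_prob_space quadratic_moments[where n=n and \<alpha>=\<alpha>] by auto
qed

subsection \<open>Lower tails of empirical second moments\<close>

text \<open>The right-hand side times the quadratic Taylor polynomial of \<open>exp x\<close> is 1 +
  x^4 / 4.\<close>

lemma exp_minus_le:
  fixes x :: real
  assumes "x \<ge> 0"
  shows "exp (- x) \<le> 1 - x + x\<^sup>2 / 2"
proof -
  have "1 \<le> (1 + x + x\<^sup>2 / 2) * (1 - x + x\<^sup>2 / 2)"
  proof -
    have "(1 + x + x\<^sup>2 / 2) * (1 - x + x\<^sup>2 / 2) = 1 + (x\<^sup>2)\<^sup>2 / 4"
      by (simp add: power2_eq_square algebra_simps)
    then show ?thesis by simp
  qed
  also have "\<dots> \<le> exp x * (1 - x + x\<^sup>2 / 2)"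
  proof (intro mult_right_mono exp_lower_Taylor_quadratic assms)
    have "1 - x + x\<^sup>2 / 2 = ((1 - x)\<^sup>2 + 1) / 2"
      by (simp add: power2_eq_square field_simps)
    then show "0 \<le> 1 - x + x\<^sup>2 / 2"
      by (simp only:) simp
  qed
  finally show ?thesis
    by (simp add: exp_minus field_simps)
qed

text \<open>A Chernoff bound with a negative exponent: exp (- s f^2) never exceeds 1, and its mean
  is controlled by the second and fourth moments of \<open>f\<close> alone.\<close>

lemma (in prob_space) empirical_second_moment_lower_tail:
  fixes p :: nat
  assumes f: "ess_bounded M f" and C: "C > 0"
    and v: "(\<integral>x. (f x)\<^sup>2 \<partial>M) = v" and f4: "(\<integral>x. f x ^ 4 \<partial>M) \<le> C * v\<^sup>2"
  defines "S \<equiv> PiM {1..p} (\<lambda>_. M)"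
  shows "{Y \<in> space S. (\<Sum>i\<in>{1..p}. (f (Y i))\<^sup>2) < real p / 2 * v} \<in> sets S"
    and "measure S {Y \<in> space S. (\<Sum>i\<in>{1..p}. (f (Y i))\<^sup>2) < real p / 2 * v} \<le> exp (- real p / (8 * C))"
proof -
  interpret S: prob_space S
    unfolding S_def by (intro prob_space_PiM prob_space_axioms)
  interpret P: product_sigma_finite "\<lambda>_::nat. M"
    by standard
  have [measurable]: "f \<in> borel_measurable M"
    using f by (rule ess_bounded_measurable)
  have comp [measurable]: "(\<lambda>Y. Y i) \<in> measurable S M" if "i \<in> {1..p}" for i
    using that unfolding S_def by (rule measurable_component_singleton)
  show sets: "{Y \<in> space S. (\<Sum>i\<in>{1..p}. (f (Y i))\<^sup>2) < real p / 2 * v} \<in> sets S"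
    by measurable
  have "v \<ge> 0"
    unfolding v[symmetric] by simp
  show "measure S {Y \<in> space S. (\<Sum>i\<in>{1..p}. (f (Y i))\<^sup>2) < real p / 2 * v} \<le> exp (- real p / (8 * C))"
  proof (cases "v = 0")
    case True
    then have "{Y \<in> space S. (\<Sum>i\<in>{1..p}. (f (Y i))\<^sup>2) < real p / 2 * v} = {}"
      by (auto simp: not_less intro!: sum_nonneg)
    then show ?thesis by (simp only: measure_empty exp_ge_zero)
  next
    case False
    with \<open>v \<ge> 0\<close> have "v > 0" by simp
    \<comment> \<open>Then s v = 1 / (2 C), and one factor has mean at most 1 - 1 / (2 C) + 1 / (8
      C) = 1 - 3 / (8 C). The threshold p v / 2 costs exp (p / (4 C)), which leaves exp (- p / (8
      C)).\<close>
    define s where "s = 1 / (2 * C * v)"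
    have s: "s > 0" "s * v = 1 / (2 * C)"
      using \<open>v > 0\<close> C by (auto simp: s_def)
    define g where "g x = exp (- (s * (f x)\<^sup>2))" for x
    have [measurable]: "g \<in> borel_measurable M"
      unfolding g_def by measurable
    have g: "0 < g x" "g x \<le> 1" for x
      using s by (auto simp: g_def)
    have g_int: "integrable M g"
      using g by (intro integrable_const_bound[where B=1]) (auto simp: less_imp_le)
    have "(\<integral>x. g x \<partial>M) \<le> (\<integral>x. 1 - s * (f x)\<^sup>2 + s\<^sup>2 / 2 * f x ^ 4 \<partial>M)"
    proof (rule integral_mono[OF g_int])
      show "integrable M (\<lambda>x. 1 - s * (f x)\<^sup>2 + s\<^sup>2 / 2 * f x ^ 4)"
        by (intro ess_bounded_integrable ess_bounded_intros f)
      show "g x \<le> 1 - s * (f x)\<^sup>2 + s\<^sup>2 / 2 * f x ^ 4" for x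
        using exp_minus_le[of "s * (f x)\<^sup>2"] s unfolding g_def
        by (simp add: power_mult_distrib flip: power_mult)
    qed
    also have "\<dots> = 1 - s * v + s\<^sup>2 / 2 * (\<integral>x. f x ^ 4 \<partial>M)"
      by (simp add: ess_bounded_integral_add ess_bounded_integral_diff ess_bounded_intros f v prob_space
          del: times_divide_eq_left)
    also have "\<dots> \<le> 1 - s * v + s\<^sup>2 / 2 * (C * v\<^sup>2)"
      by (intro add_left_mono mult_left_mono f4) auto
    also have "\<dots> = 1 - s * v + C / 2 * (s * v)\<^sup>2"
      by (simp add: power_mult_distrib)
    also have "\<dots> = 1 + (- 3 / (8 * C))"
      unfolding s using C by (simp add: power2_eq_square field_simps)
    also have "\<dots> \<le> exp (- 3 / (8 * C))"
      by (rule exp_ge_add_one_self)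
    finally have g_mean: "(\<integral>x. g x \<partial>M) \<le> exp (- 3 / (8 * C))" .
    define G where "G Y = (\<Prod>i\<in>{1..p}. g (Y i))" for Y
    have [measurable]: "G \<in> borel_measurable S"
      unfolding G_def by measurable
    have G: "0 \<le> G Y" "G Y \<le> 1" for Y
      unfolding G_def using g by (auto intro!: prod_nonneg prod_le_1 simp: less_imp_le)
    have "(\<integral>Y. G Y \<partial>S) = (\<Prod>i\<in>{1..p}. \<integral>x. g x \<partial>M)"
      unfolding G_def S_def using g_int by (intro P.product_integral_prod) auto
    also have "\<dots> \<le> (\<Prod>i\<in>{1..p}. exp (- 3 / (8 * C)))"
      using g g_mean by (intro prod_mono) (auto intro!: Bochner_Integration.integral_nonneg simp: less_imp_le)
    also have "\<dots> = exp (- 3 * real p / (8 * C))"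
      by (simp add: exp_of_nat_mult[symmetric])
    finally have G_mean: "(\<integral>Y. G Y \<partial>S) \<le> exp (- 3 * real p / (8 * C))" .
    let ?c = "exp (- real p / (4 * C))"
    have "measure S {Y \<in> space S. (\<Sum>i\<in>{1..p}. (f (Y i))\<^sup>2) < real p / 2 * v} \<le>
        measure S {Y \<in> space S. G Y \<ge> ?c}"
    proof (rule S.finite_measure_mono)
      show "{Y \<in> space S. G Y \<ge> ?c} \<in> sets S"
        by measurable
      have "G Y \<ge> ?c" if "(\<Sum>i\<in>{1..p}. (f (Y i))\<^sup>2) < real p / 2 * v" for Y
      proof -
        have "s * (\<Sum>i\<in>{1..p}. (f (Y i))\<^sup>2) \<le> s * (real p / 2 * v)"
          using that s by (intro mult_left_mono) auto
        also have "\<dots> = real p / 2 * (s * v)"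
          by simp
        also have "\<dots> = real p / (4 * C)"
          by (simp add: s)
        finally show ?thesis
          by (simp add: G_def g_def sum_distrib_left sum_negf flip: exp_sum)
      qed
      then show "{Y \<in> space S. (\<Sum>i\<in>{1..p}. (f (Y i))\<^sup>2) < real p / 2 * v} \<subseteq> {Y \<in> space S. G Y \<ge> ?c}"
        by auto
    qed
    also have "\<dots> \<le> (\<integral>Y. G Y \<partial>S) / ?c"
    proof (rule integral_Markov_inequality_measure[where A="{}"])
      show "integrable S G"
        using G by (intro S.integrable_const_bound[where B=1]) auto
    qed (use G in auto)
    also have "\<dots> \<le> exp (- 3 * real p / (8 * C)) / ?c"
      by (intro divide_right_mono G_mean) simp
    also have "\<dots> = exp (- real p / (8 * C))"
      using C by (simp flip: exp_diff)
    finally show ?thesis .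
  qed
qed

text \<open>A union bound over \<open>F\<close>, with 69120 = 8 * 8640. The event also forces the
  sample points into the ball: outcomes range over a larger space, while the bounds on the basis and
  on the model hold only there. Almost sure membership makes this free.\<close>

lemma sample_measure_lower_bound:
  assumes n: "n \<ge> 1" and \<Delta>: "\<Delta> > 0" and F: "finite F"
  obtains E where "E \<in> sets (sample_measure n p \<Delta>)"
    and "measure (sample_measure n p \<Delta>) E \<ge> 1 - real (card F) * exp (- real p / 69120)"
    and "\<And>Y i. Y \<in> E \<Longrightarrow> i \<in> {1..p} \<Longrightarrow> Y i \<in> B_inf n (vzero n) \<Delta>"
    and "\<And>Y z. Y \<in> E \<Longrightarrow> z \<in> F \<Longrightarrow>
      real p / 2 * (\<Sum>l\<in>Q_idx n \<union> L_idx n. (z l)\<^sup>2) \<le> (\<Sum>i\<in>{1..p}. (quad_poly n \<Delta> z (Y i))\<^sup>2)"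
proof -
  define U where "U = uniform_measure (PiM {1..n} (\<lambda>_. lborel :: real measure)) (B_inf n (vzero n) \<Delta>)"
  define S where "S = PiM {1..p} (\<lambda>_. U)"
  have S_eq: "sample_measure n p \<Delta> = S"
    by (simp add: sample_measure_def S_def U_def)
  note mom = quad_poly_moments[OF n \<Delta>, folded U_def]
  interpret U: prob_space U by (rule mom)
  interpret S: prob_space S
    unfolding S_def by (intro prob_space_PiM U.prob_space_axioms)
  define bad where "bad z = {Y \<in> space S. (\<Sum>i\<in>{1..p}. (quad_poly n \<Delta> z (Y i))\<^sup>2)
      < real p / 2 * (\<Sum>l\<in>Q_idx n \<union> L_idx n. (z l)\<^sup>2)}" for z
  have bad: "bad z \<in> sets S" "measure S (bad z) \<le> exp (- real p / 69120)" for z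
    using U.empirical_second_moment_lower_tail[where f="quad_poly n \<Delta> z" and p=p and C=8640, OF mom(2) _ mom(3,4)]
    unfolding bad_def S_def by simp_all
  let ?B = "B_inf n (vzero n) \<Delta>"
  have B: "?B \<in> sets (PiM {1..n} (\<lambda>_. lborel))"
    unfolding B_inf_vzero[OF n] by (auto intro!: sets_PiM_I_finite)
  define E0 where "E0 = space S - (\<Union>z\<in>F. bad z)"
  define E where "E = E0 \<inter> {Y \<in> space S. \<forall>i\<in>{1..p}. Y i \<in> ?B}"
  have E0: "E0 \<in> sets S"
    unfolding E0_def using bad F by (intro sets.Diff sets.top sets.finite_UN) auto
  have "{Y \<in> space S. Y i \<in> ?B} \<in> sets S" if "i \<in> {1..p}" for i
  proof -
    have "(\<lambda>Y. Y i) \<in> measurable S U"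
      using that unfolding S_def by (rule measurable_component_singleton)
    moreover have "?B \<in> sets U"
      using B by (simp add: U_def)
    ultimately have "(\<lambda>Y. Y i) -` ?B \<inter> space S \<in> sets S"
      by (rule measurable_sets)
    also have "(\<lambda>Y. Y i) -` ?B \<inter> space S = {Y \<in> space S. Y i \<in> ?B}"
      by auto
    finally show ?thesis .
  qed
  then have E: "E \<in> sets S"
    unfolding E_def using E0 by (intro sets.Int sets.sets_Collect_finite_All) auto
  have "AE Y in S. \<forall>i\<in>{1..p}. Y i \<in> ?B"
  proof (intro AE_finite_allI)
    fix i assume i: "i \<in> {1..p}"
    have "AE y in U. y \<in> ?B"
      unfolding U_def using B by (intro AE_uniform_measureI) auto
    then show "AE Y in S. Y i \<in> ?B"
      unfolding S_def using i by (intro AE_PiM_component[where P="\<lambda>y. y \<in> ?B"] U.prob_space_axioms)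
  qed simp
  then have "measure S E = measure S E0"
    using E E0 by (intro S.finite_measure_eq_AE) (auto simp: E_def E0_def)
  also have "\<dots> = 1 - measure S (\<Union>z\<in>F. bad z)"
    unfolding E0_def using bad F by (intro S.prob_compl sets.finite_UN) auto
  finally have "measure S E = 1 - measure S (\<Union>z\<in>F. bad z)" .
  moreover have "measure S (\<Union>z\<in>F. bad z) \<le> (\<Sum>z\<in>F. measure S (bad z))"
    using F bad by (intro S.finite_measure_subadditive_finite) auto
  moreover have "\<dots> \<le> real (card F) * exp (- real p / 69120)"
    using bad by (intro sum_bounded_above) auto
  ultimately have "measure S E \<ge> 1 - real (card F) * exp (- real p / 69120)"
    by linarith
  then show ?thesis
    using E by (intro that[of E]) (auto simp: S_eq E_def E0_def bad_def not_less)
qed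

subsection \<open>Sparse approximation and the restricted lower bound\<close>

text \<open>Maurey's argument, derandomized: averaging the new error over the weights \<open>w\<close> kills the cross
  term, so some point of \<open>J\<close> does at least as well as the average.\<close>
lemma sparse_approximation:
  fixes g :: "'j \<Rightarrow> 't \<Rightarrow> real" and w :: "'j \<Rightarrow> real"
  assumes J: "finite J" and w: "\<And>j. j \<in> J \<Longrightarrow> 0 \<le> w j" "sum w J = 1"
    and B: "\<And>j. j \<in> J \<Longrightarrow> (\<Sum>t\<in>S. (g j t)\<^sup>2) \<le> B"
    and x: "\<And>t. t \<in> S \<Longrightarrow> x t = (\<Sum>j\<in>J. w j * g j t)"
  shows "\<exists>js. (\<forall>i<k. js i \<in> J) \<and> (\<Sum>t\<in>S. (\<Sum>i<k. g (js i) t - x t)\<^sup>2) \<le> real k * B"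
proof (induction k)
  case 0
  then show ?case by simp
next
  case (Suc k)
  then obtain js where js: "\<forall>i<k. js i \<in> J" "(\<Sum>t\<in>S. (\<Sum>i<k. g (js i) t - x t)\<^sup>2) \<le> real k * B"
    by blast
  define s where "s t = (\<Sum>i<k. g (js i) t - x t)" for t
  define Q where "Q j = (\<Sum>t\<in>S. (s t + (g j t - x t))\<^sup>2)" for j
  have "J \<noteq> {}"
    using w by auto
  then have "Min (Q ` J) \<in> Q ` J"
    using J by (intro Min_in) auto
  then obtain j where j: "j \<in> J" "Q j = Min (Q ` J)"
    by auto
  have "Q j = (\<Sum>i\<in>J. w i * Q j)"
    using w by (simp flip: sum_distrib_right)
  also have "\<dots> \<le> (\<Sum>i\<in>J. w i * Q i)"
    using w J j by (intro sum_mono mult_left_mono) auto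
  also have "\<dots> = (\<Sum>t\<in>S. \<Sum>i\<in>J. w i * (s t + (g i t - x t))\<^sup>2)"
    unfolding Q_def sum_distrib_left by (rule sum.swap)
  also have "\<dots> \<le> (\<Sum>t\<in>S. (s t)\<^sup>2 + (\<Sum>i\<in>J. w i * (g i t)\<^sup>2))"
  proof (rule sum_mono)
    fix t assume t: "t \<in> S"
    have "(\<Sum>i\<in>J. w i * (s t + (g i t - x t))\<^sup>2) =
        (\<Sum>i\<in>J. w i * (s t - x t)\<^sup>2 + w i * (g i t)\<^sup>2 + 2 * (s t - x t) * (w i * g i t))"
      by (intro sum.cong) (auto simp: power2_eq_square algebra_simps)
    also have "\<dots> = (s t - x t)\<^sup>2 + (\<Sum>i\<in>J. w i * (g i t)\<^sup>2) + 2 * (s t - x t) * x t"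
      by (simp only: sum.distrib x[OF t] w(2) flip: sum_distrib_right sum_distrib_left)
    \<comment> \<open>The terms free of \<open>g\<close> combine to
      \<open>(s t)^2 - (x t)^2\<close>.\<close>
    also have "\<dots> \<le> (s t)\<^sup>2 + (\<Sum>i\<in>J. w i * (g i t)\<^sup>2)"
      by (simp add: power2_eq_square algebra_simps)
    finally show "(\<Sum>i\<in>J. w i * (s t + (g i t - x t))\<^sup>2) \<le> (s t)\<^sup>2 + (\<Sum>i\<in>J. w i * (g i t)\<^sup>2)" .
  qed
  also have "\<dots> = (\<Sum>t\<in>S. (s t)\<^sup>2) + (\<Sum>i\<in>J. w i * (\<Sum>t\<in>S. (g i t)\<^sup>2))"
    unfolding sum.distrib sum_distrib_left by (subst sum.swap) simp
  also have "\<dots> \<le> real k * B + (\<Sum>i\<in>J. w i * B)"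
    using js(2) w B unfolding s_def by (intro add_mono sum_mono mult_left_mono) auto
  also have "\<dots> = real (Suc k) * B"
    using w(2) by (simp add: algebra_simps flip: sum_distrib_left)
  finally have "Q j \<le> real (Suc k) * B" .
  moreover have "(\<Sum>i<Suc k. g ((js(k := j)) i) t - x t) = s t + (g j t - x t)" for t
    by (simp add: s_def)
  ultimately show ?case
    using js(1) j(1) unfolding Q_def by (intro exI[of _ "js(k := j)"]) (auto simp: less_Suc_eq)
qed

text \<open>Maurey's approximant before scaling: \<open>\<tau> i\<close> is a position with a sign,
  and positions may repeat.\<close>

definition signed_count :: "nat \<Rightarrow> (nat \<Rightarrow> 'i \<times> real) \<Rightarrow> 'i \<Rightarrow> real" where
  "signed_count k \<tau> l = (\<Sum>i<k. if fst (\<tau> i) = l then snd (\<tau> i) else 0)"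

lemma sum_signed_count:
  assumes "finite I" "\<And>i. i < k \<Longrightarrow> fst (\<tau> i) \<in> I"
  shows "(\<Sum>l\<in>I. c l * signed_count k \<tau> l) = (\<Sum>i<k. c (fst (\<tau> i)) * snd (\<tau> i))"
proof -
  have "(\<Sum>l\<in>I. c l * signed_count k \<tau> l) = (\<Sum>i<k. \<Sum>l\<in>I. if l = fst (\<tau> i) then c l * snd (\<tau> i) else 0)"
    unfolding signed_count_def sum_distrib_left by (subst sum.swap) (auto intro!: sum.cong)
  also have "\<dots> = (\<Sum>i<k. c (fst (\<tau> i)) * snd (\<tau> i))"
    using assms by (intro sum.cong) auto
  finally show ?thesis .
qed

text \<open>A vector \<open>v\<close> of the cone is compared with r / k times a vector
  \<open>z\<close> of the net, in the coefficient norm and in the normalized sampled norm at once.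
  The net bound for \<open>z\<close> then transfers to \<open>v\<close> with errors proportional to
  the norm of \<open>v\<close>, because the cone condition bounds \<open>r\<close> by that
  norm.\<close>

lemma restricted_lower_bound:
  fixes a :: "nat \<Rightarrow> 'i \<Rightarrow> real"
  assumes I: "finite I" and p: "p \<ge> 1" and k: "250 * R\<^sup>2 \<le> real k"
    and a: "\<And>i l. i \<in> {1..p} \<Longrightarrow> l \<in> I \<Longrightarrow> \<bar>a i l\<bar> \<le> 3"
    and net: "\<And>\<tau>. \<tau> \<in> {..<k} \<rightarrow>\<^sub>E I \<times> {1, -1} \<Longrightarrow> real p / 2 * (\<Sum>l\<in>I. (signed_count k \<tau> l)\<^sup>2)
       \<le> (\<Sum>i\<in>{1..p}. (\<Sum>l\<in>I. a i l * signed_count k \<tau> l)\<^sup>2)"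
    and v: "(\<Sum>l\<in>I. \<bar>v l\<bar>) \<le> R * L2_set v I" and R: "R > 0"
  shows "sqrt (real p) * L2_set v I \<le> 4 * L2_set (\<lambda>i. \<Sum>l\<in>I. a i l * v l) {1..p}"
proof (cases "(\<Sum>l\<in>I. \<bar>v l\<bar>) = 0")
  case True
  then have "L2_set v I = 0"
    using L2_set_le_sum_abs[of v I] L2_set_nonneg[of v I] by linarith
  then show ?thesis
    by (simp add: L2_set_nonneg)
next
  case False
  define r where "r = (\<Sum>l\<in>I. \<bar>v l\<bar>)"
  have r: "r > 0"
    using False by (simp add: r_def sum_nonneg less_le)
  have k0: "0 < real k"
    using k R by (smt (verit) zero_less_power mult_pos_pos)
  define \<sigma> :: "'i \<Rightarrow> real" where "\<sigma> l = (if v l < 0 then - 1 else 1)" for l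
  have \<sigma>: "(\<sigma> l)\<^sup>2 = 1" "\<bar>v l\<bar> * \<sigma> l = v l" "\<sigma> l \<in> {1, -1}" for l
    by (auto simp: \<sigma>_def)
  \<comment> \<open>Left indices carry the coefficients, right indices the sampled values divided by
    \<open>sqrt p\<close>. Since basis values are at most 3, each \<open>g l\<close> has squared
    norm at most (1 + 9) r^2, and the joint vector \<open>x\<close> of \<open>v\<close> is a convex
    combination of them with weights \<open>\<bar>v l\<bar> / r\<close>.\<close>
  define g :: "'i \<Rightarrow> 'i + nat \<Rightarrow> real" where
    "g l = case_sum (\<lambda>m. if m = l then r * \<sigma> l else 0) (\<lambda>i. r * \<sigma> l * (a i l / sqrt (real p)))" for l
  define x :: "'i + nat \<Rightarrow> real" where
    "x = case_sum v (\<lambda>i. (\<Sum>l\<in>I. a i l * v l) / sqrt (real p))"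
  have "\<exists>js. (\<forall>i<k. js i \<in> I) \<and>
      (\<Sum>t\<in>I <+> {1..p}. (\<Sum>i<k. g (js i) t - x t)\<^sup>2) \<le> real k * (10 * r\<^sup>2)"
  proof (rule sparse_approximation[where w="\<lambda>l. \<bar>v l\<bar> / r"])
    show "(\<Sum>l\<in>I. \<bar>v l\<bar> / r) = 1"
      using r by (simp add: r_def flip: sum_divide_distrib)
    show "(\<Sum>t\<in>I <+> {1..p}. (g l t)\<^sup>2) \<le> 10 * r\<^sup>2" if l: "l \<in> I" for l
    proof -
      have "(\<Sum>m\<in>I. (g l (Inl m))\<^sup>2) = (\<Sum>m\<in>I. if m = l then r\<^sup>2 else 0)"
        by (intro sum.cong) (auto simp: g_def power_mult_distrib \<sigma>)
      also have "\<dots> = r\<^sup>2"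
        using I l by simp
      finally have 1: "(\<Sum>m\<in>I. (g l (Inl m))\<^sup>2) = r\<^sup>2" .
      have "(\<Sum>i\<in>{1..p}. (g l (Inr i))\<^sup>2) \<le> (\<Sum>i\<in>{1..p}. r\<^sup>2 * (9 / real p))"
      proof (rule sum_mono)
        fix i assume "i \<in> {1..p}"
        then have "(a i l)\<^sup>2 \<le> 3\<^sup>2"
          using a l by (intro power2_le_iff_abs_le[THEN iffD2]) auto
        then show "(g l (Inr i))\<^sup>2 \<le> r\<^sup>2 * (9 / real p)"
          using p by (simp add: g_def power_mult_distrib power_divide \<sigma> divide_right_mono mult_left_mono)
      qed
      also have "\<dots> = 9 * r\<^sup>2"
        using p by simp
      finally show ?thesis
        using I 1 by (simp add: sum.Plus)
    qed
    show "x t = (\<Sum>l\<in>I. \<bar>v l\<bar> / r * g l t)" if "t \<in> I <+> {1..p}" for t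
    proof (cases t)
      case (Inl m)
      have "(\<Sum>l\<in>I. \<bar>v l\<bar> / r * g l t) = (\<Sum>l\<in>I. if l = m then \<bar>v l\<bar> * \<sigma> l else 0)"
        using r by (intro sum.cong) (auto simp: g_def Inl)
      also have "\<dots> = v m"
        using that I Inl by (auto simp: \<sigma>)
      finally show ?thesis
        by (simp add: x_def Inl)
    next
      case (Inr i)
      have "(\<Sum>l\<in>I. \<bar>v l\<bar> / r * g l t) = (\<Sum>l\<in>I. (\<bar>v l\<bar> * \<sigma> l) * a i l / sqrt (real p))"
        using r by (intro sum.cong) (auto simp: g_def Inr)
      also have "\<dots> = x t"
        by (simp only: \<sigma>) (simp add: x_def Inr sum_divide_distrib mult.commute)
      finally show ?thesis ..
    qed
  qed (use I r in auto)
  then obtain js where js: "\<And>i. i < k \<Longrightarrow> js i \<in> I"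
    and err: "(\<Sum>t\<in>I <+> {1..p}. (\<Sum>i<k. g (js i) t - x t)\<^sup>2) \<le> real k * (10 * r\<^sup>2)"
    by blast
  define \<tau> where "\<tau> = (\<lambda>i\<in>{..<k}. (js i, \<sigma> (js i)))"
  have \<tau>: "\<tau> \<in> {..<k} \<rightarrow>\<^sub>E I \<times> {1, -1}"
    using js \<sigma>(3) by (auto simp: \<tau>_def)
  define z where "z = signed_count k \<tau>"
  have Az: "(\<Sum>l\<in>I. c l * z l) = (\<Sum>i<k. c (js i) * \<sigma> (js i))" for c
  proof -
    have "(\<Sum>l\<in>I. c l * z l) = (\<Sum>i<k. c (fst (\<tau> i)) * snd (\<tau> i))"
      unfolding z_def using js by (intro sum_signed_count[OF I]) (auto simp: \<tau>_def)
    also have "\<dots> = (\<Sum>i<k. c (js i) * \<sigma> (js i))"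
      by (intro sum.cong) (auto simp: \<tau>_def)
    finally show ?thesis .
  qed
  define A where "A u i = (\<Sum>l\<in>I. a i l * u l) / sqrt (real p)" for u :: "'i \<Rightarrow> real" and i
  have gl: "(\<Sum>i<k. g (js i) (Inl m) - x (Inl m)) = r * z m - real k * v m" if "m \<in> I" for m
  proof -
    have "z m = (\<Sum>l\<in>I. (if l = m then 1 else 0) * z l)"
      using I that by (simp add: if_distrib[of "\<lambda>c. c * _"] cong: if_cong)
    also have "\<dots> = (\<Sum>i<k. (if js i = m then 1 else 0) * \<sigma> (js i))"
      by (rule Az)
    finally have "r * z m = (\<Sum>i<k. g (js i) (Inl m))"
      by (auto simp: g_def sum_distrib_left intro!: sum.cong)
    then show ?thesis
      by (simp add: sum_subtractf x_def)
  qed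
  have gr: "(\<Sum>i<k. g (js i) (Inr t) - x (Inr t)) = r * A z t - real k * A v t" for t
    unfolding A_def Az
    by (simp add: sum_subtractf x_def g_def sum_distrib_left sum_divide_distrib mult_ac)
  \<comment> \<open>The root of the Maurey error k * 10 r^2. The requirement
    \<open>250 * R^2 \<le> k\<close> is exactly what makes it at most one fifth of k times the norm
    of \<open>v\<close>.\<close>
  define e where "e = r * sqrt (10 * real k)"
  have "(\<Sum>m\<in>I. (r * z m - real k * v m)\<^sup>2) + (\<Sum>t\<in>{1..p}. (r * A z t - real k * A v t)\<^sup>2) \<le> e\<^sup>2"
    using err I by (simp add: sum.Plus gl gr e_def power_mult_distrib mult_ac)
  moreover have "0 \<le> (\<Sum>m\<in>I. (r * z m - real k * v m)\<^sup>2)" "0 \<le> (\<Sum>t\<in>{1..p}. (r * A z t - real k * A v t)\<^sup>2)"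
    by (auto intro: sum_nonneg)
  moreover have "e \<ge> 0"
    using r by (simp add: e_def)
  ultimately have eI: "L2_set (\<lambda>m. real k * v m - r * z m) I \<le> e" and eP: "L2_set (\<lambda>t. r * A z t - real k * A v t) {1..p} \<le> e"
    unfolding L2_set_def by (auto intro!: real_le_lsqrt simp: power2_commute[of "real k * _"])
  have "real k * L2_set v I = L2_set (\<lambda>m. r * z m + (real k * v m - r * z m)) I"
    by (simp add: L2_set_right_distrib)
  also have "\<dots> \<le> L2_set (\<lambda>m. r * z m) I + L2_set (\<lambda>m. real k * v m - r * z m) I"
    by (rule L2_set_triangle_ineq)
  also have "\<dots> \<le> r * L2_set z I + e"
    using eI r by (simp add: L2_set_right_distrib)
  finally have 1: "real k * L2_set v I \<le> r * L2_set z I + e" .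
  have "r * L2_set (A z) {1..p} = L2_set (\<lambda>t. real k * A v t + (r * A z t - real k * A v t)) {1..p}"
    using r by (simp add: L2_set_right_distrib)
  also have "\<dots> \<le> L2_set (\<lambda>t. real k * A v t) {1..p} + L2_set (\<lambda>t. r * A z t - real k * A v t) {1..p}"
    by (rule L2_set_triangle_ineq)
  also have "\<dots> \<le> real k * L2_set (A v) {1..p} + e"
    using eP by (simp add: L2_set_right_distrib)
  finally have 2: "r * L2_set (A z) {1..p} \<le> real k * L2_set (A v) {1..p} + e" .
  \<comment> \<open>7/10 is a rational stand-in for sqrt (1/2), since 49/100 is below 1/2.\<close>
  have "7 / 10 * L2_set z I \<le> L2_set (A z) {1..p}"
  proof (rule power2_le_imp_le)
    have "(7 / 10 * L2_set z I)\<^sup>2 \<le> 1 / 2 * (\<Sum>l\<in>I. (z l)\<^sup>2)"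
      by (simp add: power_mult_distrib L2_set_def sum_nonneg power2_eq_square)
    also have "\<dots> \<le> (\<Sum>i\<in>{1..p}. (\<Sum>l\<in>I. a i l * z l)\<^sup>2) / real p"
      using net[OF \<tau>] p by (simp add: z_def field_simps)
    also have "\<dots> = (L2_set (A z) {1..p})\<^sup>2"
      by (simp add: L2_set_def sum_nonneg A_def power_divide) (simp flip: sum_divide_distrib)
    finally show "(7 / 10 * L2_set z I)\<^sup>2 \<le> (L2_set (A z) {1..p})\<^sup>2" .
  qed (rule L2_set_nonneg)
  then have "r * (7 / 10 * L2_set z I) \<le> r * L2_set (A z) {1..p}"
    using r by (intro mult_left_mono) auto
  with 1 2 have "7 / 10 * (real k * L2_set v I) \<le> real k * L2_set (A v) {1..p} + 17 / 10 * e"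
    by argo
  moreover have "e \<le> (real k * L2_set v I) / 5"
  proof -
    have "R * sqrt (10 * real k) \<le> real k / 5"
    proof (rule power2_le_imp_le)
      have "(R * sqrt (10 * real k))\<^sup>2 = 10 * real k * R\<^sup>2"
        by (simp add: power_mult_distrib)
      also have "\<dots> \<le> (real k / 5)\<^sup>2"
        using mult_left_mono[OF k, of "real k"] by (simp add: power2_eq_square)
      finally show "(R * sqrt (10 * real k))\<^sup>2 \<le> (real k / 5)\<^sup>2" .
    qed simp
    then have "L2_set v I * (R * sqrt (10 * real k)) \<le> L2_set v I * (real k / 5)"
      by (intro mult_left_mono L2_set_nonneg)
    moreover have "e \<le> R * L2_set v I * sqrt (10 * real k)"
      using v unfolding e_def r_def by (intro mult_right_mono) auto
    ultimately show ?thesis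
      by (simp add: mult_ac)
  qed
  moreover have "0 \<le> real k * L2_set v I"
    by simp
  \<comment> \<open>What remains is 7/10 - (17/10) / 5 = 9/25, more than 1/4.\<close>
  ultimately have "(real k * L2_set v I) / 4 \<le> real k * L2_set (A v) {1..p}"
    by argo
  then have "L2_set v I \<le> 4 * L2_set (A v) {1..p}"
    using k0 by simp
  moreover have "L2_set (\<lambda>i. \<Sum>l\<in>I. a i l * v l) {1..p} = sqrt (real p) * L2_set (A v) {1..p}"
    using p by (subst L2_set_right_distrib) (auto simp: A_def)
  ultimately show ?thesis
    using p by (simp add: mult.left_commute mult_left_mono)
qed

lemma sum_abs_le_L2_set: "(\<Sum>i\<in>A. \<bar>f i\<bar>) \<le> sqrt (real (card A)) * L2_set f A"
  using L2_set_mult_ineq[of f "\<lambda>_. 1" A] by (simp add: L2_set_def mult.commute)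

text \<open>The error of an \<open>\<ell>\<^sub>1\<close> minimizer is concentrated on the support \<open>S\<close> of the competitor and on the
  unpenalized indices \<open>L\<close>.\<close>
lemma l1_cone:
  fixes \<alpha> \<beta> :: "'i \<Rightarrow> real"
  assumes fin: "finite Q" "finite L" and disj: "Q \<inter> L = {}"
    and le: "(\<Sum>l\<in>Q. \<bar>\<alpha> l\<bar>) \<le> (\<Sum>l\<in>Q. \<bar>\<beta> l\<bar>)" and s: "card {l \<in> Q. \<beta> l \<noteq> 0} + card L \<le> s"
  defines "v \<equiv> \<lambda>l. \<alpha> l - \<beta> l"
  shows "(\<Sum>l\<in>Q \<union> L. \<bar>v l\<bar>) \<le> 2 * sqrt (real s) * L2_set v (Q \<union> L)"
proof -
  define S where "S = {l \<in> Q. \<beta> l \<noteq> 0}"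
  have S: "S \<subseteq> Q" "finite S"
    using fin by (auto simp: S_def)
  have split: "(\<Sum>l\<in>Q. F l) = (\<Sum>l\<in>Q - S. F l) + (\<Sum>l\<in>S. F l)" for F :: "'i \<Rightarrow> real"
    using fin S by (intro sum.subset_diff)
  \<comment> \<open>Off the support of \<open>\<beta>\<close> the error is \<open>\<alpha>\<close>
    itself, so minimality bounds its mass there by its mass on the support.\<close>
  have "(\<Sum>l\<in>Q - S. \<bar>\<alpha> l\<bar>) = (\<Sum>l\<in>Q - S. \<bar>v l\<bar>)" "(\<Sum>l\<in>Q - S. \<bar>\<beta> l\<bar>) = 0"
    by (auto simp: S_def v_def intro!: sum.cong)
  moreover have "(\<Sum>l\<in>S. \<bar>\<beta> l\<bar>) \<le> (\<Sum>l\<in>S. \<bar>\<alpha> l\<bar> + \<bar>v l\<bar>)"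
    by (intro sum_mono) (auto simp: v_def)
  ultimately have "(\<Sum>l\<in>Q - S. \<bar>v l\<bar>) \<le> (\<Sum>l\<in>S. \<bar>v l\<bar>)"
    using le split[of "\<lambda>l. \<bar>\<alpha> l\<bar>"] split[of "\<lambda>l. \<bar>\<beta> l\<bar>"] by (simp add: sum.distrib)
  moreover have "(\<Sum>l\<in>Q \<union> L. \<bar>v l\<bar>) = (\<Sum>l\<in>Q - S. \<bar>v l\<bar>) + (\<Sum>l\<in>S. \<bar>v l\<bar>) + (\<Sum>l\<in>L. \<bar>v l\<bar>)"
    using fin disj split[of "\<lambda>l. \<bar>v l\<bar>"] by (simp add: sum.union_disjoint)
  moreover have "(\<Sum>l\<in>S \<union> L. \<bar>v l\<bar>) = (\<Sum>l\<in>S. \<bar>v l\<bar>) + (\<Sum>l\<in>L. \<bar>v l\<bar>)"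
    using fin S disj by (intro sum.union_disjoint) auto
  moreover have "0 \<le> (\<Sum>l\<in>L. \<bar>v l\<bar>)"
    by (auto intro: sum_nonneg)
  ultimately have "(\<Sum>l\<in>Q \<union> L. \<bar>v l\<bar>) \<le> 2 * (\<Sum>l\<in>S \<union> L. \<bar>v l\<bar>)"
    by linarith
  also have "(\<Sum>l\<in>S \<union> L. \<bar>v l\<bar>) \<le> sqrt (real (card (S \<union> L))) * L2_set v (S \<union> L)"
    by (rule sum_abs_le_L2_set)
  also have "\<dots> \<le> sqrt (real s) * L2_set v (Q \<union> L)"
  proof (intro mult_mono L2_set_nonneg)
    have "card (S \<union> L) \<le> s"
      using card_Un_le[of S L] s by (simp add: S_def)
    then show "sqrt (real (card (S \<union> L))) \<le> sqrt (real s)"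
      by simp
    show "L2_set v (S \<union> L) \<le> L2_set v (Q \<union> L)"
      unfolding L2_set_def using fin S by (intro real_sqrt_le_mono sum_mono2) auto
  qed simp
  finally show ?thesis
    by simp
qed

subsection \<open>Existence of a solution\<close>

lemma continuous_on_coordinate [continuous_intros]: "continuous_on S (\<lambda>\<alpha>::'i \<Rightarrow> real. \<alpha> l)"
  by (rule continuous_on_subset[OF continuous_on_product_coordinates]) simp

lemma feasible_iff_L2_set:
  "feasible n p \<Delta> f x0 Y \<eta> \<alpha> \<longleftrightarrow>
     L2_set (\<lambda>i. (\<Sum>l\<in>Q_idx n \<union> L_idx n. psi \<Delta> l (Y i) * \<alpha> l) - f (vadd n (Y i) x0)) {1..p} \<le> \<eta>"
  by (simp add: feasible_def norm2_def interp_matrix_def sum_idx_split)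

text \<open>The objective does not control the unpenalized coefficients; the lower bound \<open>lower\<close> applied to
  vectors supported on \<open>L_idx n\<close> does.\<close>
lemma is_solution_exists:
  assumes feas: "feasible n p \<Delta> f x0 Y \<eta> \<alpha>0" and K: "K \<ge> 0"
    and lower: "\<And>v. (\<Sum>l\<in>Q_idx n \<union> L_idx n. \<bar>v l\<bar>) \<le> 2 * sqrt (real (n + 1)) * L2_set v (Q_idx n \<union> L_idx n) \<Longrightarrow>
      L2_set v (Q_idx n \<union> L_idx n) \<le> K * L2_set (\<lambda>i. \<Sum>l\<in>Q_idx n \<union> L_idx n. psi \<Delta> l (Y i) * v l) {1..p}"
  shows "\<exists>\<alpha>. is_solution n p \<Delta> f x0 Y \<eta> \<alpha>"
proof -
  let ?I = "Q_idx n \<union> L_idx n"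
  define J where "J \<beta> = (\<Sum>l\<in>Q_idx n. \<bar>\<beta> l\<bar>)" for \<beta> :: "psi_name \<Rightarrow> real"
  define c where "c = J \<alpha>0"
  \<comment> \<open>Bounds the sampled values of the linear part alone: residual, data, and a
    quadratic part whose coefficients are at most \<open>c\<close>.\<close>
  define \<rho>0 where "\<rho>0 = \<eta> + L2_set (\<lambda>i. f (vadd n (Y i) x0)) {1..p} + (\<Sum>i\<in>{1..p}. \<Sum>l\<in>Q_idx n. \<bar>psi \<Delta> l (Y i)\<bar> * c)"
  define \<rho> where "\<rho> = max c (K * \<rho>0)"
  \<comment> \<open>Names outside the index set influence neither constraint nor objective. Pinning
    them to 0 makes the box compact in the product topology over all names, and \<open>trunc\<close>
    moves a competitor into it.\<close>
  define C where "C = (\<Pi>\<^sub>E l\<in>UNIV. if l \<in> ?I then {-\<rho>..\<rho>} else {0})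
    \<inter> {\<alpha>. feasible n p \<Delta> f x0 Y \<eta> \<alpha>}"
  define trunc where "trunc \<beta> l = (if l \<in> ?I then \<beta> l else 0)" for \<beta> :: "psi_name \<Rightarrow> real" and l
  have trunc: "feasible n p \<Delta> f x0 Y \<eta> (trunc \<beta>) \<longleftrightarrow> feasible n p \<Delta> f x0 Y \<eta> \<beta>" "J (trunc \<beta>) = J \<beta>" for \<beta>
  proof -
    have "(\<Sum>l\<in>?I. c l * trunc \<beta> l) = (\<Sum>l\<in>?I. c l * \<beta> l)" for c :: "psi_name \<Rightarrow> real"
      by (intro sum.cong) (auto simp: trunc_def)
    then show "feasible n p \<Delta> f x0 Y \<eta> (trunc \<beta>) \<longleftrightarrow> feasible n p \<Delta> f x0 Y \<eta> \<beta>"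
      by (simp add: feasible_iff_L2_set)
    show "J (trunc \<beta>) = J \<beta>"
      unfolding J_def by (intro sum.cong) (auto simp: trunc_def)
  qed
  have trunc_C: "trunc \<beta> \<in> C" if \<beta>: "feasible n p \<Delta> f x0 Y \<eta> \<beta>" "J \<beta> \<le> c" for \<beta>
  proof -
    have Q: "\<bar>\<beta> l\<bar> \<le> c" if "l \<in> Q_idx n" for l
      using member_le_sum[of l "Q_idx n" "\<lambda>l. \<bar>\<beta> l\<bar>"] that \<beta>(2) by (simp add: J_def)
    \<comment> \<open>The unpenalized part has at most n + 1 nonzero entries, so Cauchy-Schwarz
      alone puts it in the cone of the lower bound.\<close>
    define v where "v l = (if l \<in> L_idx n then \<beta> l else 0)" for l
    have vQ: "v l = 0" if "l \<in> Q_idx n" for l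
    proof -
      have "l \<notin> L_idx n"
        using that Q_L_disjoint[of n] by blast
      then show ?thesis
        by (simp add: v_def)
    qed
    have "L2_set v (L_idx n) \<le> L2_set v ?I"
      unfolding L2_set_def by (intro real_sqrt_le_mono sum_mono2) auto
    have "(\<Sum>l\<in>?I. \<bar>v l\<bar>) = (\<Sum>l\<in>L_idx n. \<bar>v l\<bar>)"
      by (simp add: sum_idx_split vQ)
    also have "\<dots> \<le> sqrt (real (n + 1)) * L2_set v (L_idx n)"
      using sum_abs_le_L2_set[of v "L_idx n"] by (simp add: card_L_idx)
    also have "\<dots> \<le> sqrt (real (n + 1)) * L2_set v ?I"
      using \<open>L2_set v (L_idx n) \<le> L2_set v ?I\<close> by (intro mult_left_mono) auto
    also have "\<dots> \<le> 2 * sqrt (real (n + 1)) * L2_set v ?I"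
      by (intro mult_right_mono) auto
    finally have "L2_set v ?I \<le> K * L2_set (\<lambda>i. \<Sum>l\<in>?I. psi \<Delta> l (Y i) * v l) {1..p}"
      by (rule lower)
    also have "\<dots> \<le> K * \<rho>0"
    proof (intro mult_left_mono K)
      define u1 where "u1 i = (\<Sum>l\<in>?I. psi \<Delta> l (Y i) * \<beta> l) - f (vadd n (Y i) x0)" for i
      define u2 where "u2 i = f (vadd n (Y i) x0)" for i
      define u3 where "u3 i = - (\<Sum>l\<in>Q_idx n. psi \<Delta> l (Y i) * \<beta> l)" for i
      have "(\<Sum>l\<in>?I. psi \<Delta> l (Y i) * v l) = u1 i + (u2 i + u3 i)" for i
        unfolding u1_def u2_def u3_def sum_idx_split by (simp add: vQ) (simp add: v_def)
      then have "L2_set (\<lambda>i. \<Sum>l\<in>?I. psi \<Delta> l (Y i) * v l) {1..p} = L2_set (\<lambda>i. u1 i + (u2 i + u3 i)) {1..p}"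
        by simp
      also have "\<dots> \<le> L2_set u1 {1..p} + (L2_set u2 {1..p} + L2_set u3 {1..p})"
        by (intro order_trans[OF L2_set_triangle_ineq] add_left_mono L2_set_triangle_ineq)
      also have "L2_set u1 {1..p} \<le> \<eta>"
        using \<beta>(1) unfolding feasible_iff_L2_set u1_def .
      also have "L2_set u3 {1..p} \<le> (\<Sum>i\<in>{1..p}. \<bar>u3 i\<bar>)"
        by (rule L2_set_le_sum_abs)
      also have "\<dots> \<le> (\<Sum>i\<in>{1..p}. \<Sum>l\<in>Q_idx n. \<bar>psi \<Delta> l (Y i)\<bar> * c)"
        unfolding u3_def abs_minus_cancel
        by (intro sum_mono order_trans[OF sum_abs]) (auto simp: abs_mult intro!: mult_left_mono Q)
      finally show "L2_set (\<lambda>i. \<Sum>l\<in>?I. psi \<Delta> l (Y i) * v l) {1..p} \<le> \<rho>0"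
        by (simp add: \<rho>0_def u2_def)
    qed
    finally have L: "\<bar>\<beta> l\<bar> \<le> K * \<rho>0" if "l \<in> L_idx n" for l
      using that member_le_L2_set[of ?I l "\<lambda>l. \<bar>v l\<bar>"] by (simp add: v_def L2_set_def split: if_splits)
    have "\<bar>\<beta> l\<bar> \<le> \<rho>" if "l \<in> ?I" for l
      using Q L that by (auto simp: \<rho>_def le_max_iff_disj)
    then show ?thesis
      using \<beta>(1) trunc(1) by (auto simp: C_def trunc_def abs_le_iff minus_le_iff)
  qed
  have "compact (\<Pi>\<^sub>E l\<in>(UNIV::psi_name set). if l \<in> ?I then {-\<rho>..\<rho>} else {0})"
    using compactin_PiE[of "\<lambda>_. euclidean" UNIV "\<lambda>l. if l \<in> ?I then {-\<rho>..\<rho>} else {0}"]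
    by (simp add: euclidean_product_topology)
  moreover have "closed {\<alpha>. feasible n p \<Delta> f x0 Y \<eta> \<alpha>}"
    unfolding feasible_iff_L2_set L2_set_def
    by (intro closed_Collect_le continuous_intros)
  ultimately have "compact C"
    unfolding C_def by (rule compact_Int_closed)
  moreover have "trunc \<alpha>0 \<in> C"
    using feas by (rule trunc_C) (simp add: c_def)
  moreover have "continuous_on C J"
    unfolding J_def by (intro continuous_intros)
  ultimately obtain \<alpha> where \<alpha>: "\<alpha> \<in> C" "\<And>\<beta>. \<beta> \<in> C \<Longrightarrow> J \<alpha> \<le> J \<beta>"
    using continuous_attains_inf[of C J] by blast
  \<comment> \<open>A competitor with objective at most \<open>c\<close> has its truncation in
    \<open>C\<close>; any other loses already against \<open>\<alpha>0\<close>.\<close>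
  have "J \<alpha> \<le> J \<beta>" if "feasible n p \<Delta> f x0 Y \<eta> \<beta>" for \<beta>
  proof (cases "J \<beta> \<le> c")
    case True
    then show ?thesis
      using \<alpha>(2)[OF trunc_C[OF that]] trunc(2) by simp
  next
    case False
    then show ?thesis
      using \<alpha>(2)[OF \<open>trunc \<alpha>0 \<in> C\<close>] trunc(2)[of \<alpha>0] by (simp add: c_def)
  qed
  then show ?thesis
    using \<alpha>(1) unfolding is_solution_def is_arg_min_def J_def C_def
    by (intro exI[of _ \<alpha>]) (auto simp: not_less)
qed

subsection \<open>Perturbation of fully quadratic models\<close>

lemma C2_quad:
  assumes A: "\<And>i j. A i j = A j i" and m: "\<And>y. y \<in> Rn n \<Longrightarrow> m y = quad_fun n c b A z y"
  shows "C2 n m" "hessian_lipschitz_on n 0 (Rn n) m"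
proof -
  note q = quad_fun_gradient_hessian[where m=m and n=n and A=A and c=c and b=b and z=z, OF A m, simplified]
  have hess: "hessian n m x i j = A i j" if "x \<in> Rn n" "i \<in> {1..n}" "j \<in> {1..n}" for x i j
    using q(4)[of x i] that by simp
  have "continuous_on (Rn n) (\<lambda>x. hessian n m x i j)" if "i \<in> {1..n}" "j \<in> {1..n}" for i j
    using that by (intro continuous_on_eq[OF continuous_on_const[of _ "A i j"]]) (auto simp: hess)
  moreover have "twice_differentiable_on n (Rn n) m"
    unfolding twice_differentiable_on_def by (intro ballI conjI; rule exI, rule q) auto
  ultimately show "C2 n m"
    by (simp add: C2_def)
  have "spectral_norm n (\<lambda>i j. hessian n m x i j - hessian n m y i j) \<le> 0" if "x \<in> Rn n" "y \<in> Rn n" for x y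
    using that by (intro order_trans[OF spectral_norm_le_sum]) (simp add: hess)
  then show "hessian_lipschitz_on n 0 (Rn n) m"
    by (simp add: hessian_lipschitz_on_def)
qed

lemma abs_hess_coeff_diff_le:
  assumes \<Delta>: "\<Delta> > 0" and V: "\<And>l. l \<in> Q_idx n \<union> L_idx n \<Longrightarrow> \<bar>\<alpha> l - \<beta> l\<bar> \<le> V"
    and ij: "i \<in> {1..n}" "j \<in> {1..n}"
  shows "\<bar>hess_coeff \<Delta> \<alpha> i j - hess_coeff \<Delta> \<beta> i j\<bar> \<le> 7 * V / \<Delta>\<^sup>2"
proof -
  \<comment> \<open>45 is at most 49.\<close>
  have "3 * sqrt 5 \<le> (7::real)"
    by (rule power2_le_imp_le) (simp_all add: power_mult_distrib)
  then have c: "\<bar>3 * sqrt 5 / \<Delta>\<^sup>2\<bar> \<le> 7 / \<Delta>\<^sup>2" "\<bar>3 / \<Delta>\<^sup>2\<bar> \<le> 7 / \<Delta>\<^sup>2"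
    by (simp_all add: divide_right_mono)
  show ?thesis
  proof (cases "i = j")
    case True
    with ij have "\<bar>\<alpha> (Sq i) - \<beta> (Sq i)\<bar> \<le> V"
      by (intro V) (auto simp: Q_idx_def)
    with c(1) have "\<bar>3 * sqrt 5 / \<Delta>\<^sup>2\<bar> * \<bar>\<alpha> (Sq i) - \<beta> (Sq i)\<bar> \<le> 7 / \<Delta>\<^sup>2 * V"
      by (intro mult_mono) auto
    moreover have "hess_coeff \<Delta> \<alpha> i j - hess_coeff \<Delta> \<beta> i j = 3 * sqrt 5 / \<Delta>\<^sup>2 * (\<alpha> (Sq i) - \<beta> (Sq i))"
      using True by (simp add: hess_coeff_def right_diff_distrib)
    ultimately show ?thesis
      by (simp only: abs_mult) simp
  next
    case False
    with ij have "\<bar>\<alpha> (Mixed (min i j) (max i j)) - \<beta> (Mixed (min i j) (max i j))\<bar> \<le> V"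
      by (intro V) (auto simp: Q_idx_def min_def max_def)
    with c(2) have "\<bar>3 / \<Delta>\<^sup>2\<bar> * \<bar>\<alpha> (Mixed (min i j) (max i j)) - \<beta> (Mixed (min i j) (max i j))\<bar> \<le> 7 / \<Delta>\<^sup>2 * V"
      by (intro mult_mono) auto
    moreover have "hess_coeff \<Delta> \<alpha> i j - hess_coeff \<Delta> \<beta> i j = 3 / \<Delta>\<^sup>2 * (\<alpha> (Mixed (min i j) (max i j)) - \<beta> (Mixed (min i j) (max i j)))"
      using False by (simp add: hess_coeff_def right_diff_distrib)
    ultimately show ?thesis
      by (simp only: abs_mult) simp
  qed
qed

lemma vsub_in_cube:
  assumes "n \<ge> 1" "x \<in> B_inf n x0 \<Delta>"
  shows "vsub n x x0 \<in> {1..n} \<rightarrow>\<^sub>E {-\<Delta>..\<Delta>}"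
proof -
  have "\<bar>x i - x0 i\<bar> \<le> \<Delta>" if "i \<in> {1..n}" for i
    using assms that unfolding B_inf_def norm_inf_def vsub_def
    by (auto simp: Max_le_iff)
  then have "x i - x0 i \<in> {-\<Delta>..\<Delta>}" if "i \<in> {1..n}" for i
    using that by (fastforce simp: abs_le_iff)
  then show ?thesis
    unfolding vsub_def by (intro restrict_PiE_iff[THEN iffD2]) blast
qed

text \<open>On the ball the basis elements are of order 1, their gradients of order 1 / \<Delta> and
  their Hessians of order 1 / \<Delta>^2. A coefficient error of order \<Delta>^3 therefore produces
  precisely the three orders that a fully quadratic model tolerates.\<close>

lemma fully_quadratic_model_perturb:
  assumes n: "n \<ge> 1" and \<Delta>: "\<Delta> > 0"
    and model: "fully_quadratic_model n f m x0 \<Delta> \<kappa>ef \<kappa>eg \<kappa>eh 0"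
    and m: "\<And>x. m x = quad_poly n \<Delta> \<beta> (vsub n x x0)"
    and close: "\<And>l. l \<in> Q_idx n \<union> L_idx n \<Longrightarrow> \<bar>\<alpha> l - \<beta> l\<bar> \<le> K * \<Delta> ^ 3"
  shows "fully_quadratic_model n f (\<lambda>x. quad_poly n \<Delta> \<alpha> (vsub n x x0)) x0 \<Delta>
    (\<kappa>ef + 3 * real (card (Q_idx n \<union> L_idx n)) * K) (\<kappa>eg + real n * (2 + 7 * real n) * K)
    (\<kappa>eh + 7 * real n * real n * K) 0"
proof -
  let ?I = "Q_idx n \<union> L_idx n"
  define V where "V = K * \<Delta> ^ 3"
  have close: "\<bar>\<alpha> l - \<beta> l\<bar> \<le> V" if "l \<in> ?I" for l
    using close[OF that] by (simp add: V_def)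
  have "Const \<in> ?I"
    by (simp add: L_idx_def)
  then have V: "V \<ge> 0"
    using close[of Const] by linarith
  define m' where "m' = (\<lambda>x. quad_poly n \<Delta> \<alpha> (vsub n x x0))"
  have m_quad: "m y = quad_fun n (\<beta> Const - sqrt 5 / 2 * (\<Sum>i\<in>{1..n}. \<beta> (Sq i)))
     (\<lambda>i. sqrt 3 / \<Delta> * \<beta> (Lin i)) (hess_coeff \<Delta> \<beta>) x0 y" for y
    by (simp add: m quad_poly_shift_eq_quad_fun)
  have m'_quad: "m' y = quad_fun n (\<alpha> Const - sqrt 5 / 2 * (\<Sum>i\<in>{1..n}. \<alpha> (Sq i)))
     (\<lambda>i. sqrt 3 / \<Delta> * \<alpha> (Lin i)) (hess_coeff \<Delta> \<alpha>) x0 y" for y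
    by (simp add: m'_def quad_poly_shift_eq_quad_fun)
  note q = quad_fun_gradient_hessian[OF hess_coeff_sym m_quad] quad_fun_gradient_hessian[OF hess_coeff_sym m'_quad]
  define H where "H i j = hess_coeff \<Delta> \<beta> i j - hess_coeff \<Delta> \<alpha> i j" for i j
  have H: "\<bar>H i j\<bar> \<le> 7 * V / \<Delta>\<^sup>2" if "i \<in> {1..n}" "j \<in> {1..n}" for i j
    using abs_hess_coeff_diff_le[OF \<Delta> close that] by (simp add: H_def abs_minus_commute)
  have "spectral_norm n (\<lambda>i j. hessian n f x i j - hessian n m' x i j) \<le> (\<kappa>eh + 7 * real n * real n * K) * \<Delta>
      \<and> norm2 n (vsub n (gradient n f x) (gradient n m' x)) \<le> (\<kappa>eg + real n * (2 + 7 * real n) * K) * \<Delta>\<^sup>2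
      \<and> \<bar>f x - m' x\<bar> \<le> (\<kappa>ef + 3 * real (card ?I) * K) * \<Delta> ^ 3"
    if x: "x \<in> B_inf n x0 \<Delta>" for x
  proof -
    have xR: "x \<in> Rn n"
      using x by (simp add: B_inf_def)
    have cube: "vsub n x x0 \<in> {1..n} \<rightarrow>\<^sub>E {-\<Delta>..\<Delta>}"
      using n x by (rule vsub_in_cube)
    have xi: "\<bar>x i - x0 i\<bar> \<le> \<Delta>" if "i \<in> {1..n}" for i
      using PiE_mem[OF cube that] that by (auto simp: vsub_def abs_le_iff)
    have f: "spectral_norm n (\<lambda>i j. hessian n f x i j - hessian n m x i j) \<le> \<kappa>eh * \<Delta>"
      "norm2 n (vsub n (gradient n f x) (gradient n m x)) \<le> \<kappa>eg * \<Delta>\<^sup>2"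
      "\<bar>f x - m x\<bar> \<le> \<kappa>ef * \<Delta> ^ 3"
      using model x unfolding fully_quadratic_model_def by auto
    have "spectral_norm n (\<lambda>i j. hessian n f x i j - hessian n m' x i j) \<le>
        spectral_norm n (\<lambda>i j. hessian n f x i j - hessian n m x i j) + spectral_norm n H"
      using q(4,8)[OF xR] by (intro spectral_norm_add_le) (simp add: H_def)
    moreover have "spectral_norm n H \<le> 7 * real n * real n * K * \<Delta>"
    proof -
      have "spectral_norm n H \<le> (\<Sum>i\<in>{1..n}. \<Sum>j\<in>{1..n}. 7 * V / \<Delta>\<^sup>2)"
        by (intro order_trans[OF spectral_norm_le_sum] sum_mono H)
      also have "\<dots> = 7 * real n * real n * K * \<Delta>"
        using \<Delta> by (simp add: V_def power2_eq_square power3_eq_cube)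
      finally show ?thesis .
    qed
    ultimately have 1: "spectral_norm n (\<lambda>i j. hessian n f x i j - hessian n m' x i j) \<le> (\<kappa>eh + 7 * real n * real n * K) * \<Delta>"
      using f(1) by (simp add: distrib_right)
    have "norm2 n (vsub n (gradient n m x) (gradient n m' x)) \<le> (\<Sum>i\<in>{1..n}. (2 + 7 * real n) * V / \<Delta>)"
    proof (intro order_trans[OF norm2_le_sum_abs] sum_mono)
      fix i assume i: "i \<in> {1..n}"
      have s3: "sqrt 3 \<le> (2::real)"
        by (rule real_le_lsqrt) auto
      have "\<bar>\<beta> (Lin i) - \<alpha> (Lin i)\<bar> \<le> V"
        using close[of "Lin i"] i by (auto simp: L_idx_def abs_minus_commute)
      then have lin: "\<bar>sqrt 3 / \<Delta> * (\<beta> (Lin i) - \<alpha> (Lin i))\<bar> \<le> 2 / \<Delta> * V"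
        unfolding abs_mult using \<Delta> s3 by (intro mult_mono) (auto simp: divide_right_mono)
      have "\<bar>\<Sum>j\<in>{1..n}. H i j * (x j - x0 j)\<bar> \<le> (\<Sum>j\<in>{1..n}. 7 * V / \<Delta>\<^sup>2 * \<Delta>)"
      proof (intro order_trans[OF sum_abs] sum_mono)
        fix j assume j: "j \<in> {1..n}"
        show "\<bar>H i j * (x j - x0 j)\<bar> \<le> 7 * V / \<Delta>\<^sup>2 * \<Delta>"
          unfolding abs_mult using V by (intro mult_mono H[OF i j] xi[OF j]) auto
      qed
      also have "\<dots> = 7 * real n * V / \<Delta>"
        using \<Delta> by (simp add: power2_eq_square)
      finally have "\<bar>\<Sum>j\<in>{1..n}. H i j * (x j - x0 j)\<bar> \<le> 7 * real n * V / \<Delta>" .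
      with lin have "\<bar>sqrt 3 / \<Delta> * (\<beta> (Lin i) - \<alpha> (Lin i)) + (\<Sum>j\<in>{1..n}. H i j * (x j - x0 j))\<bar>
          \<le> 2 / \<Delta> * V + 7 * real n * V / \<Delta>"
        by (intro order_trans[OF abs_triangle_ineq] add_mono)
      moreover have "vsub n (gradient n m x) (gradient n m' x) i =
          sqrt 3 / \<Delta> * (\<beta> (Lin i) - \<alpha> (Lin i)) + (\<Sum>j\<in>{1..n}. H i j * (x j - x0 j))"
        unfolding q(2,6)[OF xR] using i
        by (simp add: vsub_def H_def left_diff_distrib right_diff_distrib sum_subtractf diff_divide_distrib)
      ultimately have "\<bar>vsub n (gradient n m x) (gradient n m' x) i\<bar> \<le> 2 / \<Delta> * V + 7 * real n * V / \<Delta>"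
        by simp
      then show "\<bar>vsub n (gradient n m x) (gradient n m' x) i\<bar> \<le> (2 + 7 * real n) * V / \<Delta>"
        by (simp add: distrib_right add_divide_distrib)
    qed
    also have "\<dots> = real n * (2 + 7 * real n) * K * \<Delta>\<^sup>2"
      using \<Delta> by (simp add: V_def power2_eq_square power3_eq_cube)
    finally have 2: "norm2 n (vsub n (gradient n f x) (gradient n m' x)) \<le> (\<kappa>eg + real n * (2 + 7 * real n) * K) * \<Delta>\<^sup>2"
      using f(2) norm2_vsub_triangle[of n "gradient n f x" "gradient n m' x" "gradient n m x"]
      by (simp add: distrib_right)
    have "m x - m' x = (\<Sum>l\<in>?I. (\<beta> l - \<alpha> l) * psi \<Delta> l (vsub n x x0))"
      by (simp add: m m'_def quad_poly_def left_diff_distrib sum_subtractf)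
    also have "\<bar>\<dots>\<bar> \<le> (\<Sum>l\<in>?I. V * 3)"
      using V close
      by (intro order_trans[OF sum_abs] sum_mono)
         (auto simp: abs_mult abs_minus_commute intro!: mult_mono abs_psi_le[OF \<Delta> cube])
    also have "\<dots> = 3 * real (card ?I) * K * \<Delta> ^ 3"
      by (simp add: V_def)
    finally have 3: "\<bar>f x - m' x\<bar> \<le> (\<kappa>ef + 3 * real (card ?I) * K) * \<Delta> ^ 3"
      using f(3) by (simp add: distrib_right)
    show ?thesis
      using 1 2 3 by blast
  qed
  then show ?thesis
    using C2_quad[OF hess_coeff_sym m'_quad] unfolding fully_quadratic_model_def m'_def[symmetric] by blast
qed

subsection \<open>Recovery\<close>

lemma L2_set_le_sqrt_card:
  assumes "\<And>i. i \<in> A \<Longrightarrow> \<bar>u i\<bar> \<le> c" "0 \<le> c"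
  shows "L2_set u A \<le> sqrt (real (card A)) * c"
proof -
  have "L2_set u A = L2_set (\<lambda>i. \<bar>u i\<bar>) A"
    by (simp add: L2_set_def)
  also have "\<dots> \<le> L2_set (\<lambda>_. c) A"
    using assms by (intro L2_set_mono) auto
  finally show ?thesis
    using assms(2) by (simp add: L2_set_constant)
qed

lemma vadd_in_ball:
  assumes "n \<ge> 1" "y \<in> {1..n} \<rightarrow>\<^sub>E {-\<Delta>..\<Delta>}"
  shows "vadd n y x0 \<in> B_inf n x0 \<Delta>" "vsub n (vadd n y x0) x0 = y"
proof -
  show eq: "vsub n (vadd n y x0) x0 = y"
    using assms(2) by (auto simp: vsub_def vadd_def fun_eq_iff PiE_iff extensional_def)
  have "\<bar>y i\<bar> \<le> \<Delta>" if "i \<in> {1..n}" for i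
    using PiE_mem[OF assms(2) that] by (auto simp: abs_le_iff)
  moreover have "vadd n y x0 \<in> Rn n"
    by (auto simp: vadd_def Rn_def)
  ultimately show "vadd n y x0 \<in> B_inf n x0 \<Delta>"
    using assms(1) by (simp add: B_inf_def eq norm_inf_def)
qed

text \<open>The deterministic content of the random event. It involves neither \<open>f\<close> nor
  \<open>x0\<close>, and existence and accuracy of minimizers hold for every such sample.\<close>

definition good_sample :: "nat \<Rightarrow> nat \<Rightarrow> real \<Rightarrow> nat \<Rightarrow> (nat \<Rightarrow> rvec) \<Rightarrow> bool" where
  "good_sample n p \<Delta> k Y \<longleftrightarrow>
    (\<forall>i\<in>{1..p}. Y i \<in> B_inf n (vzero n) \<Delta>) \<and>
    (\<forall>\<tau> \<in> {..<k} \<rightarrow>\<^sub>E (Q_idx n \<union> L_idx n) \<times> {1, -1}.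
      real p / 2 * (\<Sum>l\<in>Q_idx n \<union> L_idx n. (signed_count k \<tau> l)\<^sup>2)
        \<le> (\<Sum>i\<in>{1..p}. (quad_poly n \<Delta> (signed_count k \<tau>) (Y i))\<^sup>2))"

lemma good_sample_lower_bound:
  assumes n: "n \<ge> 1" and \<Delta>: "\<Delta> > 0" and p: "p \<ge> 1" and s: "s \<ge> 1"
    and good: "good_sample n p \<Delta> (1000 * s) Y"
    and v: "(\<Sum>l\<in>Q_idx n \<union> L_idx n. \<bar>v l\<bar>) \<le> 2 * sqrt (real s) * L2_set v (Q_idx n \<union> L_idx n)"
  shows "sqrt (real p) * L2_set v (Q_idx n \<union> L_idx n) \<le>
    4 * L2_set (\<lambda>i. \<Sum>l\<in>Q_idx n \<union> L_idx n. psi \<Delta> l (Y i) * v l) {1..p}"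
proof (rule restricted_lower_bound[where R="2 * sqrt (real s)" and k="1000 * s"])
  show "250 * (2 * sqrt (real s))\<^sup>2 \<le> real (1000 * s)"
    by (simp add: power_mult_distrib)
  show "\<bar>psi \<Delta> l (Y i)\<bar> \<le> 3" if "i \<in> {1..p}" "l \<in> Q_idx n \<union> L_idx n" for i l
    using good that unfolding good_sample_def by (intro abs_psi_le[OF \<Delta>, where n=n]) (auto simp: B_inf_vzero[OF n])
  fix \<tau> :: "nat \<Rightarrow> psi_name \<times> real"
  assume "\<tau> \<in> {..<1000 * s} \<rightarrow>\<^sub>E (Q_idx n \<union> L_idx n) \<times> {1, - 1}"
  then show "real p / 2 * (\<Sum>l\<in>Q_idx n \<union> L_idx n. (signed_count (1000 * s) \<tau> l)\<^sup>2)
      \<le> (\<Sum>i\<in>{1..p}. (\<Sum>l\<in>Q_idx n \<union> L_idx n. psi \<Delta> l (Y i) * signed_count (1000 * s) \<tau> l)\<^sup>2)"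
    using good unfolding good_sample_def quad_poly_def by (simp add: mult.commute)
qed (use p s v in auto)

text \<open>The difference of two feasible vectors has sampled norm at most 2 \<eta>; the lower
  bound contributes a factor 4, and \<open>sqrt p\<close> cancels. This is the origin of 8 times
  \<open>\<kappa>ef\<close>.\<close>

lemma good_sample_recovery:
  assumes n: "n \<ge> 1" and \<Delta>: "\<Delta> > 0" and p: "p \<ge> 1" and \<kappa>ef: "\<kappa>ef > 0"
    and level: "sparsity_level n f \<kappa>ef \<kappa>eg \<kappa>eh x0 \<Delta> h"
    and good: "good_sample n p \<Delta> (1000 * (h + n + 1)) Y"
  defines "\<eta> \<equiv> sqrt (real p) * \<kappa>ef * \<Delta> ^ 3"
  shows "\<exists>\<alpha>. is_solution n p \<Delta> f x0 Y \<eta> \<alpha>"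
    and "is_solution n p \<Delta> f x0 Y \<eta> \<alpha> \<Longrightarrow>
      fully_quadratic_model n f (\<lambda>x. quad_poly n \<Delta> \<alpha> (vsub n x x0)) x0 \<Delta>
        (\<kappa>ef + 3 * real (card (Q_idx n \<union> L_idx n)) * (8 * \<kappa>ef)) (\<kappa>eg + real n * (2 + 7 * real n) * (8 * \<kappa>ef))
        (\<kappa>eh + 7 * real n * real n * (8 * \<kappa>ef)) 0"
proof -
  let ?I = "Q_idx n \<union> L_idx n"
  obtain \<alpha>0 where sparse: "sparse_on (Q_idx n) h \<alpha>0"
    and model: "fully_quadratic_model n f (quad_poly n \<Delta> \<alpha>0) x0 \<Delta> \<kappa>ef \<kappa>eg \<kappa>eh 0"
    using level unfolding sparsity_level_def by blast
  obtain \<beta> where \<beta>: "\<And>l. l \<in> Q_idx n \<Longrightarrow> \<beta> l = \<alpha>0 l"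
    "\<And>x. quad_poly n \<Delta> \<alpha>0 x = quad_poly n \<Delta> \<beta> (vsub n x x0)"
    using quad_poly_translate[OF \<Delta>] by metis
  have "{l \<in> Q_idx n. \<beta> l \<noteq> 0} = {l \<in> Q_idx n. \<alpha>0 l \<noteq> 0}"
    using \<beta>(1) by auto
  then have card: "card {l \<in> Q_idx n. \<beta> l \<noteq> 0} + card (L_idx n) \<le> h + n + 1"
    using sparse by (simp add: sparse_on_def card_L_idx)
  have feas: "feasible n p \<Delta> f x0 Y \<eta> \<beta>"
  proof -
    have "\<bar>(\<Sum>l\<in>?I. psi \<Delta> l (Y i) * \<beta> l) - f (vadd n (Y i) x0)\<bar> \<le> \<kappa>ef * \<Delta> ^ 3" if "i \<in> {1..p}" for i
    proof -
      have Yi: "Y i \<in> {1..n} \<rightarrow>\<^sub>E {-\<Delta>..\<Delta>}"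
        using good that unfolding good_sample_def B_inf_vzero[OF n] by blast
      have "(\<Sum>l\<in>?I. psi \<Delta> l (Y i) * \<beta> l) = quad_poly n \<Delta> \<alpha>0 (vadd n (Y i) x0)"
        unfolding \<beta>(2) vadd_in_ball(2)[OF n Yi] by (simp add: quad_poly_def mult.commute)
      moreover have "\<bar>f (vadd n (Y i) x0) - quad_poly n \<Delta> \<alpha>0 (vadd n (Y i) x0)\<bar> \<le> \<kappa>ef * \<Delta> ^ 3"
        using model vadd_in_ball(1)[OF n Yi] unfolding fully_quadratic_model_def by blast
      ultimately show ?thesis
        by (simp add: abs_minus_commute)
    qed
    then have "L2_set (\<lambda>i. (\<Sum>l\<in>?I. psi \<Delta> l (Y i) * \<beta> l) - f (vadd n (Y i) x0)) {1..p}
        \<le> sqrt (real (card {1..p})) * (\<kappa>ef * \<Delta> ^ 3)"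
      using \<kappa>ef \<Delta> by (intro L2_set_le_sqrt_card) auto
    then show ?thesis
      by (simp add: feasible_iff_L2_set \<eta>_def mult.assoc)
  qed
  note lower = good_sample_lower_bound[OF n \<Delta> p _ good]
  show "\<exists>\<alpha>. is_solution n p \<Delta> f x0 Y \<eta> \<alpha>"
  \<comment> \<open>The cone for n + 1 is contained in the one for h + n + 1, and
    \<open>sqrt p\<close> is at least 1, so the factor 4 serves here as well.\<close>
  proof (rule is_solution_exists[OF feas, where K=4])
    fix v :: "psi_name \<Rightarrow> real"
    assume "(\<Sum>l\<in>?I. \<bar>v l\<bar>) \<le> 2 * sqrt (real (n + 1)) * L2_set v ?I"
    also have "\<dots> \<le> 2 * sqrt (real (h + n + 1)) * L2_set v ?I"
      by (intro mult_right_mono mult_left_mono) auto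
    finally have "sqrt (real p) * L2_set v ?I \<le> 4 * L2_set (\<lambda>i. \<Sum>l\<in>?I. psi \<Delta> l (Y i) * v l) {1..p}"
      by (intro lower) auto
    moreover have "1 * L2_set v ?I \<le> sqrt (real p) * L2_set v ?I"
      using p by (intro mult_right_mono) auto
    ultimately show "L2_set v ?I \<le> 4 * L2_set (\<lambda>i. \<Sum>l\<in>?I. psi \<Delta> l (Y i) * v l) {1..p}"
      by linarith
  qed simp
  assume sol: "is_solution n p \<Delta> f x0 Y \<eta> \<alpha>"
  define v where "v l = \<alpha> l - \<beta> l" for l
  have "(\<Sum>l\<in>Q_idx n. \<bar>\<alpha> l\<bar>) \<le> (\<Sum>l\<in>Q_idx n. \<bar>\<beta> l\<bar>)" and feas\<alpha>: "feasible n p \<Delta> f x0 Y \<eta> \<alpha>"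
    using sol feas unfolding is_solution_def is_arg_min_def by (auto simp: not_less)
  then have "(\<Sum>l\<in>?I. \<bar>v l\<bar>) \<le> 2 * sqrt (real (h + n + 1)) * L2_set v ?I"
    unfolding v_def by (intro l1_cone card) auto
  then have "sqrt (real p) * L2_set v ?I \<le> 4 * L2_set (\<lambda>i. \<Sum>l\<in>?I. psi \<Delta> l (Y i) * v l) {1..p}"
    by (intro lower) auto
  also have "L2_set (\<lambda>i. \<Sum>l\<in>?I. psi \<Delta> l (Y i) * v l) {1..p} \<le> \<eta> + \<eta>"
  proof -
    define r where "r \<gamma> i = (\<Sum>l\<in>?I. psi \<Delta> l (Y i) * \<gamma> l) - f (vadd n (Y i) x0)" for \<gamma> i
    have "(\<lambda>i. \<Sum>l\<in>?I. psi \<Delta> l (Y i) * v l) = (\<lambda>i. r \<alpha> i + - r \<beta> i)"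
      by (simp add: r_def v_def right_diff_distrib sum_subtractf)
    then have "L2_set (\<lambda>i. \<Sum>l\<in>?I. psi \<Delta> l (Y i) * v l) {1..p} \<le> L2_set (r \<alpha>) {1..p} + L2_set (\<lambda>i. - r \<beta> i) {1..p}"
      using L2_set_triangle_ineq[of "r \<alpha>" "\<lambda>i. - r \<beta> i"] by simp
    moreover have "L2_set (\<lambda>i. - r \<beta> i) {1..p} = L2_set (r \<beta>) {1..p}"
      by (simp add: L2_set_def)
    ultimately show ?thesis
      using feas feas\<alpha> unfolding feasible_iff_L2_set r_def by linarith
  qed
  finally have "sqrt (real p) * L2_set v ?I \<le> sqrt (real p) * (8 * \<kappa>ef * \<Delta> ^ 3)"
    by (simp add: \<eta>_def mult_ac)
  then have V: "L2_set v ?I \<le> 8 * \<kappa>ef * \<Delta> ^ 3"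
    using p by simp
  show "fully_quadratic_model n f (\<lambda>x. quad_poly n \<Delta> \<alpha> (vsub n x x0)) x0 \<Delta>
        (\<kappa>ef + 3 * real (card ?I) * (8 * \<kappa>ef)) (\<kappa>eg + real n * (2 + 7 * real n) * (8 * \<kappa>ef))
        (\<kappa>eh + 7 * real n * real n * (8 * \<kappa>ef)) 0"
  proof (rule fully_quadratic_model_perturb[OF n \<Delta> model \<beta>(2)])
    fix l assume "l \<in> ?I"
    then have "\<bar>v l\<bar> \<le> L2_set (\<lambda>l. \<bar>v l\<bar>) ?I"
      by (intro member_le_L2_set) auto
    then show "\<bar>\<alpha> l - \<beta> l\<bar> \<le> 8 * \<kappa>ef * \<Delta> ^ 3"
      using V by (simp add: v_def L2_set_def)
  qed
qed

subsection \<open>Probability of a good sample\<close>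

lemma good_sample_probability:
  assumes n: "n \<ge> 1" and \<Delta>: "\<Delta> > 0"
  obtains E where "E \<in> sets (sample_measure n p \<Delta>)"
    and "measure (sample_measure n p \<Delta>) E \<ge>
      1 - (2 * real (card (Q_idx n \<union> L_idx n))) ^ k * exp (- real p / 69120)"
    and "\<And>Y. Y \<in> E \<Longrightarrow> good_sample n p \<Delta> k Y"
proof -
  \<comment> \<open>Counting words instead of the vectors they define gives (2 q)^k at once,
    although reordered words give the same vector.\<close>
  define N where "N = {..<k} \<rightarrow>\<^sub>E (Q_idx n \<union> L_idx n) \<times> {1, -1::real}"
  have "finite N"
    unfolding N_def by (intro finite_PiE) auto
  have "card (signed_count k ` N) \<le> card N"
    using \<open>finite N\<close> by (rule card_image_le)
  also have "card N = (2 * card (Q_idx n \<union> L_idx n)) ^ k"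
  proof -
    have "card ((Q_idx n \<union> L_idx n) \<times> {1, -1::real}) = 2 * card (Q_idx n \<union> L_idx n)"
      by (simp add: card_cartesian_product)
    then show ?thesis
      by (simp only: N_def card_funcsetE finite_lessThan card_lessThan)
  qed
  finally have "real (card (signed_count k ` N)) \<le> real ((2 * card (Q_idx n \<union> L_idx n)) ^ k)"
    by (simp only: of_nat_le_iff)
  then have card: "real (card (signed_count k ` N)) \<le> (2 * real (card (Q_idx n \<union> L_idx n))) ^ k"
    by simp
  obtain E where E: "E \<in> sets (sample_measure n p \<Delta>)"
    "measure (sample_measure n p \<Delta>) E \<ge> 1 - real (card (signed_count k ` N)) * exp (- real p / 69120)"
    "\<And>Y i. Y \<in> E \<Longrightarrow> i \<in> {1..p} \<Longrightarrow> Y i \<in> B_inf n (vzero n) \<Delta>"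
    "\<And>Y z. Y \<in> E \<Longrightarrow> z \<in> signed_count k ` N \<Longrightarrow>
      real p / 2 * (\<Sum>l\<in>Q_idx n \<union> L_idx n. (z l)\<^sup>2) \<le> (\<Sum>i\<in>{1..p}. (quad_poly n \<Delta> z (Y i))\<^sup>2)"
    using sample_measure_lower_bound[OF n \<Delta>, of "signed_count k ` N" p] \<open>finite N\<close> by blast
  have "real (card (signed_count k ` N)) * exp (- real p / 69120) \<le>
      (2 * real (card (Q_idx n \<union> L_idx n))) ^ k * exp (- real p / 69120)"
    using card by (intro mult_right_mono) auto
  with E(2) have "measure (sample_measure n p \<Delta>) E \<ge>
      1 - (2 * real (card (Q_idx n \<union> L_idx n))) ^ k * exp (- real p / 69120)"
    by linarith
  moreover have "good_sample n p \<Delta> k Y" if "Y \<in> E" for Y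
    using E(3,4)[OF that] unfolding good_sample_def N_def by blast
  ultimately show ?thesis
    using E(1) that by blast
qed

text \<open>Put X = s ln q. The hypothesis yields p \<ge> 180000000 X ln p, so both X and ln q ln p
  are at most p / 180000000. The net costs 2000 X and the target ln n ln p, together 2001 such
  units, while the tail gains p / 69120, about 2604 of them. This fixes the constant
  20000000.\<close>

lemma failure_probability_bound:
  fixes n p s :: nat and q :: real
  assumes n: "n \<ge> 1" "real n \<le> q" and q: "q \<ge> 3" and s: "s \<ge> 3"
    and p: "real p / ln (real p) \<ge> 9 * 20000000 * real s * (ln (real s))\<^sup>2 * ln q"
  shows "p \<ge> 1" and "(2 * q) ^ (1000 * s) * exp (- real p / 69120) < real n powr (- 1 * ln (real p))"
proof -
  have ln3: "1 \<le> ln x" if "3 \<le> x" for x :: real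
  proof -
    have "exp 1 \<le> x"
      using exp_le that by linarith
    then show ?thesis
      using that by (subst ln_ge_iff) auto
  qed
  define X where "X = real s * ln q"
  have lnq: "ln q \<ge> 1" and lns: "ln (real s) \<ge> 1"
    using q s by (auto intro!: ln3)
  have "1 \<le> (ln (real s))\<^sup>2"
    using lns by simp
  then have "X * 1 \<le> X * (ln (real s))\<^sup>2"
    using lnq by (intro mult_left_mono) (auto simp: X_def)
  then have pX: "real p / ln (real p) \<ge> 180000000 * X"
    using p by (simp add: X_def mult_ac)
  have "3 * 1 \<le> X"
    unfolding X_def using lnq s by (intro mult_mono) auto
  then have X: "X \<ge> 3" by simp
  \<comment> \<open>For p = 0 the numerator vanishes, and for p = 1 the division by
    \<open>ln 1 = 0\<close> yields 0, against a positive right-hand side.\<close>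
  have "p \<noteq> 0"
    by (rule notI) (use pX X in simp)
  moreover have "p \<noteq> 1"
    by (rule notI) (use pX X in simp)
  ultimately have p2: "p \<ge> 2" by simp
  then show "p \<ge> 1" by simp
  have "ln (real p) > 0"
    using p2 by simp
  with pX have pX': "real p \<ge> 180000000 * X * ln (real p)"
    by (simp add: le_divide_eq)
  \<comment> \<open>\<open>ln 2\<close> is below 1, so this value is excluded by hand before
    \<open>ln p \<ge> 1\<close> is available.\<close>
  have "p \<noteq> 2"
  proof
    assume "p = 2"
    have "1 \<le> ln ((2::real) ^ 2)"
      by (rule ln3) simp
    then have "1 / 2 \<le> ln (2::real)"
      using ln_realpow[of "2::real" 2] by simp
    then have "3 * (1 / 2) \<le> X * ln (2::real)"
      using X by (intro mult_mono) auto
    with pX' \<open>p = 2\<close> show False by simp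
  qed
  with p2 have lnp: "ln (real p) \<ge> 1"
    by (intro ln3) simp
  have "X * 1 \<le> X * ln (real p)"
    using lnp X by (intro mult_left_mono) auto
  then have 1: "180000000 * X \<le> real p"
    using pX' by (simp add: mult.assoc)
  \<comment> \<open>Here \<open>s\<close> is given up and the factor \<open>ln p\<close> kept; it
    absorbs the target probability.\<close>
  have "1 * (ln q * ln (real p)) \<le> real s * (ln q * ln (real p))"
    using s lnq lnp by (intro mult_right_mono) auto
  then have 2: "180000000 * (ln q * ln (real p)) \<le> real p"
    using pX' by (simp add: X_def mult_ac)
  have "ln (real n) * ln (real p) \<le> ln q * ln (real p)"
    using n q lnp by (intro mult_right_mono) auto
  moreover have "real (1000 * s) * ln (2 * q) \<le> 2000 * X"
  proof -
    have "ln (2 * q) = ln 2 + ln q"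
      using q by (simp add: ln_mult)
    also have "\<dots> \<le> 2 * ln q"
      using q by simp
    finally have "real (1000 * s) * ln (2 * q) \<le> real (1000 * s) * (2 * ln q)"
      by (intro mult_left_mono) auto
    then show ?thesis
      by (simp add: X_def)
  qed
  ultimately have key: "real (1000 * s) * ln (2 * q) - real p / 69120 < - (ln (real n) * ln (real p))"
    using 1 2 X by argo
  have "(2 * q) ^ (1000 * s) = exp (real (1000 * s) * ln (2 * q))"
    using q by (simp add: exp_of_nat_mult del: of_nat_mult)
  then have "(2 * q) ^ (1000 * s) * exp (- real p / 69120) = exp (real (1000 * s) * ln (2 * q) + - real p / 69120)"
    by (simp only: exp_add)
  also have "\<dots> < exp (- (ln (real n) * ln (real p)))"
    using key by (simp only: exp_less_cancel_iff)
  also have "\<dots> = real n powr (- 1 * ln (real p))"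
    using n by (simp add: powr_def mult.commute)
  finally show "(2 * q) ^ (1000 * s) * exp (- real p / 69120) < real n powr (- 1 * ln (real p))" .
qed

declare One_nat_def [simp]

theorem theorem4p5:
  shows "\<exists>c_partial::real. c_partial > 0 \<and> (\<exists>\<gamma>::real. \<gamma> > 0 \<and>
    (\<forall>(n::nat) (D::rvec set) (f::rvec \<Rightarrow> real) (\<kappa>ef'::real) (\<kappa>eg'::real) (\<kappa>eh'::real).
      n \<ge> 1 \<longrightarrow> D \<subseteq> Rn n \<longrightarrow> approx_hessian_sparsity n D f \<kappa>ef' \<kappa>eg' \<kappa>eh' \<longrightarrow>
      (\<exists>\<kappa>ef::real. \<exists>\<kappa>eg::real. \<exists>\<kappa>eh::real. \<kappa>ef > 0 \<and> \<kappa>eg > 0 \<and> \<kappa>eh > 0 \<and>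
        (\<forall>x0\<in>D. \<forall>\<Delta>>0. B_inf n x0 \<Delta> \<subseteq> D \<longrightarrow>
          (\<forall>h. sparsity_level n f \<kappa>ef' \<kappa>eg' \<kappa>eh' x0 \<Delta> h \<longrightarrow>
            (\<forall>p::nat. real p / ln (real p)
                \<ge> 9 * c_partial * real (h + n + 1) * (ln (real (h + n + 1))) ^ 2
                    * ln (real (n + 1) * real (n + 2) / 2) \<longrightarrow>
              (\<exists>E \<in> sets (sample_measure n p \<Delta>).
                measure (sample_measure n p \<Delta>) E > 1 - real n powr (- \<gamma> * ln (real p)) \<and>
                (\<forall>Y\<in>E.
                  (\<exists>\<alpha>. is_solution n p \<Delta> f x0 Y (sqrt (real p) * \<kappa>ef' * \<Delta> ^ 3) \<alpha>) \<and>
                  (\<forall>\<alpha>. is_solution n p \<Delta> f x0 Y (sqrt (real p) * \<kappa>ef' * \<Delta> ^ 3) \<alpha> \<longrightarrow>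
                    fully_quadratic_model n f (\<lambda>x. quad_poly n \<Delta> \<alpha> (vsub n x x0))
                      x0 \<Delta> \<kappa>ef \<kappa>eg \<kappa>eh 0)))))))))"
proof (rule exI[of _ "20000000::real"], rule conjI[rotated], rule exI[of _ "1::real"], rule conjI[rotated],
    intro allI impI)
  fix n :: nat and D :: "rvec set" and f :: "rvec \<Rightarrow> real" and \<kappa>ef' \<kappa>eg' \<kappa>eh' :: real
  assume n: "1 \<le> n" and "D \<subseteq> Rn n" and sparsity: "approx_hessian_sparsity n D f \<kappa>ef' \<kappa>eg' \<kappa>eh'"
  have pos: "\<kappa>ef' > 0" "\<kappa>eg' > 0" "\<kappa>eh' > 0"
    using sparsity by (simp_all add: approx_hessian_sparsity_def)
  define q where "q = real (n + 1) * real (n + 2) / 2"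
  have q: "real (card (Q_idx n \<union> L_idx n)) = q"
    by (simp only: card_idx q_def)
  have "2 * 3 \<le> real (n + 1) * real (n + 2)"
    using n by (intro mult_mono) auto
  then have q3: "3 \<le> q"
    by (simp add: q_def)
  have "real n * 2 \<le> real (n + 1) * real (n + 2)"
    by (intro mult_mono) auto
  then have nq: "real n \<le> q"
    by (simp add: q_def)
  \<comment> \<open>These values depend on n and the given constants only, and are fixed before
    \<open>x0\<close>, \<open>\<Delta>\<close>, \<open>h\<close> and \<open>p\<close>
    appear.\<close>
  define \<kappa>ef where "\<kappa>ef = \<kappa>ef' + 3 * real (card (Q_idx n \<union> L_idx n)) * (8 * \<kappa>ef')"
  define \<kappa>eg where "\<kappa>eg = \<kappa>eg' + real n * (2 + 7 * real n) * (8 * \<kappa>ef')"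
  define \<kappa>eh where "\<kappa>eh = \<kappa>eh' + 7 * real n * real n * (8 * \<kappa>ef')"
  show "\<exists>\<kappa>ef \<kappa>eg \<kappa>eh. \<kappa>ef > 0 \<and> \<kappa>eg > 0 \<and> \<kappa>eh > 0 \<and>
        (\<forall>x0\<in>D. \<forall>\<Delta>>0. B_inf n x0 \<Delta> \<subseteq> D \<longrightarrow>
          (\<forall>h. sparsity_level n f \<kappa>ef' \<kappa>eg' \<kappa>eh' x0 \<Delta> h \<longrightarrow>
            (\<forall>p::nat. real p / ln (real p)
                \<ge> 9 * 20000000 * real (h + n + 1) * (ln (real (h + n + 1))) ^ 2
                    * ln (real (n + 1) * real (n + 2) / 2) \<longrightarrow>
              (\<exists>E \<in> sets (sample_measure n p \<Delta>).
                measure (sample_measure n p \<Delta>) E > 1 - real n powr (- 1 * ln (real p)) \<and>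
                (\<forall>Y\<in>E.
                  (\<exists>\<alpha>. is_solution n p \<Delta> f x0 Y (sqrt (real p) * \<kappa>ef' * \<Delta> ^ 3) \<alpha>) \<and>
                  (\<forall>\<alpha>. is_solution n p \<Delta> f x0 Y (sqrt (real p) * \<kappa>ef' * \<Delta> ^ 3) \<alpha> \<longrightarrow>
                    fully_quadratic_model n f (\<lambda>x. quad_poly n \<Delta> \<alpha> (vsub n x x0))
                      x0 \<Delta> \<kappa>ef \<kappa>eg \<kappa>eh 0))))))"
  proof (rule exI[of _ \<kappa>ef], rule exI[of _ \<kappa>eg], rule exI[of _ \<kappa>eh], intro conjI ballI allI impI)
    show "\<kappa>ef > 0" "\<kappa>eg > 0" "\<kappa>eh > 0"
      unfolding \<kappa>ef_def \<kappa>eg_def \<kappa>eh_def using pos by (auto intro!: add_pos_nonneg mult_nonneg_nonneg)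
    fix x0 :: rvec and \<Delta> :: real and h p :: nat
    assume \<Delta>: "0 < \<Delta>" and level: "sparsity_level n f \<kappa>ef' \<kappa>eg' \<kappa>eh' x0 \<Delta> h"
      and "real p / ln (real p) \<ge> 9 * 20000000 * real (h + n + 1) * (ln (real (h + n + 1))) ^ 2
          * ln (real (n + 1) * real (n + 2) / 2)"
    moreover from level have "h + n + 1 \<ge> 3"
      using n by (auto simp: sparsity_level_def)
    ultimately have p: "1 \<le> p"
      and fail: "(2 * q) ^ (1000 * (h + n + 1)) * exp (- real p / 69120) < real n powr (- 1 * ln (real p))"
      using failure_probability_bound[OF n nq q3, of "h + n + 1" p] unfolding q_def by blast+
    obtain E where E: "E \<in> sets (sample_measure n p \<Delta>)"
      and prob: "measure (sample_measure n p \<Delta>) E \<ge> 1 - (2 * q) ^ (1000 * (h + n + 1)) * exp (- real p / 69120)"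
      and good: "\<And>Y. Y \<in> E \<Longrightarrow> good_sample n p \<Delta> (1000 * (h + n + 1)) Y"
      using good_sample_probability[OF n \<Delta>, of p "1000 * (h + n + 1)"] unfolding q by metis
    show "\<exists>E \<in> sets (sample_measure n p \<Delta>).
        measure (sample_measure n p \<Delta>) E > 1 - real n powr (- 1 * ln (real p)) \<and>
        (\<forall>Y\<in>E.
          (\<exists>\<alpha>. is_solution n p \<Delta> f x0 Y (sqrt (real p) * \<kappa>ef' * \<Delta> ^ 3) \<alpha>) \<and>
          (\<forall>\<alpha>. is_solution n p \<Delta> f x0 Y (sqrt (real p) * \<kappa>ef' * \<Delta> ^ 3) \<alpha> \<longrightarrow>
            fully_quadratic_model n f (\<lambda>x. quad_poly n \<Delta> \<alpha> (vsub n x x0))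
              x0 \<Delta> \<kappa>ef \<kappa>eg \<kappa>eh 0))"
    proof (intro bexI[of _ E] conjI ballI allI impI)
      \<comment> \<open>For n = 1 the bound reads: the event has positive probability.\<close>
      show "measure (sample_measure n p \<Delta>) E > 1 - real n powr (- 1 * ln (real p))"
        using prob fail by linarith
      show "\<exists>\<alpha>. is_solution n p \<Delta> f x0 Y (sqrt (real p) * \<kappa>ef' * \<Delta> ^ 3) \<alpha>" if "Y \<in> E" for Y
        using good_sample_recovery(1)[OF n \<Delta> p pos(1) level good[OF that]] .
      show "fully_quadratic_model n f (\<lambda>x. quad_poly n \<Delta> \<alpha> (vsub n x x0)) x0 \<Delta> \<kappa>ef \<kappa>eg \<kappa>eh 0"
        if "Y \<in> E" "is_solution n p \<Delta> f x0 Y (sqrt (real p) * \<kappa>ef' * \<Delta> ^ 3) \<alpha>" for Y \<alpha>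
        unfolding \<kappa>ef_def \<kappa>eg_def \<kappa>eh_def
        using good_sample_recovery(2)[OF n \<Delta> p pos(1) level good[OF that(1)] that(2)] .
    qed (rule E)
  qed
qed simp_all

end
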